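(* Let $m$ be an even positive integer, $p$ a positive divisor of $m$, and suppose that either $n\ge 3$, or $n=2$ and $p$ is odd. Let $c=(c_1,(c_\zeta)_{\zeta\in C_{m/p}\setminus\{1\}})$ be arbitrary complex parameters, and define $\underline c$ by $\underline c_1:=-c_1$ and $\underline c_\zeta:=-c_\zeta$ for all $\zeta\in C_{m/p}\setminus\{1\}$. Then there exists an isomorphism of associative algebras $$\phi\colon \underline H_{\underline c}(\mu(G(m,p,n)))\to (H_c(G(m,p,n)),\star)$$ from the negative braided Cherednik algebra to the $\mathcal F$-twisted rational Cherednik algebra such that $$\phi(\sigma_i)=\bar s_i,\qquad \phi(t)=t,\qquad \phi(\underline x_j)=x_j,\qquad \phi(\underline y_j)=y_j$$ for all $i\in[n-1]$, $j\in[n]$, $t\in T(m,p,n)$, where $\sigma_i:=\sigma_{i,i+1}^{(1)}$ and $\bar s_i:=s_{i,i+1}^{(-1)}$.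
   Context: Groups. $[n]=\{1,\dots,n\}$; $C_k\subset\mathbb C^\times$ is the group of $k$-th roots of unity. $V$ is a complex vector space with basis $x_1,\dots,x_n$, $V^*$ has the dual basis $y_1,\dots,y_n$; $\mathrm{GL}(V)$ acts on $V^*$ by $\langle g(y),x\rangle=\langle y,g^{-1}(x)\rangle$. $\mathbb S_n\subset\mathrm{GL}(V)$ is the group of permutation matrices, $T(m,p,n)$ is the group of diagonal matrices $t$ with $t^m=\mathrm{id}$ and $\det(t)\in C_{m/p}$, and $G(m,p,n)=\mathbb S_n\ltimes T(m,p,n)\subset\mathrm{GL}(V)$. For $m$ even, $\mu(G(m,p,n))=\{wt\mid w\in\mathbb S_n,\ t\in T(m,1,n),\ \det(wt)\in C_{m/p}\}$. For $\epsilon\in\mathbb C^\times$ and $i\ne j$, define elements of $\mathrm{GL}(V)$: $s_{ij}^{(\epsilon)}$: $x_i\mapsto\epsilon^{-1}x_j$, $x_j\mapsto\epsilon x_i$, $x_k\mapsto x_k$ ($k\ne i,j$); $\sigma_{ij}^{(\epsilon)}$: $x_i\mapsto\epsilon^{-1}x_j$, $x_j\mapsto-\epsilon x_i$, $x_k\mapsto x_k$ ($k\ne i,j$); $t_i^{(\epsilon)}$: $x_i\mapsto\epsilon x_i$, $x_k\mapsto x_k$ ($k\neq i$). Rational Cherednik algebra. $H_c(G(m,p,n))$ is the associative unital $\mathbb C$-algebra generated by $x_1,\dots,x_n\in V$, $y_1,\dots,y_n\in V^*$ and the group algebra of $G(m,p,n)$, subject to: $x_ix_j=x_jx_i$, $y_iy_j=y_jy_i$,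 $gx_i=g(x_i)g$, $gy_i=g(y_i)g$ for $g\in G(m,p,n)$; for $i\neq j$, $y_ix_j-x_jy_i=c_1\sum_{\epsilon\in C_m}\epsilon s_{ij}^{(\epsilon)}$; and $y_ix_i-x_iy_i=1-c_1\sum_{j\ne i}\sum_{\epsilon\in C_m}s_{ij}^{(\epsilon)}-\sum_{\zeta\in C_{m/p}\setminus\{1\}}c_\zeta t_i^{(\zeta)}$. Negative braided Cherednik algebra. For parameters $c'=(c'_1,(c'_\zeta))$, $\underline H_{c'}(\mu(G(m,p,n)))$ is the associative unital $\mathbb C$-algebra generated by a basis $\underline x_1,\dots,\underline x_n$ of $V$, the dual basis $\underline y_1,\dots,\underline y_n$ of $V^*$ and the group algebra of $\mu(G(m,p,n))$ (group elements act on the $\underline x_i$, $\underline y_i$ by the same formulas as on $x_i$, $y_i$), subject to: for $i\ne j$, $\underline x_i\underline x_j+\underline x_j\underline x_i=0$, $\underline y_i\underline y_j+\underline y_j\underline y_i=0$, $\underline y_i\underline x_j+\underline x_j\underline y_i=c'_1\sum_{\epsilon\in C_m}\epsilon\sigma_{ij}^{(\epsilon)}$; and for all $i$ and $g\in\mu(G(m,p,n))$, $g\underline x_i=g(\underline x_i)g$, $g\underline y_i=g(\underline y_i)g$, $\underline y_i\underline x_i-\underline x_i\underline y_i=1+c'_1\sum_{j\ne i}\sum_{\epsilon\in C_m}\sigma_{ij}^{(\epsilon)}+\sum_{\zeta\in C_{m/p}\setminus\{1\}}c'_\zeta t_i^{(\zeta)}$. Twist. $T=\langle\gamma_1,\dots,\gamma_n\mid\gamma_i^2=1,\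 \gamma_i\gamma_j=\gamma_j\gamma_i\rangle\cong(C_2)^n$ acts on $H_c(G(m,p,n))$ by algebra automorphisms with $\gamma_i\rhd g=t_i^{(-1)}gt_i^{(-1)}$ ($g\in G(m,p,n)$), $\gamma_i\rhd x_j=t_i^{(-1)}(x_j)$, $\gamma_i\rhd y_j=t_i^{(-1)}(y_j)$. Let $$f_{ij}=\tfrac12(1\otimes1+\gamma_i\otimes1+1\otimes\gamma_j-\gamma_i\otimes\gamma_j),\qquad \mathcal F=\prod_{1\le j<i\le n}f_{ij}\in\mathbb CT\otimes\mathbb CT,$$ which is a $2$-cocycle on the Hopf algebra $\mathbb CT$ with $\mathcal F^{-1}=\mathcal F$. The twisted algebra $(H_c(G(m,p,n)),\star)$ has the same underlying vector space and unit as $H_c(G(m,p,n))$ and the associative product $a\star b=\mathrm{mult}(\mathcal F^{-1}\rhd(a\otimes b))$, where $\mathrm{mult}$ is the original product. *)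

theory Defs
  imports
    "HOL-Algebra.QuotRing"
    "HOL-Algebra.Module"
    "HOL-Library.Poly_Mapping"
    "HOL-Library.Product_Plus"
    "HOL-Library.Z2"
    "Jordan_Normal_Form.Determinant"
begin

text \<open>
  Conventions. The index set \<open>[n]\<close> is \<open>{0..<n}\<close>, so index \<open>i\<close> here is \<open>i + 1\<close> in the usual
  1-based notation. Elements of \<open>GL(V)\<close> are \<open>n \<times> n\<close> complex matrices with respect to the
  basis \<open>x\<^sub>0, \<dots>, x\<^sub>n\<^sub>-\<^sub>1\<close> of \<open>V\<close>: column \<open>j\<close> of \<open>g\<close> holds the coordinates of \<open>g(x\<^sub>j)\<close>.
\<close>

section \<open>Groups\<close>

definition roots1 :: "nat \<Rightarrow> complex set" where
  "roots1 k = {z. z ^ k = 1}"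

definition perm_mats :: "nat \<Rightarrow> complex mat set" where
  "perm_mats n = {mat n n (\<lambda>(r, k). if r = \<pi> k then 1 else 0) | \<pi>. \<pi> permutes {..<n}}"

definition Tgrp :: "nat \<Rightarrow> nat \<Rightarrow> nat \<Rightarrow> complex mat set" where
  "Tgrp m p n = {t \<in> carrier_mat n n.
     diagonal_mat t \<and> t ^\<^sub>m m = 1\<^sub>m n \<and> det t \<in> roots1 (m div p)}"

definition Ggrp :: "nat \<Rightarrow> nat \<Rightarrow> nat \<Rightarrow> complex mat set" where
  "Ggrp m p n = {w * t | w t. w \<in> perm_mats n \<and> t \<in> Tgrp m p n}"

definition muGgrp :: "nat \<Rightarrow> nat \<Rightarrow> nat \<Rightarrow> complex mat set" where
  "muGgrp m p n =
     {w * t | w t. w \<in> perm_mats n \<and> t \<in> Tgrp m 1 n \<and> det (w * t) \<in> roots1 (m div p)}"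

definition s_mat :: "nat \<Rightarrow> nat \<Rightarrow> nat \<Rightarrow> complex \<Rightarrow> complex mat" where
  "s_mat n i j \<epsilon> = mat n n (\<lambda>(r, k).
     if k = i then (if r = j then inverse \<epsilon> else 0)
     else if k = j then (if r = i then \<epsilon> else 0)
     else if r = k then 1 else 0)"

definition sigma_mat :: "nat \<Rightarrow> nat \<Rightarrow> nat \<Rightarrow> complex \<Rightarrow> complex mat" where
  "sigma_mat n i j \<epsilon> = mat n n (\<lambda>(r, k).
     if k = i then (if r = j then inverse \<epsilon> else 0)
     else if k = j then (if r = i then - \<epsilon> else 0)
     else if r = k then 1 else 0)"

definition t_mat :: "nat \<Rightarrow> nat \<Rightarrow> complex \<Rightarrow> complex mat" where
  "t_mat n i \<epsilon> = mat n n (\<lambda>(r, k). if r = k then (if k = i then \<epsilon> else 1) else 0)"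

definition inv_mat :: "nat \<Rightarrow> complex mat \<Rightarrow> complex mat" where
  "inv_mat n g = inv\<^bsub>ring_mat TYPE(complex) n ()\<^esub> g"


section \<open>Algebras given by generators and relations\<close>

datatype 'g free_monoid = Word (letters: "'g list")

instantiation free_monoid :: (type) monoid_add
begin

definition zero_free_monoid :: "'a free_monoid" where
  "0 = Word []"

definition plus_free_monoid :: "'a free_monoid \<Rightarrow> 'a free_monoid \<Rightarrow> 'a free_monoid" where
  "u + v = Word (letters u @ letters v)"

instance
  by standard (simp_all add: zero_free_monoid_def plus_free_monoid_def)

end

text \<open>
  Noncommutative polynomials: finitely supported functions on words, whose product as
  a \<^typ>\<open>'a \<Rightarrow>\<^sub>0 'b\<close> is convolution along concatenation.
\<close>

type_synonym 'g ncpoly = "'g free_monoid \<Rightarrow>\<^sub>0 complex"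

definition scal :: "complex \<Rightarrow> 'a::zero \<Rightarrow>\<^sub>0 complex" where
  "scal a = Poly_Mapping.single 0 a"

definition letter :: "'g \<Rightarrow> 'g ncpoly" where
  "letter g = Poly_Mapping.single (Word [g]) 1"

definition free_algebra :: "'g set \<Rightarrow> (complex, 'g ncpoly) module" where
  "free_algebra S =
     \<lparr>carrier = {f. \<forall>w \<in> Poly_Mapping.keys f. set (letters w) \<subseteq> S},
      monoid.mult = (*), one = 1, zero = 0, add = (+), module.smult = (\<lambda>a f. scal a * f)\<rparr>"

text \<open>Unital algebra homomorphism out of the free algebra with prescribed values on letters.\<close>

definition free_hom :: "('g \<Rightarrow> 'h ncpoly) \<Rightarrow> 'g ncpoly \<Rightarrow> 'h ncpoly" where
  "free_hom h f =
     (\<Sum>w \<in> Poly_Mapping.keys f. scal (Poly_Mapping.lookup f w) * prod_list (map h (letters w)))"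

text \<open>
  In \<open>HOL-Algebra\<close>, \<open>Idl\<close> generates two-sided ideals; elements of the quotient are cosets.
\<close>

definition rel_class :: "'g set \<Rightarrow> 'g ncpoly set \<Rightarrow> 'g ncpoly \<Rightarrow> 'g ncpoly set" where
  "rel_class S R f = (Idl\<^bsub>free_algebra S\<^esub> R) +>\<^bsub>free_algebra S\<^esub> f"

text \<open>
  The map on the quotient induced by \<open>h\<close>; if \<open>h\<close> is additive and preserves the ideal, all terms of
  the union are the same coset.
\<close>

definition induced ::
  "'g set \<Rightarrow> 'g ncpoly set \<Rightarrow> ('g ncpoly \<Rightarrow> 'g ncpoly) \<Rightarrow> 'g ncpoly set \<Rightarrow> 'g ncpoly set" where
  "induced S R h A = (\<Union>f \<in> A. rel_class S R (h f))"

definition presented_algebra ::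
  "'g set \<Rightarrow> 'g ncpoly set \<Rightarrow> (complex, 'g ncpoly set) module" where
  "presented_algebra S R =
     (let Q = free_algebra S Quot (Idl\<^bsub>free_algebra S\<^esub> R) in
      \<lparr>carrier = carrier Q, monoid.mult = monoid.mult Q, one = one Q, zero = zero Q, add = add Q,
       module.smult = (\<lambda>a. induced S R (\<lambda>f. scal a * f))\<rparr>)"

definition alg_iso ::
  "(complex, 'a) module \<Rightarrow> (complex, 'b) module \<Rightarrow> ('a \<Rightarrow> 'b) set" where
  "alg_iso A B =
     {\<phi> \<in> ring_iso A B. \<forall>a. \<forall>u \<in> carrier A. \<phi> (a \<odot>\<^bsub>A\<^esub> u) = a \<odot>\<^bsub>B\<^esub> \<phi> u}"


section \<open>The rational and the negative braided Cherednik algebras\<close>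

datatype gen = XGen nat | YGen nat | GGen "complex mat"

abbreviation xg :: "nat \<Rightarrow> gen ncpoly" where "xg i \<equiv> letter (XGen i)"
abbreviation yg :: "nat \<Rightarrow> gen ncpoly" where "yg i \<equiv> letter (YGen i)"
abbreviation gg :: "complex mat \<Rightarrow> gen ncpoly" where "gg g \<equiv> letter (GGen g)"

definition gens :: "nat \<Rightarrow> complex mat set \<Rightarrow> gen set" where
  "gens n G = XGen ` {..<n} \<union> YGen ` {..<n} \<union> GGen ` G"

definition act_x :: "nat \<Rightarrow> complex mat \<Rightarrow> nat \<Rightarrow> gen ncpoly" where
  "act_x n g j = (\<Sum>i<n. scal (g $$ (i, j)) * xg i)"

text \<open>Contragredient action: the coefficient of \<open>y\<^sub>i\<close> in \<open>g(y\<^sub>j)\<close> is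
  \<open>\<langle>g(y\<^sub>j), x\<^sub>i\<rangle> = \<langle>y\<^sub>j, g\<^sup>-\<^sup>1(x\<^sub>i)\<rangle>\<close>.\<close>

definition act_y :: "nat \<Rightarrow> complex mat \<Rightarrow> nat \<Rightarrow> gen ncpoly" where
  "act_y n g j = (\<Sum>i<n. scal (inv_mat n g $$ (j, i)) * yg i)"

text \<open>Relations of the group algebra of \<open>G\<close>, and its commutation with \<open>V\<close> and \<open>V\<^sup>*\<close>.\<close>

definition group_rels :: "nat \<Rightarrow> complex mat set \<Rightarrow> gen ncpoly set" where
  "group_rels n G =
     {gg g * gg h - gg (g * h) | g h. g \<in> G \<and> h \<in> G} \<union>
     {gg (1\<^sub>m n) - 1} \<union>
     {gg g * xg i - act_x n g i * gg g | g i. g \<in> G \<and> i < n} \<union>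
     {gg g * yg i - act_y n g i * gg g | g i. g \<in> G \<and> i < n}"

definition cherednik_rels ::
  "nat \<Rightarrow> nat \<Rightarrow> nat \<Rightarrow> complex \<Rightarrow> (complex \<Rightarrow> complex) \<Rightarrow> gen ncpoly set" where
  "cherednik_rels m p n c1 c =
     group_rels n (Ggrp m p n) \<union>
     {xg i * xg j - xg j * xg i | i j. i < n \<and> j < n} \<union>
     {yg i * yg j - yg j * yg i | i j. i < n \<and> j < n} \<union>
     {yg i * xg j - xg j * yg i
        - scal c1 * (\<Sum>\<epsilon> \<in> roots1 m. scal \<epsilon> * gg (s_mat n i j \<epsilon>))
      | i j. i < n \<and> j < n \<and> i \<noteq> j} \<union>
     {yg i * xg i - xg i * yg i
        - (1 - scal c1 * (\<Sum>j \<in> {..<n} - {i}. \<Sum>\<epsilon> \<in> roots1 m. gg (s_mat n i j \<epsilon>))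
             - (\<Sum>\<zeta> \<in> roots1 (m div p) - {1}. scal (c \<zeta>) * gg (t_mat n i \<zeta>)))
      | i. i < n}"

definition braided_rels ::
  "nat \<Rightarrow> nat \<Rightarrow> nat \<Rightarrow> complex \<Rightarrow> (complex \<Rightarrow> complex) \<Rightarrow> gen ncpoly set" where
  "braided_rels m p n c1 c =
     group_rels n (muGgrp m p n) \<union>
     {xg i * xg j + xg j * xg i | i j. i < n \<and> j < n \<and> i \<noteq> j} \<union>
     {yg i * yg j + yg j * yg i | i j. i < n \<and> j < n \<and> i \<noteq> j} \<union>
     {yg i * xg j + xg j * yg i
        - scal c1 * (\<Sum>\<epsilon> \<in> roots1 m. scal \<epsilon> * gg (sigma_mat n i j \<epsilon>))
      | i j. i < n \<and> j < n \<and> i \<noteq> j} \<union>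
     {yg i * xg i - xg i * yg i
        - (1 + scal c1 * (\<Sum>j \<in> {..<n} - {i}. \<Sum>\<epsilon> \<in> roots1 m. gg (sigma_mat n i j \<epsilon>))
             + (\<Sum>\<zeta> \<in> roots1 (m div p) - {1}. scal (c \<zeta>) * gg (t_mat n i \<zeta>)))
      | i. i < n}"

definition cherednik ::
  "nat \<Rightarrow> nat \<Rightarrow> nat \<Rightarrow> complex \<Rightarrow> (complex \<Rightarrow> complex) \<Rightarrow> (complex, gen ncpoly set) module" where
  "cherednik m p n c1 c = presented_algebra (gens n (Ggrp m p n)) (cherednik_rels m p n c1 c)"

definition cherednik_class ::
  "nat \<Rightarrow> nat \<Rightarrow> nat \<Rightarrow> complex \<Rightarrow> (complex \<Rightarrow> complex) \<Rightarrow> gen ncpoly \<Rightarrow> gen ncpoly set" where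
  "cherednik_class m p n c1 c = rel_class (gens n (Ggrp m p n)) (cherednik_rels m p n c1 c)"

definition braided ::
  "nat \<Rightarrow> nat \<Rightarrow> nat \<Rightarrow> complex \<Rightarrow> (complex \<Rightarrow> complex) \<Rightarrow> (complex, gen ncpoly set) module" where
  "braided m p n c1 c = presented_algebra (gens n (muGgrp m p n)) (braided_rels m p n c1 c)"

definition braided_class ::
  "nat \<Rightarrow> nat \<Rightarrow> nat \<Rightarrow> complex \<Rightarrow> (complex \<Rightarrow> complex) \<Rightarrow> gen ncpoly \<Rightarrow> gen ncpoly set" where
  "braided_class m p n c1 c = rel_class (gens n (muGgrp m p n)) (braided_rels m p n c1 c)"


section \<open>The cocycle twist\<close>

text \<open>
  The group \<open>T\<close>, written additively: \<open>\<gamma>\<^sub>i\<close> is \<open>Poly_Mapping.single i 1\<close>. The type has generators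
  \<open>\<gamma>\<^sub>i\<close> for all natural numbers \<open>i\<close>; only those with \<open>i < n\<close> occur in \<open>\<F>\<close>.
  \<open>\<complex>T \<otimes> \<complex>T\<close> is the group algebra of \<open>T \<times> T\<close>.
\<close>

type_synonym tgrp = "nat \<Rightarrow>\<^sub>0 bit"
type_synonym tgrp_alg2 = "(tgrp \<times> tgrp) \<Rightarrow>\<^sub>0 complex"

definition tgam :: "nat \<Rightarrow> tgrp" where
  "tgam i = Poly_Mapping.single i 1"

definition tens :: "tgrp \<Rightarrow> tgrp \<Rightarrow> tgrp_alg2" where
  "tens a b = Poly_Mapping.single (a, b) 1"

definition ftw :: "nat \<Rightarrow> nat \<Rightarrow> tgrp_alg2" where
  "ftw i j = scal (1 / 2) *
     (tens 0 0 + tens (tgam i) 0 + tens 0 (tgam j) - tens (tgam i) (tgam j))"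

definition Ftw :: "nat \<Rightarrow> tgrp_alg2" where
  "Ftw n = (\<Prod>(i, j) \<in> {(i, j). j < i \<and> i < n}. ftw i j)"

definition inv_alg2 :: "tgrp_alg2 \<Rightarrow> tgrp_alg2" where
  "inv_alg2 J = (THE K. J * K = 1)"

text \<open>Action of \<open>\<gamma>\<^sub>k\<close> on generators, and on the rational Cherednik algebra.\<close>

fun gamma_gen :: "nat \<Rightarrow> nat \<Rightarrow> gen \<Rightarrow> gen ncpoly" where
  "gamma_gen n k (XGen j) = act_x n (t_mat n k (-1)) j"
| "gamma_gen n k (YGen j) = act_y n (t_mat n k (-1)) j"
| "gamma_gen n k (GGen g) = gg (t_mat n k (-1) * g * t_mat n k (-1))"

definition gamma_act ::
  "nat \<Rightarrow> nat \<Rightarrow> nat \<Rightarrow> complex \<Rightarrow> (complex \<Rightarrow> complex) \<Rightarrow> nat \<Rightarrow> gen ncpoly set \<Rightarrow> gen ncpoly set" where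
  "gamma_act m p n c1 c k =
     induced (gens n (Ggrp m p n)) (cherednik_rels m p n c1 c) (free_hom (gamma_gen n k))"

text \<open>Action of an arbitrary element of \<open>T\<close>, given commuting actions \<open>\<gamma> i\<close> of the generators.\<close>

definition tgrp_act :: "(nat \<Rightarrow> 'a \<Rightarrow> 'a) \<Rightarrow> tgrp \<Rightarrow> 'a \<Rightarrow> 'a" where
  "tgrp_act \<gamma> \<tau> = foldr \<gamma> (sorted_list_of_set (Poly_Mapping.keys \<tau>))"

definition twist ::
  "(complex, 'a) module \<Rightarrow> (nat \<Rightarrow> 'a \<Rightarrow> 'a) \<Rightarrow> tgrp_alg2 \<Rightarrow> (complex, 'a) module" where
  "twist A \<gamma> J = A\<lparr>monoid.mult := (\<lambda>a b.
     \<Oplus>\<^bsub>A\<^esub>u \<in> Poly_Mapping.keys (inv_alg2 J).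
       Poly_Mapping.lookup (inv_alg2 J) u \<odot>\<^bsub>A\<^esub>
         (tgrp_act \<gamma> (fst u) a \<otimes>\<^bsub>A\<^esub> tgrp_act \<gamma> (snd u) b))\<rparr>"

definition twisted_cherednik ::
  "nat \<Rightarrow> nat \<Rightarrow> nat \<Rightarrow> complex \<Rightarrow> (complex \<Rightarrow> complex) \<Rightarrow> (complex, gen ncpoly set) module" where
  "twisted_cherednik m p n c1 c =
     twist (cherednik m p n c1 c) (gamma_act m p n c1 c) (Ftw n)"

end

theory Submission
  imports Defs
begin

text \<open>
  Conjugation by the diagonal matrices with entries \<open>\<plusminus>1\<close> grades the rational Cherednik algebra by
  vectors over the field with two elements. Put \<open>B(\<alpha>, \<beta>) = \<Sum> \<alpha>\<^sub>i \<beta>\<^sub>j\<close>, summed over \<open>j < i\<close>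
  (\<open>order_form\<close>). On elements of weights \<open>\<alpha>\<close> and \<open>\<beta>\<close> the twisted product is \<open>(-1)\<^bsup>B(\<alpha>,\<beta>)\<^esup>\<close> times
  the old product (\<open>star_weight\<close>). Both \<open>x\<^sub>i\<close> and \<open>y\<^sub>i\<close> have the \<open>i\<close>-th unit vector as weight,
  so twisting exchanges commutation with anticommutation for distinct indices.

  Group elements are not weight vectors, and they have to be corrected. Let \<open>M\<close> be a monomial matrix
  with permutation \<open>\<pi>\<close>. Its counterpart in the twisted algebra is \<open>M Q\<close>, where \<open>Q\<close> lies in the
  group algebra of the diagonal sign matrices and so is known once its values on the characters
  \<open>\<delta>\<close> of that group are known; they are \<open>(-1)\<^bsup>J(\<delta>)\<^esup>\<close> for a quadratic form \<open>J\<close> that depends only on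
  \<open>\<pi>\<close> (\<open>perm_form\<close>). To find \<open>J\<close>, let \<open>M Q\<close> act on the ordered product \<open>x\<^sup>\<delta>\<close> of the \<open>x\<^sub>i\<close> with
  \<open>\<delta>\<^sub>i = 1\<close>. If the variables anticommute, reordering the permuted product costs the parity of the
  number of inversions of \<open>\<pi>\<close> inside the support of \<open>\<delta>\<close>. The part of \<open>M\<close> that meets \<open>x\<^sup>\<delta>\<close> has weight
  \<open>\<pi>\<delta> + \<delta>\<close>, so the twisted product already contributes \<open>B(\<pi>\<delta> + \<delta>, \<delta>)\<close>; \<open>J(\<delta>)\<close> is the sum of the two.

  Four properties of \<open>J\<close> carry the proof. A cocycle identity (\<open>perm_form_compose\<close>) makes \<open>M \<mapsto> M Q\<close>
  multiplicative for the twisted product. The effect of adding a unit vector to \<open>\<delta>\<close>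
  (\<open>perm_form_add_unit\<close>) gives the commutation of \<open>M Q\<close> with the variables. For the transposition of
  \<open>i < j\<close> one has \<open>J(\<delta>) = \<delta>\<^sub>i\<close> (\<open>perm_form_transpose\<close>), so that \<open>Q\<close> is a single matrix and
  \<open>\<sigma>\<^sub>i\<^sub>j\<close> with parameter \<open>\<epsilon>\<close> becomes \<open>s\<^sub>i\<^sub>j\<close> with parameter \<open>-\<epsilon>\<close>. Finally, complementing \<open>\<delta>\<close> changes \<open>J\<close>
  by the parity of \<open>\<pi>\<close> (\<open>perm_form_complement\<close>, \<open>sg_perm_form_ones\<close>), and this makes the
  determinant conditions of the two groups correspond (\<open>fourier_parity\<close>, \<open>mgroup_sign_mat\<close>).

  The correction is carried out on the free algebra. The map \<open>twist_map\<close> sends products to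
  twisted products and, as \<open>Q\<close> squares to one, it is an involution that also sends twisted products
  back to products (\<open>twist_map_twist_map\<close>, \<open>twist_map_star\<close>). Both presentations are instances of
  one family of relations with a sign parameter (\<open>rels\<close>), and \<open>twist_map\<close> carries the relations for
  either sign into the ideal for the other one (\<open>twist_map_rels\<close>). Hence it descends to mutually
  inverse maps between the quotients.
\<close>

text \<open>
  Bits serve as a field; rewriting its operations to logical ones would block the ring rules.
\<close>

declare add_bit_eq_xor [simp del] mult_bit_eq_and [simp del]

section \<open>Noncommutative polynomials\<close>

lemma scal_simps:
  "scal (a * b) = scal a * (scal b :: 'k::monoid_add \<Rightarrow>\<^sub>0 complex)"
  "scal (a + b) = scal a + (scal b :: 'k::monoid_add \<Rightarrow>\<^sub>0 complex)"
  "scal (- a) = - (scal a :: 'k::monoid_add \<Rightarrow>\<^sub>0 complex)"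
  "scal 0 = (0 :: 'k::monoid_add \<Rightarrow>\<^sub>0 complex)"
  "scal 1 = (1 :: 'k::monoid_add \<Rightarrow>\<^sub>0 complex)"
  by (simp_all add: scal_def mult_single single_add single_uminus)

lemma scal_sum: "scal (\<Sum>i\<in>A. a i) = (\<Sum>i\<in>A. scal (a i) :: 'k::monoid_add \<Rightarrow>\<^sub>0 complex)"
  by (induction A rule: infinite_finite_induct) (simp_all add: scal_simps)

lemma poly_mapping_lin_induct [case_names single add]:
  assumes "\<And>w a. P (Poly_Mapping.single w a)" "\<And>f g. P f \<Longrightarrow> P g \<Longrightarrow> P (f + g)"
  shows "P (f :: 'k \<Rightarrow>\<^sub>0 'b::comm_monoid_add)"
proof (induction f rule: update_induct)
  case const
  show ?case using assms(1)[of undefined 0] by simp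
next
  case (update f a b)
  have "Poly_Mapping.update a b f = Poly_Mapping.single a b + f"
    using update(1) by (intro poly_mapping_eqI) (auto simp: Poly_Mapping.lookup_update lookup_add
        lookup_single in_keys_iff when_def)
  then show ?case using assms update by metis
qed

lemma scal_commute: "scal a * f = f * (scal a :: 'k::monoid_add \<Rightarrow>\<^sub>0 complex)"
  by (induction f rule: poly_mapping_lin_induct)
     (simp_all add: scal_def mult_single algebra_simps)

lemma mult_scal_left: "f * (scal a * g) = scal a * (f * (g :: 'k::monoid_add \<Rightarrow>\<^sub>0 complex))"
  by (metis mult.assoc scal_commute)

text \<open>
  A separate scaling operation lets the simplifier pull scalars to the front; for products with
  \<open>scal c\<close> the corresponding rewrite rule loops.
\<close>

definition smul :: "complex \<Rightarrow> ('k::monoid_add \<Rightarrow>\<^sub>0 complex) \<Rightarrow> ('k \<Rightarrow>\<^sub>0 complex)" (infixr "*\<^sub>s" 75) where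
  "c *\<^sub>s f = scal c * f"

lemma smul_simps [simp]:
  "(c *\<^sub>s f) * g = c *\<^sub>s (f * g)"
  "f * (c *\<^sub>s g) = c *\<^sub>s (f * g)"
  "a *\<^sub>s b *\<^sub>s f = (a * b) *\<^sub>s f"
  "1 *\<^sub>s f = f" "0 *\<^sub>s f = 0" "c *\<^sub>s 0 = 0" "(- c) *\<^sub>s f = - (c *\<^sub>s f)" "c *\<^sub>s (- f) = - (c *\<^sub>s f)"
  unfolding smul_def by (simp add: mult.assoc, rule mult_scal_left, simp_all add: mult.assoc scal_simps)

lemma smul_distrib:
  "(a + b) *\<^sub>s f = a *\<^sub>s f + b *\<^sub>s f" "c *\<^sub>s (f + g) = c *\<^sub>s f + c *\<^sub>s g" "c *\<^sub>s (f - g) = c *\<^sub>s f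
      - c *\<^sub>s g"
  by (simp_all add: smul_def scal_simps distrib_left distrib_right right_diff_distrib)

lemma smul_sum: "c *\<^sub>s (\<Sum>i\<in>A. f i) = (\<Sum>i\<in>A. c *\<^sub>s f i)" "(\<Sum>i\<in>A. a i) *\<^sub>s g = (\<Sum>i\<in>A. a i *\<^sub>s g)"
  by (simp_all add: smul_def scal_sum sum_distrib_left sum_distrib_right)

lemma smul_single: "c *\<^sub>s Poly_Mapping.single w a = Poly_Mapping.single w (c * a)"
  by (simp add: smul_def scal_def mult_single)

lemma ncpoly_induct [case_names one letter scal add]:
  assumes one: "P 1" and letter: "\<And>l f. P f \<Longrightarrow> P (letter l * f)"
    and scal: "\<And>a f. P f \<Longrightarrow> P (a *\<^sub>s f)" and add: "\<And>f g. P f \<Longrightarrow> P g \<Longrightarrow> P (f + g)"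
  shows "P (f :: 'g ncpoly)"
proof (induction f rule: poly_mapping_lin_induct)
  case (single w a)
  have "P (Poly_Mapping.single (Word ls) 1)" for ls :: "'g list"
  proof (induction ls)
    case Nil
    have "Word [] = (0 :: 'g free_monoid)" by (simp add: zero_free_monoid_def)
    then show ?case using one by simp
  next
    case (Cons l ls)
    have "Poly_Mapping.single (Word (l # ls)) 1 = letter l * Poly_Mapping.single (Word ls) 1"
      by (simp add: letter_def mult_single plus_free_monoid_def)
    then show ?case using letter Cons by metis
  qed
  then have "P (Poly_Mapping.single w 1)" by (cases w) metis
  then show ?case using scal[of "Poly_Mapping.single w 1" a] by (simp add: smul_single)
next
  case (add f g)
  then show ?case by (rule assms(4))
qed

lemma letters_zero: "letters 0 = []"
  by (simp add: zero_free_monoid_def)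

text \<open>
  Linear extension of a map on letters, where words are evaluated by an arbitrary product on the
  target. With the twisted product this gives homomorphisms into the twisted algebra.
\<close>

definition word_map :: "('h ncpoly \<Rightarrow> 'h ncpoly \<Rightarrow> 'h ncpoly) \<Rightarrow> ('g \<Rightarrow> 'h ncpoly) \<Rightarrow> 'g ncpoly \<Rightarrow> 'h ncpoly"
  where "word_map mul h f =
    (\<Sum>w \<in> Poly_Mapping.keys f. Poly_Mapping.lookup f w *\<^sub>s foldr (\<lambda>l. mul (h l)) (letters w) 1)"

lemma word_map_superset:
  assumes "finite A" "Poly_Mapping.keys f \<subseteq> A"
  shows "word_map mul h f =
    (\<Sum>w \<in> A. Poly_Mapping.lookup f w *\<^sub>s foldr (\<lambda>l. mul (h l)) (letters w) 1)"
  unfolding word_map_def by (rule sum.mono_neutral_left) (use assms in \<open>auto simp: in_keys_iff\<close>)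

lemma word_map_add: "word_map mul h (f + g) = word_map mul h f + word_map mul h g"
proof -
  let ?A = "Poly_Mapping.keys f \<union> Poly_Mapping.keys g"
  have A: "finite ?A" "Poly_Mapping.keys f \<subseteq> ?A" "Poly_Mapping.keys g \<subseteq> ?A" "Poly_Mapping.keys (f
      + g) \<subseteq> ?A"
    using Poly_Mapping.keys_add[of f g] by auto
  show ?thesis unfolding word_map_superset[OF A(1,2)] word_map_superset[OF A(1,3)]
      word_map_superset[OF A(1,4)]
    by (simp add: lookup_add smul_distrib sum.distrib)
qed

lemma word_map_single:
  "word_map mul h (Poly_Mapping.single w a) = a *\<^sub>s foldr (\<lambda>l. mul (h l)) (letters w) 1"
  by (subst word_map_superset[of "{w}"]) auto

lemma word_map_smul: "word_map mul h (c *\<^sub>s f) = c *\<^sub>s word_map mul h f"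
  by (induction f rule: poly_mapping_lin_induct) (simp_all add: smul_single word_map_single
      word_map_add smul_distrib)

lemma word_map_0 [simp]: "word_map mul h 0 = 0"
  by (simp add: word_map_def)

lemma word_map_one [simp]: "word_map mul h 1 = 1"
  using word_map_single[of mul h 0 1] by (simp add: letters_zero)

lemma word_map_minus: "word_map mul h (- f) = - word_map mul h f"
  using word_map_smul[of mul h "-1" f] by simp

lemma word_map_diff: "word_map mul h (f - g) = word_map mul h f - word_map mul h g"
  using word_map_add[of mul h f "- g"] by (simp add: word_map_minus)

lemma word_map_sum: "word_map mul h (\<Sum>i\<in>A. f i) = (\<Sum>i\<in>A. word_map mul h (f i))"
  by (induction A rule: infinite_finite_induct) (simp_all add: word_map_add)

lemma word_map_letter_mult:
  assumes add: "\<And>l f g. mul (h l) (f + g) = mul (h l) f + mul (h l) g"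
    and smul: "\<And>l a f. mul (h l) (a *\<^sub>s f) = a *\<^sub>s mul (h l) f"
  shows "word_map mul h (letter l * f) = mul (h l) (word_map mul h f)"
proof (induction f rule: poly_mapping_lin_induct)
  case (single w a)
  have "letter l * Poly_Mapping.single w a = Poly_Mapping.single (Word (l # letters w)) a"
    by (simp add: letter_def mult_single plus_free_monoid_def)
  then show ?case by (simp add: word_map_single smul)
qed (simp add: word_map_add distrib_left add)

lemma free_hom_word_map: "free_hom h = word_map (*) h"
proof
  fix f
  have "prod_list (map h ls) = foldr (\<lambda>l. (*) (h l)) ls 1" for ls by (induction ls) auto
  then show "free_hom h f = word_map (*) h f" by (simp add: free_hom_def word_map_def smul_def)
qed

lemma free_hom_letter_mult: "free_hom h (letter l * f) = h l * free_hom h f"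
  unfolding free_hom_word_map by (rule word_map_letter_mult) (simp_all add: distrib_left)

lemma free_hom_mult: "free_hom h (f * g) = free_hom h f * free_hom h g"
  by (induction f rule: ncpoly_induct)
     (simp_all add: free_hom_letter_mult mult.assoc, simp_all add: free_hom_word_map word_map_smul
         word_map_add distrib_right)

lemma free_hom_letter: "free_hom h (letter l) = h l"
  using free_hom_letter_mult[of h l 1] by (simp add: free_hom_word_map)

lemma free_hom_scal: "free_hom h (scal a) = scal a"
  using word_map_smul[of "(*)" h a 1] by (simp add: free_hom_word_map smul_def)

lemmas free_hom_simps = free_hom_mult free_hom_scal free_hom_letter
  word_map_add[of "(*)", folded free_hom_word_map]
  word_map_smul[of "(*)", folded free_hom_word_map]
  word_map_diff[of "(*)", folded free_hom_word_map]
  word_map_minus[of "(*)", folded free_hom_word_map]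
  word_map_sum[of "(*)", folded free_hom_word_map]
  word_map_one[of "(*)", folded free_hom_word_map]
  word_map_0[of "(*)", folded free_hom_word_map]

section \<open>Two-sided ideals and presented algebras\<close>

text \<open>
  Two-sided ideals of the whole type. Congruences can then be multiplied by arbitrary
  polynomials, and membership in a carrier matters only when the presented algebras are entered.
\<close>

inductive_set tideal :: "'a::ring_1 set \<Rightarrow> 'a set" for R where
  zero: "0 \<in> tideal R"
| base: "r \<in> R \<Longrightarrow> r \<in> tideal R"
| add: "a \<in> tideal R \<Longrightarrow> b \<in> tideal R \<Longrightarrow> a + b \<in> tideal R"
| left: "b \<in> tideal R \<Longrightarrow> a * b \<in> tideal R"
| right: "a \<in> tideal R \<Longrightarrow> a * b \<in> tideal R"

lemma tideal_uminus: "a \<in> tideal R \<Longrightarrow> - a \<in> tideal R"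
  using tideal.left[of a R "-1"] by simp

lemma tideal_diff: "a \<in> tideal R \<Longrightarrow> b \<in> tideal R \<Longrightarrow> a - b \<in> tideal R"
  using tideal.add[OF _ tideal_uminus] by fastforce

lemma tideal_smul: "a \<in> tideal R \<Longrightarrow> c *\<^sub>s a \<in> tideal R"
  unfolding smul_def by (rule tideal.left)

lemma tideal_sum: "(\<And>i. i \<in> A \<Longrightarrow> f i \<in> tideal R) \<Longrightarrow> (\<Sum>i\<in>A. f i) \<in> tideal R"
  by (induction A rule: infinite_finite_induct) (auto intro: tideal.intros)

abbreviation polys_over :: "'g set \<Rightarrow> 'g ncpoly set" where
  "polys_over S \<equiv> carrier (free_algebra S)"

lemma polys_over_iff: "f \<in> polys_over S \<longleftrightarrow> (\<forall>w \<in> Poly_Mapping.keys f. set (letters w) \<subseteq> S)"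
  by (simp add: free_algebra_def)

lemma polys_over_add: "f \<in> polys_over S \<Longrightarrow> g \<in> polys_over S \<Longrightarrow> f + g \<in> polys_over S"
  using Poly_Mapping.keys_add[of f g] by (auto simp: polys_over_iff)

lemma polys_over_mult: "f \<in> polys_over S \<Longrightarrow> g \<in> polys_over S \<Longrightarrow> f * g \<in> polys_over S"
  using Poly_Mapping.keys_mult[of f g] by (fastforce simp: polys_over_iff plus_free_monoid_def)

lemma polys_over_scal: "scal a \<in> polys_over S"
  by (auto simp: polys_over_iff scal_def zero_free_monoid_def)

lemma polys_over_smul: "f \<in> polys_over S \<Longrightarrow> c *\<^sub>s f \<in> polys_over S"
  unfolding smul_def by (rule polys_over_mult[OF polys_over_scal])

lemma polys_over_one: "1 \<in> polys_over S"
  using polys_over_scal[of 1] by (simp add: scal_simps)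

lemma polys_over_zero: "0 \<in> polys_over S"
  using polys_over_scal[of 0] by (simp add: scal_simps)

lemma polys_over_uminus: "f \<in> polys_over S \<Longrightarrow> - f \<in> polys_over S"
  by (simp add: polys_over_iff)

lemma polys_over_diff: "f \<in> polys_over S \<Longrightarrow> g \<in> polys_over S \<Longrightarrow> f - g \<in> polys_over S"
  using polys_over_add[OF _ polys_over_uminus] by fastforce

lemma polys_over_letter: "l \<in> S \<Longrightarrow> letter l \<in> polys_over S"
  by (auto simp: polys_over_iff letter_def)

lemma polys_over_sum: "(\<And>i. i \<in> A \<Longrightarrow> f i \<in> polys_over S) \<Longrightarrow> (\<Sum>i\<in>A. f i) \<in> polys_over S"
  by (induction A rule: infinite_finite_induct) (auto intro: polys_over_add polys_over_zero)

definition retract :: "'g set \<Rightarrow> 'g ncpoly \<Rightarrow> 'g ncpoly" where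
  "retract S = free_hom (\<lambda>l. if l \<in> S then letter l else 0)"

lemma retract_in: "retract S f \<in> polys_over S"
proof (induction f rule: ncpoly_induct)
  case (letter l f)
  then show ?case
    by (auto simp: retract_def free_hom_simps intro!: polys_over_zero polys_over_mult[OF
        polys_over_letter])
qed (simp_all add: retract_def free_hom_simps polys_over_add polys_over_one polys_over_smul)

lemma retract_id:
  assumes "f \<in> polys_over S" shows "retract S f = f"
proof -
  have word: "set ls \<subseteq> S \<Longrightarrow>
      prod_list (map (\<lambda>l. if l \<in> S then letter l else 0) ls)
          = Poly_Mapping.single (Word ls) (1::complex)"
    for ls :: "'a list"
  proof (induction ls)
    case Nil
    have "Word [] = (0 :: 'a free_monoid)" by (simp add: zero_free_monoid_def)
    then show ?case by simp
  next
    case (Cons l ls)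
    then show ?case by (simp add: letter_def mult_single plus_free_monoid_def)
  qed
  have "retract S f = (\<Sum>w\<in>Poly_Mapping.keys f. Poly_Mapping.single w (Poly_Mapping.lookup f w))"
    unfolding retract_def free_hom_def
  proof (rule sum.cong[OF refl])
    fix w assume "w \<in> Poly_Mapping.keys f"
    then have "set (letters w) \<subseteq> S" using assms by (simp add: polys_over_iff)
    from word[OF this] show "scal (Poly_Mapping.lookup f w) *
        prod_list (map (\<lambda>l. if l \<in> S then letter l else 0) (letters w)) =
        Poly_Mapping.single w (Poly_Mapping.lookup f w)"
      by (simp add: scal_def mult_single)
  qed
  also have "\<dots> = f"
    by (intro poly_mapping_eqI) (simp add: lookup_sum lookup_single when_def in_keys_iff)
  finally show ?thesis .
qed

lemma polys_over_induct [consumes 1, case_names one letter scal add]: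
  assumes f: "f \<in> polys_over S"
    and one: "P 1" and letter: "\<And>l f. l \<in> S \<Longrightarrow> P f \<Longrightarrow> P (letter l * f)"
    and scal: "\<And>a f. P f \<Longrightarrow> P (a *\<^sub>s f)"
    and add: "\<And>f g. P f \<Longrightarrow> P g \<Longrightarrow> P (f + g)"
  shows "P (f :: 'g ncpoly)"
proof -
  have zero: "P 0" using scal[OF one, of 0] by simp
  have "P (retract S f)"
  proof (induction f rule: ncpoly_induct)
    case (letter l f)
    then show ?case using assms(3) zero by (simp add: retract_def free_hom_simps)
  qed (simp_all add: retract_def free_hom_simps one scal add)
  then show ?thesis by (simp add: retract_id[OF f])
qed

lemma free_algebra_ops:
  "f \<otimes>\<^bsub>free_algebra S\<^esub> g = f * g" "f \<oplus>\<^bsub>free_algebra S\<^esub> g = f + g"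
  "\<one>\<^bsub>free_algebra S\<^esub> = 1" "\<zero>\<^bsub>free_algebra S\<^esub> = 0" "a \<odot>\<^bsub>free_algebra S\<^esub> f = scal a * f"
  by (simp_all add: free_algebra_def)

lemma ring_free_algebra: "ring (free_algebra S)"
proof (rule ringI)
  show "abelian_group (free_algebra S)"
  proof (rule abelian_groupI, unfold free_algebra_ops)
    fix f :: "'a ncpoly" assume f: "f \<in> polys_over S"
    show "\<exists>g\<in>polys_over S. g + f = 0"
      by (rule bexI[of _ "- f"]) (simp_all add: f polys_over_uminus)
  qed (auto intro: polys_over_add polys_over_zero)
  show "Group.monoid (free_algebra S)"
    by (rule monoidI, unfold free_algebra_ops) (auto simp: mult.assoc intro: polys_over_mult
        polys_over_one)
qed (simp_all add: free_algebra_ops distrib_left distrib_right)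

lemma free_algebra_minus:
  assumes "f \<in> polys_over S" shows "\<ominus>\<^bsub>free_algebra S\<^esub> f = - f"
proof -
  interpret F: ring "free_algebra S" by (rule ring_free_algebra)
  show ?thesis
    by (rule F.minus_equality) (simp_all add: assms free_algebra_ops polys_over_uminus)
qed

text \<open>
  The retraction onto the polynomials over \<open>S\<close> fixes the generators, so it maps the ideal that
  they generate in the whole type into the ideal that they generate among the polynomials over
  \<open>S\<close>.
\<close>

lemma Idl_eq_tideal:
  assumes R: "R \<subseteq> polys_over S"
  shows "Idl\<^bsub>free_algebra S\<^esub> R = tideal R \<inter> polys_over S"
proof
  interpret F: ring "free_algebra S" by (rule ring_free_algebra)
  let ?I = "Idl\<^bsub>free_algebra S\<^esub> R"
  interpret I: ideal ?I "free_algebra S" by (rule F.genideal_ideal[OF R])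
  have "ideal (tideal R \<inter> polys_over S) (free_algebra S)"
  proof (rule idealI[OF F.ring_axioms])
    show "subgroup (tideal R \<inter> polys_over S) (add_monoid (free_algebra S))"
      by (rule F.add.subgroupI)
         (auto simp: free_algebra_ops free_algebra_minus
            intro: tideal.intros tideal_uminus polys_over_add polys_over_zero polys_over_uminus)
  qed (auto simp: free_algebra_ops intro: tideal.intros polys_over_mult)
  then show "?I \<subseteq> tideal R \<inter> polys_over S"
    by (rule F.genideal_minimal) (use R in \<open>auto intro: tideal.base\<close>)
  have "retract S f \<in> ?I" if "f \<in> tideal R" for f
    using that
  proof induction
    case zero
    then show ?case using I.zero_closed by (simp add: retract_def free_hom_simps free_algebra_ops)
  next
    case (base r)
    then show ?case using F.genideal_self[OF R] retract_id[of r S] R by auto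
  next
    case (add a b)
    then show ?case using I.a_closed by (simp add: retract_def free_hom_simps free_algebra_ops)
  next
    case (left b a)
    then show ?case using I.I_l_closed[OF _ retract_in]
        by (simp add: retract_def free_hom_simps free_algebra_ops)
  next
    case (right a b)
    then show ?case using I.I_r_closed[OF _ retract_in]
        by (simp add: retract_def free_hom_simps free_algebra_ops)
  qed
  then show "tideal R \<inter> polys_over S \<subseteq> ?I" using retract_id[of _ S] by (metis IntE subsetI)
qed

lemma rel_class_iff:
  assumes R: "R \<subseteq> polys_over S" and f: "f \<in> polys_over S"
  shows "g \<in> rel_class S R f \<longleftrightarrow> g \<in> polys_over S \<and> g - f \<in> tideal R"
proof
  assume "g \<in> rel_class S R f"
  then show "g \<in> polys_over S \<and> g - f \<in> tideal R"
    using f by (auto simp: rel_class_def a_r_coset_def' Idl_eq_tideal[OF R] free_algebra_ops intro: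
        polys_over_add)
next
  assume "g \<in> polys_over S \<and> g - f \<in> tideal R"
  then have "g - f \<in> tideal R \<inter> polys_over S" "g = (g - f) + f" using f by (auto intro: polys_over_diff)
  then show "g \<in> rel_class S R f"
    unfolding rel_class_def a_r_coset_def' Idl_eq_tideal[OF R] free_algebra_ops by blast
qed

lemma rel_class_eq_iff:
  assumes R: "R \<subseteq> polys_over S" and f: "f \<in> polys_over S" and g: "g \<in> polys_over S"
  shows "rel_class S R f = rel_class S R g \<longleftrightarrow> f - g \<in> tideal R"
proof
  assume "rel_class S R f = rel_class S R g"
  then show "f - g \<in> tideal R"
    using rel_class_iff[OF R f, of f] rel_class_iff[OF R g, of f] f by (auto intro: tideal.zero)
next
  assume fg: "f - g \<in> tideal R"
  have "h - f \<in> tideal R \<longleftrightarrow> h - g \<in> tideal R" for h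
    using tideal.add[OF _ fg, of "h - f"] tideal_diff[OF _ fg, of "h - g"] by auto
  then show "rel_class S R f = rel_class S R g"
    by (auto simp: rel_class_iff[OF R f] rel_class_iff[OF R g])
qed

text \<open>
  A difference-preserving map that respects the ideals sends a coset into a single coset, so the
  union is one of equal sets.
\<close>

lemma UN_rel_class:
  assumes R: "R \<subseteq> polys_over S" and f: "f \<in> polys_over S"
    and h: "\<And>g. g \<in> polys_over S \<Longrightarrow> h g \<in> polys_over S'" and R': "R' \<subseteq> polys_over S'"
    and diff: "\<And>f g. h (f - g) = h f - h g" and ideal: "\<And>f. f \<in> tideal R \<Longrightarrow> h f \<in> tideal R'"
  shows "(\<Union>g \<in> rel_class S R f. rel_class S' R' (h g)) = rel_class S' R' (h f)"
proof -
  have "rel_class S' R' (h g) = rel_class S' R' (h f)" if "g \<in> rel_class S R f" for g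
    using that h f ideal diff[symmetric] by (simp add: rel_class_eq_iff[OF R'] rel_class_iff[OF R f])
  moreover have "f \<in> rel_class S R f" by (simp add: rel_class_iff[OF R f] f tideal.zero)
  ultimately show ?thesis by blast
qed

lemma presented_algebra_carrier:
  "carrier (presented_algebra S R) = rel_class S R ` polys_over S"
  by (auto simp: presented_algebra_def Let_def FactRing_def A_RCOSETS_def' rel_class_def)

lemma presented_algebra_ops:
  assumes R: "R \<subseteq> polys_over S" and f: "f \<in> polys_over S" and g: "g \<in> polys_over S"
  shows "rel_class S R f \<otimes>\<^bsub>presented_algebra S R\<^esub> rel_class S R g = rel_class S R (f * g)"
    "rel_class S R f \<oplus>\<^bsub>presented_algebra S R\<^esub> rel_class S R g = rel_class S R (f + g)"
    "\<one>\<^bsub>presented_algebra S R\<^esub> = rel_class S R 1"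
    "\<zero>\<^bsub>presented_algebra S R\<^esub> = rel_class S R 0"
    "a \<odot>\<^bsub>presented_algebra S R\<^esub> rel_class S R f = rel_class S R (a *\<^sub>s f)"
proof -
  interpret F: ring "free_algebra S" by (rule ring_free_algebra)
  interpret I: ideal "Idl\<^bsub>free_algebra S\<^esub> R" "free_algebra S" by (rule F.genideal_ideal[OF R])
  show "rel_class S R f \<otimes>\<^bsub>presented_algebra S R\<^esub> rel_class S R g = rel_class S R (f * g)"
    "rel_class S R f \<oplus>\<^bsub>presented_algebra S R\<^esub> rel_class S R g = rel_class S R (f + g)"
    "\<one>\<^bsub>presented_algebra S R\<^esub> = rel_class S R 1"
    using I.rcoset_mult_add[OF f g] I.a_rcos_sum[OF f g]
    by (simp_all add: presented_algebra_def Let_def FactRing_def rel_class_def free_algebra_ops)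
  show "\<zero>\<^bsub>presented_algebra S R\<^esub> = rel_class S R 0"
    using F.a_coset_add_zero[OF I.a_subset]
    by (simp add: presented_algebra_def Let_def FactRing_def rel_class_def free_algebra_ops)
  show "a \<odot>\<^bsub>presented_algebra S R\<^esub> rel_class S R f = rel_class S R (a *\<^sub>s f)"
    unfolding presented_algebra_def Let_def module.simps induced_def smul_def
    by (rule UN_rel_class[OF R f _ R]) (auto simp: right_diff_distrib intro: tideal.left
        polys_over_mult polys_over_scal)
qed

lemma presented_algebra_abelian_monoid:
  assumes R: "R \<subseteq> polys_over S"
  shows "abelian_monoid (presented_algebra S R)"
  by (rule abelian_monoidI)
     (auto simp: presented_algebra_carrier presented_algebra_ops[OF R] polys_over_add
         polys_over_zero add_ac
        presented_algebra_ops(4)[OF R polys_over_zero polys_over_zero])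

lemma presented_algebra_finsum:
  assumes R: "R \<subseteq> polys_over S" and "finite A" "\<And>i. i \<in> A \<Longrightarrow> f i \<in> polys_over S"
  shows "(\<Oplus>\<^bsub>presented_algebra S R\<^esub>i\<in>A. rel_class S R (f i)) = rel_class S R (\<Sum>i\<in>A. f i)"
proof -
  interpret abelian_monoid "presented_algebra S R" by (rule presented_algebra_abelian_monoid[OF R])
  show ?thesis using assms(2,3)
  proof (induction A rule: finite_induct)
    case empty
    then show ?case using presented_algebra_ops(4)[OF R polys_over_zero polys_over_zero] by simp
  next
    case (insert i A)
    then show ?case
      by (subst finsum_insert) (auto simp: presented_algebra_carrier presented_algebra_ops[OF R]
          polys_over_sum)
  qed
qed

section \<open>Quadratic forms over the field with two elements\<close>

lemma bit_add_self [simp]: "b + b = (0 :: bit)"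
  by (cases b) auto

lemma bit_add_left_self [simp]: "b + (b + c) = (c :: bit)"
  by (cases b) (auto simp: add.assoc[symmetric])

lemma bit_mult_self [simp]: "b * b = (b :: bit)"
  by (cases b) auto

lemma bit_add_eq_0_iff: "a + b = 0 \<longleftrightarrow> a = (b :: bit)"
  by (cases a; cases b) auto

definition sg :: "bit \<Rightarrow> complex" where
  "sg b = (if b = 0 then 1 else - 1)"

lemma sg_simps [simp]: "sg 0 = 1" "sg 1 = - 1" "sg b * sg b = 1" "sg b \<noteq> 0" "inverse (sg b) = sg b"
  by (auto simp: sg_def)

lemma sg_add: "sg (a + b) = sg a * sg b"
  by (cases a; cases b) (auto simp: sg_def)

lemma sg_sum: "sg (\<Sum>i\<in>A. f i) = (\<Prod>i\<in>A. sg (f i))"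
  by (induction A rule: infinite_finite_induct) (simp_all add: sg_add)

text \<open>
  The plain notation for inverses is taken by groups.
\<close>

abbreviation pinv :: "(nat \<Rightarrow> nat) \<Rightarrow> nat \<Rightarrow> nat" where
  "pinv \<equiv> Hilbert_Choice.inv"

definition bilin :: "nat \<Rightarrow> (nat \<Rightarrow> nat \<Rightarrow> bit) \<Rightarrow> (nat \<Rightarrow> bit) \<Rightarrow> (nat \<Rightarrow> bit) \<Rightarrow> bit" where
  "bilin n c \<alpha> \<beta> = (\<Sum>i<n. \<Sum>j<n. c i j * \<alpha> i * \<beta> j)"

lemma bilin_add_left: "bilin n c (\<lambda>i. \<alpha> i + \<alpha>' i) \<beta> = bilin n c \<alpha> \<beta> + bilin n c \<alpha>' \<beta>"
  and bilin_add_right: "bilin n c \<alpha> (\<lambda>i. \<beta> i + \<beta>' i) = bilin n c \<alpha> \<beta> + bilin n c \<alpha> \<beta>'"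
  and bilin_add_coeff: "bilin n (\<lambda>i j. c i j + c' i j) \<alpha> \<beta> = bilin n c \<alpha> \<beta> + bilin n c' \<alpha> \<beta>"
  by (simp_all add: bilin_def algebra_simps sum.distrib)

lemma bilin_cong:
  "(\<And>i j. i < n \<Longrightarrow> j < n \<Longrightarrow> c i j = c' i j) \<Longrightarrow> (\<And>i. i < n \<Longrightarrow> \<alpha> i = \<alpha>' i) \<Longrightarrow>
    (\<And>i. i < n \<Longrightarrow> \<beta> i = \<beta>' i) \<Longrightarrow> bilin n c \<alpha> \<beta> = bilin n c' \<alpha>' \<beta>'"
  unfolding bilin_def by (intro sum.cong) auto

lemma bilin_swap: "bilin n c \<alpha> \<beta> = bilin n (\<lambda>i j. c j i) \<beta> \<alpha>"
  unfolding bilin_def by (subst sum.swap) (simp add: algebra_simps)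

lemma bilin_reindex:
  assumes \<sigma>: "\<sigma> permutes {..<n}" and \<tau>: "\<tau> permutes {..<n}"
  shows "bilin n c (\<lambda>i. \<alpha> (pinv \<sigma> i)) (\<lambda>j. \<beta> (pinv \<tau> j)) = bilin n (\<lambda>i j. c (\<sigma> i) (\<tau> j)) \<alpha> \<beta>"
proof -
  have "bilin n c (\<lambda>i. \<alpha> (pinv \<sigma> i)) (\<lambda>j. \<beta> (pinv \<tau> j))
      = (\<Sum>i<n. \<Sum>j<n. c (\<sigma> i) j * \<alpha> (pinv \<sigma> (\<sigma> i)) * \<beta> (pinv \<tau> j))"
    unfolding bilin_def by (rule sum.permute[OF \<sigma>, unfolded o_def])
  also have "\<dots> = (\<Sum>i<n. \<Sum>j<n. c (\<sigma> i) (\<tau> j) * \<alpha> (pinv \<sigma> (\<sigma> i)) * \<beta> (pinv \<tau> (\<tau> j)))"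
    by (rule sum.cong[OF refl], rule sum.permute[OF \<tau>, unfolded o_def])
  finally show ?thesis
    by (simp add: bilin_def permutes_inverses[OF \<sigma>] permutes_inverses[OF \<tau>])
qed

text \<open>
  In characteristic two the two terms of each unordered pair of indices cancel. The identities
  for \<open>perm_form\<close> that are quadratic in \<open>\<delta>\<close> are reduced to this by comparing coefficients.
\<close>

lemma bilin_alternating:
  assumes "\<And>i. i < n \<Longrightarrow> c i i = 0" "\<And>i j. i < j \<Longrightarrow> j < n \<Longrightarrow> c i j = c j i"
  shows "bilin n c \<delta> \<delta> = 0"
  using assms
proof (induction n)
  case 0
  then show ?case by (simp add: bilin_def)
next
  case (Suc n)
  have "bilin (Suc n) c \<delta> \<delta> = bilin n c \<delta> \<delta> + (\<Sum>i<n. c i n * \<delta> i * \<delta> n + c n i * \<delta> n * \<delta> i)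
      + c n n * \<delta> n * \<delta> n"
    by (simp add: bilin_def sum.distrib algebra_simps)
  also have "(\<Sum>i<n. c i n * \<delta> i * \<delta> n + c n i * \<delta> n * \<delta> i) = 0"
  proof (intro sum.neutral ballI)
    fix i assume "i \<in> {..<n}"
    then have "c i n = c n i" using Suc.prems(2)[of i n] by simp
    then show "c i n * \<delta> i * \<delta> n + c n i * \<delta> n * \<delta> i = 0"
        by (simp add: mult.assoc mult.commute[of "\<delta> n"])
  qed
  finally have "bilin (Suc n) c \<delta> \<delta> = bilin n c \<delta> \<delta> + c n n * \<delta> n * \<delta> n" by simp
  moreover have "bilin n c \<delta> \<delta> = 0" by (rule Suc.IH) (auto intro!: Suc.prems)
  ultimately show ?case using Suc.prems(1)[of n] by simp
qed

definition unit :: "nat \<Rightarrow> nat \<Rightarrow> bit" where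
  "unit i k = of_bool (k = i)"

lemma bilin_unit_left: "i < n \<Longrightarrow> bilin n c (unit i) \<beta> = (\<Sum>j<n. c i j * \<beta> j)"
proof -
  assume "i < n"
  have "bilin n c (unit i) \<beta> = (\<Sum>k<n. if k = i then \<Sum>j<n. c k j * \<beta> j else 0)"
    unfolding bilin_def unit_def by (intro sum.cong) auto
  then show ?thesis using \<open>i < n\<close> by simp
qed

lemma bilin_unit_right: "i < n \<Longrightarrow> bilin n c \<alpha> (unit i) = (\<Sum>j<n. c j i * \<alpha> j)"
  by (subst bilin_swap) (rule bilin_unit_left)

lemma sum_mult_unit: "i < n \<Longrightarrow> (\<Sum>j<n. c j * unit i j) = c i"
  by (simp add: unit_def if_distrib cong: if_cong)

definition order_form :: "nat \<Rightarrow> (nat \<Rightarrow> bit) \<Rightarrow> (nat \<Rightarrow> bit) \<Rightarrow> bit" where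
  "order_form n = bilin n (\<lambda>i j. of_bool (j < i))"

text \<open>
  The number of inversions of \<open>\<pi>\<close> inside the support of \<open>\<delta>\<close>, plus \<open>B(\<delta>, \<delta>)\<close>, counts the pairs
  whose order \<open>\<pi>\<close> preserves; the second coefficient is \<open>B(\<pi>\<delta>, \<delta>)\<close> after reindexing the first
  argument.
\<close>

definition perm_form :: "nat \<Rightarrow> (nat \<Rightarrow> nat) \<Rightarrow> (nat \<Rightarrow> bit) \<Rightarrow> bit" where
  "perm_form n \<pi> \<delta> = bilin n (\<lambda>i j. of_bool (i < j \<and> \<pi> i < \<pi> j) + of_bool (j < \<pi> i)) \<delta> \<delta>"

lemma perm_form_cong: "(\<And>i. i < n \<Longrightarrow> \<delta> i = \<delta>' i) \<Longrightarrow> perm_form n \<pi> \<delta> = perm_form n \<pi> \<delta>'"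
  unfolding perm_form_def by (intro bilin_cong) auto

lemma perm_form_id: "perm_form n id \<delta> = 0"
  unfolding perm_form_def by (rule bilin_alternating) auto

text \<open>
  Whether \<open>\<pi> \<circ> \<rho>\<close> inverts a pair is decided by whether \<open>\<rho>\<close> inverts it and whether \<open>\<pi>\<close> inverts
  its image; the remaining terms \<open>B\<close> telescope.
\<close>

lemma perm_form_compose:
  assumes \<pi>: "\<pi> permutes {..<n}" and \<rho>: "\<rho> permutes {..<n}"
  shows "perm_form n (\<pi> \<circ> \<rho>) \<delta> = perm_form n \<rho> \<delta> + perm_form n \<pi> (\<lambda>i. \<delta> (pinv \<rho> i))
    + order_form n (\<lambda>i. \<delta> (pinv \<rho> (pinv \<pi> i)) + \<delta> (pinv \<rho> i)) (\<lambda>i. \<delta> (pinv \<rho> i) + \<delta> i)"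
proof -
  have \<pi>\<rho>: "\<pi> \<circ> \<rho> permutes {..<n}" by (rule permutes_compose[OF \<rho> \<pi>])
  have inv: "pinv (\<pi> \<circ> \<rho>) i = pinv \<rho> (pinv \<pi> i)" for i
    using permutes_inv_o[OF \<pi>] permutes_inv_o[OF \<rho>] permutes_bij[OF \<pi>] permutes_bij[OF \<rho>]
    by (simp add: o_inv_distrib)
  note reindex = bilin_reindex[where \<alpha> = \<delta> and \<beta> = \<delta>]
  note re = reindex[OF \<pi>\<rho> \<rho>, unfolded inv] reindex[OF \<rho> \<rho>]
    reindex[OF \<rho> permutes_id, unfolded inv_id id_apply] reindex[OF \<pi>\<rho> permutes_id, unfolded inv
        inv_id id_apply]
  have "perm_form n (\<pi> \<circ> \<rho>) \<delta> + (perm_form n \<rho> \<delta> + perm_form n \<pi> (\<lambda>i. \<delta> (pinv \<rho> i))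
      + order_form n (\<lambda>i. \<delta> (pinv \<rho> (pinv \<pi> i)) + \<delta> (pinv \<rho> i)) (\<lambda>i. \<delta> (pinv \<rho> i) + \<delta> i)) = 0"
    unfolding perm_form_def order_form_def bilin_add_left bilin_add_right re bilin_add_coeff[symmetric]
    by (rule bilin_alternating) (auto simp: algebra_simps, (use permutes_inj[OF \<rho>] permutes_inj[OF
        \<pi>] in \<open>force simp: inj_eq of_bool_def\<close>)+)
  then show ?thesis by (simp only: bit_add_eq_0_iff)
qed


text \<open>
  The two values of \<open>B\<close> are the twists in the product of a group element with the \<open>i\<close>-th
  variable and in the product of the variable with index \<open>\<pi> i\<close> with that group element.
\<close>

lemma perm_form_add_unit:
  assumes \<pi>: "\<pi> permutes {..<n}" and i: "i < n"
  shows "perm_form n \<pi> (\<lambda>k. \<delta> k + unit i k) = perm_form n \<pi> \<delta>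
    + order_form n (\<lambda>k. \<delta> (pinv \<pi> k) + \<delta> k + unit (\<pi> i) k + unit i k) (unit i)
    + order_form n (unit (\<pi> i)) (\<lambda>k. \<delta> (pinv \<pi> k) + \<delta> k)"
proof -
  have \<pi>i: "\<pi> i < n" using permutes_in_image[OF \<pi>, of i] i by simp
  have re: "(\<Sum>k<n. c k * \<delta> (pinv \<pi> k)) = (\<Sum>k<n. c (\<pi> k) * \<delta> k)" for c
    using sum.permute[OF \<pi>, of "\<lambda>k. c k * \<delta> (pinv \<pi> k)"] by (simp add: permutes_inverses[OF \<pi>] o_def)
  have coeff: "(of_bool (k < i \<and> \<pi> k < \<pi> i) + of_bool (i < \<pi> k)) + (of_bool (i < k \<and> \<pi> i < \<pi> k)
      + of_bool (k < \<pi> i))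
      = (of_bool (i < \<pi> k) + of_bool (i < k) + of_bool (\<pi> k < \<pi> i) + of_bool (k < \<pi> i) :: bit)" for k
    using permutes_inj[OF \<pi>] by (cases k i rule: linorder_cases; cases "\<pi> k" "\<pi> i" rule:
        linorder_cases) (auto simp: inj_eq algebra_simps)
  let ?X = "\<Sum>k<n. (of_bool (k < i \<and> \<pi> k < \<pi> i) + of_bool (i < \<pi> k)) * \<delta> k"
    and ?Y = "\<Sum>k<n. (of_bool (i < k \<and> \<pi> i < \<pi> k) + of_bool (k < \<pi> i)) * \<delta> k"
  have "?X + ?Y = (\<Sum>k<n. of_bool (i < \<pi> k) * \<delta> k) + (\<Sum>k<n. of_bool (i < k) * \<delta> k)
      + (\<Sum>k<n. of_bool (\<pi> k < \<pi> i) * \<delta> k) + (\<Sum>k<n. of_bool (k < \<pi> i) * \<delta> k)" (is "_ = ?Z")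
    unfolding sum.distrib[symmetric] distrib_right[symmetric] coeff ..
  moreover have "?X = ?X + ?Y + ?Y" by (simp only: add.assoc bit_add_self add_0_right)
  ultimately have X: "?X = ?Z + ?Y" by (simp only:)
  show ?thesis
    unfolding perm_form_def order_form_def bilin_add_left bilin_add_right
      bilin_unit_left[OF i] bilin_unit_right[OF i] bilin_unit_left[OF \<pi>i] re
      sum_mult_unit[OF i] sum_mult_unit[OF \<pi>i] X
    by (simp only: less_irrefl simp_thms of_bool_eq add_ac bit_add_self bit_add_left_self add_0_left
        add_0_right)
qed

lemma perm_form_transpose:
  assumes "i < j" "j < n"
  shows "perm_form n (transpose i j) \<delta> = \<delta> i"
proof -
  have i: "i < n" using assms by simp
  have "bilin n (\<lambda>a b. unit i a * unit i b) \<delta> \<delta> = (\<Sum>a<n. \<delta> a * unit i a) * (\<Sum>b<n. \<delta> b * unit i b)"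
    unfolding bilin_def sum_product by (intro sum.cong refl) (simp add: ac_simps)
  then have "\<delta> i = bilin n (\<lambda>a b. unit i a * unit i b) \<delta> \<delta>"
      by (simp only: sum_mult_unit[OF i] bit_mult_self)
  moreover have "perm_form n (transpose i j) \<delta> + bilin n (\<lambda>a b. unit i a * unit i b) \<delta> \<delta> = 0"
    unfolding perm_form_def bilin_add_coeff[symmetric]
    by (rule bilin_alternating) (use assms in \<open>auto simp: transpose_def of_bool_def unit_def\<close>)
  ultimately show ?thesis by (simp add: bit_add_eq_0_iff)
qed

text \<open>
  The difference of both sides is linear in \<open>\<delta>\<close>. Its coefficient at \<open>i\<close> counts indices \<open>j\<close> by
  their position relative to \<open>i\<close> before and after \<open>\<pi>\<close>, and is even.
\<close>

lemma perm_form_complement: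
  assumes \<pi>: "\<pi> permutes {..<n}"
  shows "perm_form n \<pi> (\<lambda>k. \<delta> k + 1) = perm_form n \<pi> \<delta> + perm_form n \<pi> (\<lambda>k. 1)"
proof -
  let ?c = "\<lambda>i j. of_bool (i < j \<and> \<pi> i < \<pi> j) + of_bool (j < \<pi> i) :: bit"
  have coeff: "of_bool (i < j \<and> \<pi> i < \<pi> j) + of_bool (\<pi> j < \<pi> i) + of_bool (j < i \<and> \<pi> j < \<pi> i)
      + of_bool (i < j) = (0::bit)" for i j
    using permutes_inj[OF \<pi>] by (cases j i rule: linorder_cases; cases "\<pi> j" "\<pi> i" rule:
        linorder_cases) (auto simp: inj_eq)
  have row: "(\<Sum>j<n. ?c i j + ?c j i) = 0" for i
  proof -
    have "(\<Sum>j<n. of_bool (j < \<pi> i)) = (\<Sum>j<n. of_bool (\<pi> j < \<pi> i) :: bit)"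
      "(\<Sum>j<n. of_bool (i < \<pi> j)) = (\<Sum>j<n. of_bool (i < j) :: bit)"
      by (rule sum.permute[OF \<pi>, of "\<lambda>j. of_bool (j < \<pi> i)", unfolded o_def],
          rule sum.permute[OF \<pi>, of "\<lambda>j. of_bool (i < j)", unfolded o_def, symmetric])
    then have "(\<Sum>j<n. ?c i j + ?c j i) = (\<Sum>j<n. of_bool (i < j \<and> \<pi> i < \<pi> j) + of_bool (\<pi> j < \<pi> i)
        + of_bool (j < i \<and> \<pi> j < \<pi> i) + of_bool (i < j))"
      by (simp only: sum.distrib add_ac)
    then show ?thesis unfolding coeff by simp
  qed
  have "bilin n ?c \<delta> (\<lambda>k. 1) + bilin n ?c (\<lambda>k. 1) \<delta> = (\<Sum>i<n. (\<Sum>j<n. ?c i j + ?c j i) * \<delta> i)"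
  proof -
    have "bilin n ?c \<delta> (\<lambda>k. 1) = (\<Sum>i<n. \<Sum>j<n. ?c i j * \<delta> i)"
      by (simp only: bilin_def mult_1_right)
    moreover have "bilin n ?c (\<lambda>k. 1) \<delta> = (\<Sum>i<n. \<Sum>j<n. ?c j i * \<delta> i)"
      by (subst bilin_swap) (simp only: bilin_def mult_1_right)
    ultimately show ?thesis
      by (simp only: sum.distrib[symmetric] distrib_right[symmetric] sum_distrib_right[symmetric])
  qed
  also have "\<dots> = 0" unfolding row by simp
  finally have 1: "bilin n ?c \<delta> (\<lambda>k. 1) = bilin n ?c (\<lambda>k. 1) \<delta>" by (simp add: bit_add_eq_0_iff)
  show ?thesis
    unfolding perm_form_def bilin_add_left bilin_add_right using 1 by (simp add: add_ac)
qed

text \<open>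
  On the all-one vector the terms \<open>B\<close> in the cocycle identity vanish, so both sides are
  homomorphisms, and they agree on transpositions.
\<close>

lemma sg_perm_form_ones:
  assumes "\<pi> permutes {..<n}"
  shows "sg (perm_form n \<pi> (\<lambda>k. 1)) = of_int (sign \<pi>)"
  using assms finite_lessThan
proof (induction rule: permutes_induct)
  case id
  then show ?case by (simp add: perm_form_id[unfolded id_def])
next
  case (swap a b p)
  have t: "transpose a b permutes {..<n}" using swap by (intro permutes_swap_id)
  have one: "perm_form n (transpose a b) (\<lambda>k. 1) = 1"
    using swap(1-3) perm_form_transpose[of a b n "\<lambda>k. 1"] perm_form_transpose[of b a n "\<lambda>k. 1"]
    by (cases a b rule: linorder_cases) (auto simp: transpose_commute)
  have "sign (transpose a b \<circ> p) = - sign p"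
    using swap(3-5) t by (subst sign_compose) (auto simp: sign_swap_id intro:
        permutes_imp_permutation[of "{..<n}"])
  have "sg (perm_form n (transpose a b \<circ> p) (\<lambda>k. 1)) = - sg (perm_form n p (\<lambda>k. 1))"
    by (simp only: perm_form_compose[OF t \<open>p permutes {..<n}\<close>] sg_add one sg_simps) (simp add:
        order_form_def bilin_def)
  then show ?case
    by (simp only: swap.IH \<open>sign (transpose a b \<circ> p) = - sign p\<close> of_int_minus)
qed

section \<open>Monomial matrices\<close>

definition monomat :: "nat \<Rightarrow> (nat \<Rightarrow> nat) \<Rightarrow> (nat \<Rightarrow> complex) \<Rightarrow> complex mat" where
  "monomat n \<pi> a = mat n n (\<lambda>(r, k). if r = \<pi> k then a k else 0)"

lemma monomat_carrier [simp]: "monomat n \<pi> a \<in> carrier_mat n n"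
  and monomat_index [simp]: "r < n \<Longrightarrow> k < n \<Longrightarrow> monomat n \<pi> a $$ (r, k) = (if r = \<pi> k then a k else 0)"
  by (simp_all add: monomat_def)

lemma monomat_dim [simp]: "dim_row (monomat n \<pi> a) = n" "dim_col (monomat n \<pi> a) = n"
  by (simp_all add: monomat_def)

lemma monomat_cong: "(\<And>k. k < n \<Longrightarrow> \<pi> k = \<rho> k) \<Longrightarrow> (\<And>k. k < n \<Longrightarrow> a k = b k) \<Longrightarrow> monomat n \<pi> a = monomat n \<rho> b"
  by (rule eq_matI) auto

lemma monomat_mult:
  assumes \<rho>: "\<rho> permutes {..<n}"
  shows "monomat n \<pi> a * monomat n \<rho> b = monomat n (\<pi> \<circ> \<rho>) (\<lambda>k. a (\<rho> k) * b k)"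
proof (rule eq_matI)
  fix r k assume rk: "r < dim_row (monomat n (\<pi> \<circ> \<rho>) (\<lambda>k. a (\<rho> k) * b k))" "k < dim_col (monomat n
      (\<pi> \<circ> \<rho>) (\<lambda>k. a (\<rho> k) * b k))"
  then have \<rho>k: "\<rho> k < n" using permutes_in_image[OF \<rho>, of k] by simp
  have "(monomat n \<pi> a * monomat n \<rho> b) $$ (r, k) =
      (\<Sum>l<n. (if r = \<pi> l then a l else 0) * (if l = \<rho> k then b k else 0))"
    using rk by (simp add: scalar_prod_def lessThan_atLeast0)
  also have "\<dots> = (\<Sum>l<n. if l = \<rho> k then (if r = \<pi> (\<rho> k) then a (\<rho> k) * b k else 0) else 0)"
    by (intro sum.cong) auto
  also have "\<dots> = monomat n (\<pi> \<circ> \<rho>) (\<lambda>k. a (\<rho> k) * b k) $$ (r, k)"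
    using rk \<rho>k by simp
  finally show "(monomat n \<pi> a * monomat n \<rho> b) $$ (r, k) = \<dots>" .
qed simp_all

lemma monomat_mult_diag: "monomat n \<pi> a * monomat n id b = monomat n \<pi> (\<lambda>k. a k * b k)"
  by (simp only: monomat_mult[OF permutes_id] comp_id id_apply)

lemma monomat_one: "1\<^sub>m n = monomat n id (\<lambda>k. 1)"
  by (rule eq_matI) auto

lemma det_monomat:
  assumes \<pi>: "\<pi> permutes {..<n}"
  shows "det (monomat n \<pi> a) = of_int (sign \<pi>) * (\<Prod>k<n. a k)"
proof -
  have "monomat n \<pi> (\<lambda>k. 1) = mat n n (\<lambda>(i, j). 1\<^sub>m n $$ (pinv \<pi> i, j))"
  proof (rule eq_matI)
    fix i j assume "i < dim_row (mat n n (\<lambda>(i, j). 1\<^sub>m n $$ (pinv \<pi> i, j) :: complex))"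
      "j < dim_col (mat n n (\<lambda>(i, j). 1\<^sub>m n $$ (pinv \<pi> i, j) :: complex))"
    then have ij: "i < n" "j < n" "pinv \<pi> i < n"
      using permutes_in_image[OF permutes_inv[OF \<pi>], of i] by auto
    then show "monomat n \<pi> (\<lambda>k. 1) $$ (i, j) = mat n n (\<lambda>(i, j). 1\<^sub>m n $$ (pinv \<pi> i, j)) $$ (i, j)"
      using permutes_inverses[OF \<pi>] by auto
  qed simp_all
  then have 1: "det (monomat n \<pi> (\<lambda>k. 1)) = of_int (sign \<pi>)"
    using det_permute_rows[OF one_carrier_mat, of "pinv \<pi>" n] permutes_inv[OF \<pi>] sign_inverse[OF
        permutes_imp_permutation[OF _ \<pi>]]
    by (simp add: lessThan_atLeast0)
  have 2: "det (monomat n id a) = (\<Prod>k<n. a k)"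
    using det_upper_triangular[of "monomat n id a" n]
    by (simp add: prod_list_diag_prod lessThan_atLeast0 upper_triangular_def)
  have "monomat n \<pi> a = monomat n \<pi> (\<lambda>k. 1) * monomat n id a"
    by (simp add: monomat_mult_diag)
  then show ?thesis using 1 2 by (simp add: det_mult[of _ n])
qed

lemma monomat_eqD:
  assumes "monomat n \<pi> a = monomat n \<rho> b" "\<pi> permutes {..<n}" "\<rho> permutes {..<n}" "\<And>k. k < n \<Longrightarrow> a k \<noteq> 0"
  shows "\<pi> = \<rho>" "k < n \<Longrightarrow> a k = b k"
proof -
  have *: "\<pi> k = \<rho> k \<and> a k = b k" if "k < n" for k
  proof -
    have "\<pi> k < n" using that permutes_in_image[OF assms(2), of k] by simp
    then have "monomat n \<rho> b $$ (\<pi> k, k) = a k" unfolding assms(1)[symmetric] using that by simp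
    then show ?thesis using that \<open>\<pi> k < n\<close> assms(4)[OF that] by (auto split: if_splits)
  qed
  then show "k < n \<Longrightarrow> a k = b k" by simp
  show "\<pi> = \<rho>"
  proof
    fix k show "\<pi> k = \<rho> k"
      using * permutes_not_in[OF assms(2), of k] permutes_not_in[OF assms(3), of k]
          by (cases "k < n") auto
  qed
qed

lemma inv_mat_monomat:
  assumes \<pi>: "\<pi> permutes {..<n}" and a: "\<And>k. k < n \<Longrightarrow> a k \<noteq> 0"
  shows "inv_mat n (monomat n \<pi> a) = monomat n (pinv \<pi>) (\<lambda>k. inverse (a (pinv \<pi> k)))"
proof -
  interpret R: ring "ring_mat TYPE(complex) n ()" by (rule ring_mat)
  have "monomat n \<pi> a * monomat n (pinv \<pi>) (\<lambda>k. inverse (a (pinv \<pi> k))) = 1\<^sub>m n"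
    unfolding monomat_mult[OF permutes_inv[OF \<pi>]] monomat_one
    by (rule monomat_cong) (use a permutes_in_image[OF permutes_inv[OF \<pi>]] permutes_inverses[OF \<pi>]
        in auto)
  moreover have "monomat n (pinv \<pi>) (\<lambda>k. inverse (a (pinv \<pi> k))) * monomat n \<pi> a = 1\<^sub>m n"
    unfolding monomat_mult[OF \<pi>] monomat_one
    by (rule monomat_cong) (use a permutes_inverses[OF \<pi>] in auto)
  ultimately show ?thesis
    unfolding inv_mat_def
    by (intro R.inv_char) (simp_all add: ring_mat_simps)
qed

definition monomial :: "nat \<Rightarrow> complex mat \<Rightarrow> bool" where
  "monomial n M \<longleftrightarrow> (\<exists>\<pi> a. \<pi> permutes {..<n} \<and> (\<forall>k<n. a k \<noteq> 0) \<and> M = monomat n \<pi> a)"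

text \<open>
  Entries are required to be nonzero because otherwise a matrix does not determine its
  permutation.
\<close>

definition perm_of :: "nat \<Rightarrow> complex mat \<Rightarrow> nat \<Rightarrow> nat" where
  "perm_of n M = (THE \<pi>. \<pi> permutes {..<n} \<and> (\<exists>a. (\<forall>k<n. a k \<noteq> 0) \<and> M = monomat n \<pi> a))"

lemma perm_of_monomat:
  assumes "\<pi> permutes {..<n}" "\<And>k. k < n \<Longrightarrow> a k \<noteq> 0"
  shows "perm_of n (monomat n \<pi> a) = \<pi>"
  unfolding perm_of_def by (rule the_equality) (use assms monomat_eqD(1)[of n] in \<open>blast, metis\<close>)

lemma monomial_monomat: "\<pi> permutes {..<n} \<Longrightarrow> (\<And>k. k < n \<Longrightarrow> a k \<noteq> 0) \<Longrightarrow> monomial n (monomat n \<pi> a)"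
  unfolding monomial_def by blast

definition sign_mat :: "nat \<Rightarrow> (nat \<Rightarrow> bit) \<Rightarrow> complex mat" where
  "sign_mat n \<epsilon> = monomat n id (\<lambda>k. sg (\<epsilon> k))"

lemma monomat_sign_mat: "monomat n \<pi> a * sign_mat n \<epsilon> = monomat n \<pi> (\<lambda>k. a k * sg (\<epsilon> k))"
  by (simp add: sign_mat_def monomat_mult_diag)

lemma sign_mat_monomat:
  "\<pi> permutes {..<n} \<Longrightarrow> sign_mat n \<epsilon> * monomat n \<pi> a = monomat n \<pi> (\<lambda>k. a k * sg (\<epsilon> (\<pi> k)))"
  unfolding sign_mat_def by (subst monomat_mult) (simp_all only: id_comp mult.commute)

lemma t_mat_monomat: "t_mat n i z = monomat n id (\<lambda>k. if k = i then z else 1)"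
  unfolding t_mat_def monomat_def by (rule cong_mat) auto

lemma t_mat_sign: "t_mat n k (-1) = sign_mat n (unit k)"
  unfolding t_mat_monomat sign_mat_def by (rule monomat_cong) (auto simp: unit_def)

lemma s_mat_monomat:
  "i \<noteq> j \<Longrightarrow> s_mat n i j z = monomat n (transpose i j) (\<lambda>k. if k = i then inverse z else if k
      = j then z else 1)"
  unfolding s_mat_def monomat_def by (rule cong_mat) (auto simp: transpose_def)

lemma sigma_mat_monomat:
  "i \<noteq> j \<Longrightarrow> sigma_mat n i j z = monomat n (transpose i j) (\<lambda>k. if k = i then inverse z else if k
      = j then - z else 1)"
  unfolding sigma_mat_def monomat_def by (rule cong_mat) (auto simp: transpose_def)

text \<open>
  The groups for both algebras: monomial matrices whose entries are \<open>m\<close>-th roots of unity. They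
  differ only in whether the sign of the permutation enters the condition on the entries; \<open>br\<close>
  selects the braided case.
\<close>

definition mgroup :: "bool \<Rightarrow> nat \<Rightarrow> nat \<Rightarrow> nat \<Rightarrow> complex mat set" where
  "mgroup br m p n = {monomat n \<pi> a | \<pi> a. \<pi> permutes {..<n} \<and> (\<forall>k<n. a k ^ m = 1) \<and>
     ((if br then of_int (sign \<pi>) else 1) * (\<Prod>k<n. a k)) ^ (m div p) = 1}"

lemma diag_pow: "monomat n id a ^\<^sub>m m = monomat n id (\<lambda>k. a k ^ m)"
proof (induction m)
  case 0
  show ?case by (simp only: pow_mat.simps monomat_dim monomat_one power_0)
next
  case (Suc m)
  then show ?case by (simp only: pow_mat.simps monomat_mult_diag power_Suc2)
qed

lemma Tgrp_eq: "Tgrp m p n = {monomat n id a | a. (\<forall>k<n. a k ^ m = 1) \<and> (\<Prod>k<n. a k) ^ (m div p) = 1}"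
proof (intro Set.set_eqI iffI)
  fix t assume t: "t \<in> Tgrp m p n"
  then have c: "t \<in> carrier_mat n n" by (simp add: Tgrp_def)
  have eq: "t = monomat n id (\<lambda>k. t $$ (k, k))"
    by (rule eq_matI) (use t c in \<open>auto simp: Tgrp_def diagonal_mat_def\<close>)
  have "monomat n id (\<lambda>k. (t $$ (k, k)) ^ m) = 1\<^sub>m n"
    using t unfolding diag_pow[symmetric] eq[symmetric] by (simp add: Tgrp_def)
  then have "(t $$ (k, k)) ^ m = 1" if "k < n" for k
    using that monomat_index[of k n k id "\<lambda>k. (t $$ (k, k)) ^ m"] by simp
  moreover have "(\<Prod>k<n. t $$ (k, k)) ^ (m div p) = 1"
    using t det_monomat[OF permutes_id, of n "\<lambda>k. t $$ (k, k)"] eq by (simp add: Tgrp_def roots1_def)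
  ultimately show "t \<in> {monomat n id a | a. (\<forall>k<n. a k ^ m = 1) \<and> (\<Prod>k<n. a k) ^ (m div p) = 1}"
    using eq by blast
next
  fix t assume "t \<in> {monomat n id a | a. (\<forall>k<n. a k ^ m = 1) \<and> (\<Prod>k<n. a k) ^ (m div p) = 1}"
  then obtain a where t: "t = monomat n id a" "\<forall>k<n. a k ^ m = 1" "(\<Prod>k<n. a k) ^ (m div p) = 1" by blast
  then show "t \<in> Tgrp m p n"
    by (auto simp: Tgrp_def diagonal_mat_def diag_pow monomat_one roots1_def det_monomat[OF
        permutes_id] intro: monomat_cong)
qed

lemma perm_mats_eq: "perm_mats n = {monomat n \<pi> (\<lambda>k. 1) | \<pi>. \<pi> permutes {..<n}}"
  by (simp add: perm_mats_def monomat_def)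

lemma Ggrp_eq: "Ggrp m p n = mgroup False m p n"
proof -
  have "monomat n \<pi> (\<lambda>k. 1) * monomat n id a = monomat n \<pi> a" for \<pi> a
    by (simp add: monomat_mult_diag)
  then show ?thesis
    unfolding Ggrp_def mgroup_def perm_mats_eq Tgrp_eq by (auto, metis+)
qed

lemma muGgrp_eq: "muGgrp m p n = mgroup True m p n"
proof -
  have *: "monomat n \<pi> (\<lambda>k. 1) * monomat n id a = monomat n \<pi> a" for \<pi> a
    by (simp add: monomat_mult_diag)
  have **: "(\<Prod>k<n. a k) ^ m = 1" if "\<forall>k<n. a k ^ m = 1" for a :: "nat \<Rightarrow> complex"
    using that by (simp add: prod_power_distrib)
  show ?thesis
  proof (intro Set.set_eqI iffI)
    fix M assume "M \<in> muGgrp m p n"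
    then obtain \<pi> a where "\<pi> permutes {..<n}" "M = monomat n \<pi> a" "\<forall>k<n. a k ^ m
        = 1" "det (monomat n \<pi> a) \<in> roots1 (m div p)"
      unfolding muGgrp_def perm_mats_eq Tgrp_eq by (auto simp: *)
    then show "M \<in> mgroup True m p n" unfolding mgroup_def by (auto simp: roots1_def det_monomat)
  next
    fix M assume "M \<in> mgroup True m p n"
    then obtain \<pi> a where M: "\<pi> permutes {..<n}" "M = monomat n \<pi> a" "\<forall>k<n. a k ^ m = 1"
      "(of_int (sign \<pi>) * (\<Prod>k<n. a k)) ^ (m div p) = 1"
      unfolding mgroup_def by auto
    then have "monomat n \<pi> (\<lambda>k. 1) \<in> perm_mats n" "monomat n id a \<in> Tgrp m 1 n" "det (monomat n \<pi> a)
        \<in> roots1 (m div p)"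
      using ** by (auto simp: perm_mats_eq Tgrp_eq det_monomat roots1_def)
    then show "M \<in> muGgrp m p n"
      unfolding muGgrp_def M(2) by (intro CollectI exI[of _ "monomat n \<pi> (\<lambda>k. 1)"] exI[of _ "monomat
          n id a"]) (simp only: *)
  qed
qed

lemma mgroupE:
  assumes "M \<in> mgroup br m p n" "m > 0"
  obtains \<pi> a where "M = monomat n \<pi> a" "\<pi> permutes {..<n}" "\<And>k. k < n \<Longrightarrow> a k ^ m = 1" "\<And>k. k < n
      \<Longrightarrow> a k \<noteq> 0"
    "((if br then of_int (sign \<pi>) else 1) * (\<Prod>k<n. a k)) ^ (m div p) = 1"
proof -
  obtain \<pi> a where "M = monomat n \<pi> a" "\<pi> permutes {..<n}" "\<forall>k<n. a k ^ m = 1"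
    "((if br then of_int (sign \<pi>) else 1) * (\<Prod>k<n. a k)) ^ (m div p) = 1"
    using assms(1) unfolding mgroup_def by blast
  moreover have "a k \<noteq> 0" if "k < n" for k
    using \<open>\<forall>k<n. a k ^ m = 1\<close> that assms(2) by (auto simp: power_0_left)
  ultimately show ?thesis using that by blast
qed

lemma mgroup_one: "1\<^sub>m n \<in> mgroup br m p n"
  unfolding mgroup_def monomat_one by (intro CollectI exI[of _ id] exI[of _ "\<lambda>k. 1"]) (simp add:
      permutes_id)

lemma mgroup_mult:
  assumes "M \<in> mgroup br m p n" "N \<in> mgroup br m p n" "m > 0"
  shows "M * N \<in> mgroup br m p n"
proof -
  obtain \<pi> a where M: "M = monomat n \<pi> a" "\<pi> permutes {..<n}" "\<And>k. k < n \<Longrightarrow> a k ^ m = 1"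
    "((if br then of_int (sign \<pi>) else 1) * (\<Prod>k<n. a k)) ^ (m div p) = 1"
    using mgroupE[OF assms(1,3)] by metis
  obtain \<rho> b where N: "N = monomat n \<rho> b" "\<rho> permutes {..<n}" "\<And>k. k < n \<Longrightarrow> b k ^ m = 1"
    "((if br then of_int (sign \<rho>) else 1) * (\<Prod>k<n. b k)) ^ (m div p) = 1"
    using mgroupE[OF assms(2,3)] by metis
  have "(\<Prod>k<n. a (\<rho> k)) = (\<Prod>k<n. a k)" using prod.permute[OF N(2), of a] by (simp add: o_def)
  moreover have "sign (\<pi> \<circ> \<rho>) = sign \<pi> * sign \<rho>"
    using M(2) N(2) by (intro sign_compose) (auto intro: permutes_imp_permutation[of "{..<n}"])
  moreover have "((if br then of_int (sign \<pi>) else 1) * (\<Prod>k<n. a k) * ((if br then of_int (sign \<rho>)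
      else 1) * (\<Prod>k<n. b k))) ^ (m div p) = 1"
    unfolding power_mult_distrib[of "_ * _" "_ * _"] M(4) N(4) by simp
  ultimately have "((if br then of_int (sign (\<pi> \<circ> \<rho>)) else 1) * (\<Prod>k<n. a (\<rho> k) * b k)) ^ (m div p) = 1"
    by (simp add: prod.distrib mult_ac split: if_splits)
  moreover have "(a (\<rho> k) * b k) ^ m = 1" if "k < n" for k
    using that M(3)[of "\<rho> k"] N(3) permutes_in_image[OF N(2), of k] by (simp add: power_mult_distrib)
  ultimately show ?thesis
    unfolding M(1) N(1) monomat_mult[OF N(2)] mgroup_def
    by (intro CollectI exI[of _ "\<pi> \<circ> \<rho>"] exI[of _ "\<lambda>k. a (\<rho> k) * b k"]) (simp add:
        permutes_compose[OF N(2) M(2)])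
qed

text \<open>
  If the determinant of the sign matrix equals the sign of the permutation, multiplication by it
  passes from one group to the other.
\<close>

lemma mgroup_sign_mat:
  assumes M: "M \<in> mgroup br m p n" and m: "m > 0" "even m"
    and \<epsilon>: "sg (\<Sum>k<n. \<epsilon> k) = (if br = br' then 1 else of_int (sign (perm_of n M)))"
  shows "M * sign_mat n \<epsilon> \<in> mgroup br' m p n"
proof -
  obtain \<pi> a where M: "M = monomat n \<pi> a" "\<pi> permutes {..<n}" "\<And>k. k < n \<Longrightarrow> a k ^ m = 1" "\<And>k. k < n
      \<Longrightarrow> a k \<noteq> 0"
    "((if br then of_int (sign \<pi>) else 1) * (\<Prod>k<n. a k)) ^ (m div p) = 1"
    using mgroupE[OF M m(1)] by metis
  have "(\<Prod>k<n. a k * sg (\<epsilon> k)) = (\<Prod>k<n. a k) * sg (\<Sum>k<n. \<epsilon> k)"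
    by (simp add: prod.distrib sg_sum)
  then have "(if br' then of_int (sign \<pi>) else 1) * (\<Prod>k<n. a k * sg (\<epsilon> k))
      = (if br then of_int (sign \<pi>) else 1) * (\<Prod>k<n. a k)"
    using \<epsilon> perm_of_monomat[of \<pi> n a, OF M(2,4)] by (cases br; cases br') (auto simp: M(1) sign_def)
  moreover have "sg b ^ m = 1" for b using m by (auto simp: sg_def)
  then have "(a k * sg (\<epsilon> k)) ^ m = 1" if "k < n" for k using M(3)[OF that]
      by (simp add: power_mult_distrib)
  ultimately show ?thesis
    unfolding M(1) monomat_sign_mat mgroup_def using M(2,5)
    by (intro CollectI exI[of _ \<pi>] exI[of _ "\<lambda>k. a k * sg (\<epsilon> k)"]) simp
qed

section \<open>Weights and the twisted product\<close>

text \<open>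
  Matrices that are not monomial are left alone, which makes this an action by commuting
  involutions on all letters.
\<close>

definition sign_conj :: "nat \<Rightarrow> nat \<Rightarrow> complex mat \<Rightarrow> complex mat" where
  "sign_conj n k M =
    (if monomial n M then sign_mat n (unit k) * M * sign_mat n (unit k) else M)"

lemma sign_conj_monomat:
  assumes \<pi>: "\<pi> permutes {..<n}" and a: "\<And>k. k < n \<Longrightarrow> a k \<noteq> 0"
  shows "sign_conj n k (monomat n \<pi> a) = monomat n \<pi> (\<lambda>j. a j * sg (unit k (\<pi> j) + unit k j))"
  using monomial_monomat[of \<pi> n a, OF \<pi> a]
  by (simp add: sign_conj_def sign_mat_monomat[OF \<pi>] monomat_sign_mat sg_add mult_ac)

lemma monomialE:
  assumes "monomial n M"
  obtains \<pi> a where "M = monomat n \<pi> a" "\<pi> permutes {..<n}" "\<And>k. k < n \<Longrightarrow> a k \<noteq> 0"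
  using assms unfolding monomial_def by metis

lemma sign_conj_sign_conj: "sign_conj n k (sign_conj n k M) = M"
proof (cases "monomial n M")
  case True
  obtain \<pi> a where M: "M = monomat n \<pi> a" "\<pi> permutes {..<n}" "\<And>k. k < n \<Longrightarrow> a k \<noteq> 0"
    using monomialE[OF True] by metis
  have nz: "k < n \<Longrightarrow> a k * sg (b k) \<noteq> 0" for k b using M(3) by simp
  show ?thesis
    using nz M(3) by (simp add: M(1) sign_conj_monomat[OF M(2)] mult.assoc)
qed (simp add: sign_conj_def)

lemma sign_conj_commute: "sign_conj n k (sign_conj n l M) = sign_conj n l (sign_conj n k M)"
proof (cases "monomial n M")
  case True
  obtain \<pi> a where M: "M = monomat n \<pi> a" "\<pi> permutes {..<n}" "\<And>k. k < n \<Longrightarrow> a k \<noteq> 0"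
    using monomialE[OF True] by metis
  have nz: "k < n \<Longrightarrow> a k * sg (b k) \<noteq> 0" for k b using M(3) by simp
  show ?thesis
    using nz M(3) by (simp add: M(1) sign_conj_monomat[OF M(2)] mult_ac)
qed (simp add: sign_conj_def)

lemma sign_conj_ge: "k \<ge> n \<Longrightarrow> sign_conj n k M = M"
proof (cases "monomial n M")
  case True
  assume k: "k \<ge> n"
  obtain \<pi> a where M: "M = monomat n \<pi> a" "\<pi> permutes {..<n}" "\<And>k. k < n \<Longrightarrow> a k \<noteq> 0"
    using monomialE[OF True] by metis
  have "unit k (\<pi> j) + unit k j = 0" if "j < n" for j
  proof -
    have "\<pi> j < n" using permutes_in_image[OF M(2), of j] that by simp
    then show ?thesis using that k by (simp add: unit_def)
  qed
  then show ?thesis by (auto simp: M(1) sign_conj_monomat[OF M(2,3)] intro: monomat_cong)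
qed (simp add: sign_conj_def)

text \<open>
  Indices \<open>j \<ge> n\<close> are fixed, so that \<open>\<gamma>\<^sub>k\<close> acts trivially for \<open>k \<ge> n\<close>.
\<close>

definition sign_letter :: "nat \<Rightarrow> nat \<Rightarrow> gen \<Rightarrow> gen ncpoly" where
  "sign_letter n k l = (case l of
     XGen j \<Rightarrow> (sg (if j < n then unit j k else 0)) *\<^sub>s xg j
   | YGen j \<Rightarrow> (sg (if j < n then unit j k else 0)) *\<^sub>s yg j
   | GGen M \<Rightarrow> gg (sign_conj n k M))"

definition sign_act :: "nat \<Rightarrow> nat \<Rightarrow> gen ncpoly \<Rightarrow> gen ncpoly" where
  "sign_act n k = free_hom (sign_letter n k)"

lemma sign_act_simps:
  "sign_act n k (f + g) = sign_act n k f + sign_act n k g"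
  "sign_act n k (f - g) = sign_act n k f - sign_act n k g"
  "sign_act n k (f * g) = sign_act n k f * sign_act n k g"
  "sign_act n k (c *\<^sub>s f) = c *\<^sub>s sign_act n k f"
  "sign_act n k (scal c) = scal c"
  "sign_act n k 1 = 1" "sign_act n k 0 = 0"
  "sign_act n k (\<Sum>i\<in>A. h i) = (\<Sum>i\<in>A. sign_act n k (h i))"
  by (simp_all add: sign_act_def free_hom_simps)

lemma sign_act_letter:
  "sign_act n k (xg j) = (sg (if j < n then unit j k else 0)) *\<^sub>s xg j"
  "sign_act n k (yg j) = (sg (if j < n then unit j k else 0)) *\<^sub>s yg j"
  "sign_act n k (gg M) = gg (sign_conj n k M)"
  by (simp_all add: sign_act_def free_hom_simps sign_letter_def)

lemma sign_act_sign_act: "sign_act n k (sign_act n k f) = f"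
proof (induction f rule: ncpoly_induct)
  case (letter l f)
  have "sign_act n k (sign_act n k (letter l)) = letter l"
    by (cases l) (simp_all add: sign_act_letter sign_act_simps sign_conj_sign_conj)
  with letter show ?case by (simp add: sign_act_simps)
qed (simp_all add: sign_act_simps)

lemma sign_act_commute: "sign_act n k (sign_act n l f) = sign_act n l (sign_act n k f)"
proof (induction f rule: ncpoly_induct)
  case (letter x f)
  have "sign_act n k (sign_act n l (letter x)) = sign_act n l (sign_act n k (letter x))"
    by (cases x) (simp_all add: sign_act_letter sign_act_simps mult.commute sign_conj_commute[of n k l])
  with letter show ?case by (simp add: sign_act_simps)
qed (simp_all add: sign_act_simps)

lemma sign_act_ge:
  assumes "k \<ge> n" shows "sign_act n k f = f"
proof (induction f rule: ncpoly_induct)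
  case (letter l f)
  have "sign_act n k (letter l) = letter l"
    using assms by (cases l) (simp_all add: sign_act_letter unit_def sign_conj_ge)
  with letter show ?case by (simp add: sign_act_simps)
qed (simp_all add: sign_act_simps)

text \<open>
  Vectors of length \<open>n\<close>, padded with zeros to make extensional equality available.
\<close>

definition vecs :: "nat \<Rightarrow> (nat \<Rightarrow> bit) set" where
  "vecs n = {\<alpha>. \<forall>i\<ge>n. \<alpha> i = 0}"

lemma vecs_add: "\<alpha> \<in> vecs n \<Longrightarrow> \<beta> \<in> vecs n \<Longrightarrow> (\<lambda>k. \<alpha> k + \<beta> k) \<in> vecs n"
  and vecs_zero: "(\<lambda>k. 0) \<in> vecs n" and vecs_unit: "i < n \<Longrightarrow> unit i \<in> vecs n"
  by (auto simp: vecs_def unit_def)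

definition weight :: "nat \<Rightarrow> (nat \<Rightarrow> bit) \<Rightarrow> gen ncpoly \<Rightarrow> bool" where
  "weight n \<alpha> f \<longleftrightarrow> (\<forall>k. sign_act n k f = (sg (\<alpha> k)) *\<^sub>s f)"

lemma weight_mult: "weight n \<alpha> f \<Longrightarrow> weight n \<beta> g \<Longrightarrow> weight n (\<lambda>k. \<alpha> k + \<beta> k) (f * g)"
  by (simp add: weight_def sign_act_simps sg_add mult_ac)

lemma weight_one: "weight n (\<lambda>k. 0) 1"
  by (simp add: weight_def sign_act_simps)

lemma weight_x: "i < n \<Longrightarrow> weight n (unit i) (xg i)"
  and weight_y: "i < n \<Longrightarrow> weight n (unit i) (yg i)"
  by (simp_all add: weight_def sign_act_letter)

text \<open>
  The projections \<open>(1 \<plusminus> \<gamma>\<^sub>k) / 2\<close> split every element into weight vectors. In the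
  induction, at stage \<open>d\<close> the element is already an eigenvector of \<open>\<gamma>\<^sub>k\<close> for all \<open>k \<ge> d\<close>.
\<close>

lemma weight_induct [case_names add weight]:
  assumes add: "\<And>f g. P f \<Longrightarrow> P g \<Longrightarrow> P (f + g)"
    and weight: "\<And>\<alpha> f. \<alpha> \<in> vecs n \<Longrightarrow> weight n \<alpha> f \<Longrightarrow> P f"
  shows "P f"
proof -
  have "P f" if "\<alpha> \<in> vecs n" "\<And>k. k \<ge> d \<Longrightarrow> sign_act n k f = (sg (\<alpha> k)) *\<^sub>s f" for d \<alpha> f
    using that
  proof (induction d arbitrary: \<alpha> f)
    case 0
    then show ?case by (intro weight[of \<alpha>]) (simp_all add: weight_def)
  next
    case (Suc d)
    show ?case
    proof (cases "d < n")
      case True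
      \<comment> \<open>The projection onto the eigenspace of the sign change \<open>d\<close> with eigenvalue given by \<open>b\<close>.\<close>
      define h where "h b = (1/2) *\<^sub>s (f + (sg b) *\<^sub>s sign_act n d f)" for b
      have P: "P (h b)" for b
      proof (rule Suc.IH[of "\<alpha>(d := b)"])
        show "\<alpha>(d := b) \<in> vecs n" using Suc.prems(1) True by (auto simp: vecs_def)
        fix k assume "d \<le> k"
        show "sign_act n k (h b) = (sg ((\<alpha>(d := b)) k)) *\<^sub>s h b"
        proof (cases "k = d")
          case True
          then show ?thesis
            by (simp add: h_def sign_act_simps sign_act_sign_act smul_distrib add.commute)
        next
          case False
          then have "sign_act n k f = (sg (\<alpha> k)) *\<^sub>s f" using Suc.prems(2)[of k] \<open>d \<le> k\<close> by simp
          moreover from this have "sign_act n k (sign_act n d f) = (sg (\<alpha> k)) *\<^sub>s sign_act n d f"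
            by (simp add: sign_act_commute[of n k] sign_act_simps)
          ultimately show ?thesis using False
            by (simp add: h_def sign_act_simps smul_distrib mult_ac)
        qed
      qed
      have "f = h 0 + h 1"
      proof -
        have "h 0 + h 1 = (1/2) *\<^sub>s f + (1/2) *\<^sub>s f" by (simp add: h_def smul_distrib)
        also have "\<dots> = (1/2 + 1/2) *\<^sub>s f" by (simp only: smul_distrib)
        finally show ?thesis by simp
      qed
      then show ?thesis using P add by metis
    next
      case False
      show ?thesis
        by (rule Suc.IH[OF Suc.prems(1)])
           (use False Suc.prems in \<open>auto simp: sign_act_ge vecs_def\<close>)
    qed
  qed
  from this[of "\<lambda>k. 0" n f] show ?thesis by (simp add: vecs_zero sign_act_ge)
qed

definition tact :: "nat \<Rightarrow> tgrp \<Rightarrow> gen ncpoly \<Rightarrow> gen ncpoly" where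
  "tact n = tgrp_act (sign_act n)"

lemma tact_simps:
  "tact n \<tau> (f + g) = tact n \<tau> f + tact n \<tau> g"
  "tact n \<tau> (c *\<^sub>s f) = c *\<^sub>s tact n \<tau> f"
  "sign_act n k (tact n \<tau> f) = tact n \<tau> (sign_act n k f)"
proof -
  have "foldr (sign_act n) ls (f + g) = foldr (sign_act n) ls f + foldr (sign_act n) ls g \<and>
    foldr (sign_act n) ls (c *\<^sub>s f) = c *\<^sub>s foldr (sign_act n) ls f \<and>
    sign_act n k (foldr (sign_act n) ls f) = foldr (sign_act n) ls (sign_act n k f)" for ls
    by (induction ls) (simp_all add: sign_act_simps sign_act_commute[of n k])
  then show "tact n \<tau> (f + g) = tact n \<tau> f + tact n \<tau> g"
    "tact n \<tau> (c *\<^sub>s f) = c *\<^sub>s tact n \<tau> f"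
    "sign_act n k (tact n \<tau> f) = tact n \<tau> (sign_act n k f)"
    by (simp_all add: tact_def tgrp_act_def)
qed

definition bit_pair :: "nat \<Rightarrow> (nat \<Rightarrow> bit) \<Rightarrow> tgrp \<Rightarrow> bit" where
  "bit_pair n \<alpha> \<tau> = (\<Sum>k<n. \<alpha> k * Poly_Mapping.lookup \<tau> k)"

lemma bit_pair_add: "bit_pair n \<alpha> (\<sigma> + \<tau>) = bit_pair n \<alpha> \<sigma> + bit_pair n \<alpha> \<tau>"
  by (simp add: bit_pair_def lookup_add distrib_left sum.distrib)

lemma bit_pair_simps: "bit_pair n \<alpha> 0 = 0" "i < n \<Longrightarrow> bit_pair n \<alpha> (tgam i) = \<alpha> i"
  by (simp_all add: bit_pair_def tgam_def lookup_single when_def if_distrib cong: if_cong)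

text \<open>
  Nonzero coefficients of an element of \<open>T\<close> are one, so the product of the \<open>\<gamma>\<^sub>k\<close> over its
  support acts by the pairing with the weight.
\<close>

lemma tact_weight:
  assumes \<alpha>: "\<alpha> \<in> vecs n" and f: "weight n \<alpha> f"
  shows "tact n \<tau> f = (sg (bit_pair n \<alpha> \<tau>)) *\<^sub>s f"
proof -
  have fold: "foldr (sign_act n) ls f = (sg (sum_list (map \<alpha> ls))) *\<^sub>s f" for ls
    using f by (induction ls) (simp_all add: weight_def sign_act_simps sg_add mult_ac)
  have "sum_list (map \<alpha> (sorted_list_of_set (Poly_Mapping.keys \<tau>))) = (\<Sum>k\<in>Poly_Mapping.keys \<tau>. \<alpha> k)"
    by (simp add: sum_list_distinct_conv_sum_set)
  also have "\<dots> = (\<Sum>k\<in>Poly_Mapping.keys \<tau>. \<alpha> k * Poly_Mapping.lookup \<tau> k)"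
    by (rule sum.cong) (auto simp: in_keys_iff)
  also have "\<dots> = (\<Sum>k\<in>Poly_Mapping.keys \<tau> \<union> {..<n}. \<alpha> k * Poly_Mapping.lookup \<tau> k)"
    by (rule sum.mono_neutral_left) (auto simp: in_keys_iff)
  also have "\<dots> = bit_pair n \<alpha> \<tau>"
    unfolding bit_pair_def by (rule sum.mono_neutral_right) (use \<alpha> in \<open>auto simp: vecs_def\<close>)
  finally show ?thesis unfolding tact_def tgrp_act_def fold by simp
qed

text \<open>
  Evaluation of the group algebra of \<open>T \<times> T\<close> at the character given by a pair of weights.
\<close>

definition char_eval :: "nat \<Rightarrow> (nat \<Rightarrow> bit) \<Rightarrow> (nat \<Rightarrow> bit) \<Rightarrow> tgrp_alg2 \<Rightarrow> complex" where
  "char_eval n \<alpha> \<beta> K = (\<Sum>u\<in>Poly_Mapping.keys K.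
     Poly_Mapping.lookup K u * (sg (bit_pair n \<alpha> (fst u)) * sg (bit_pair n \<beta> (snd u))))"

lemma char_eval_superset:
  assumes "finite A" "Poly_Mapping.keys K \<subseteq> A"
  shows "char_eval n \<alpha> \<beta> K = (\<Sum>u\<in>A.
     Poly_Mapping.lookup K u * (sg (bit_pair n \<alpha> (fst u)) * sg (bit_pair n \<beta> (snd u))))"
  unfolding char_eval_def by (rule sum.mono_neutral_left) (use assms in \<open>auto simp: in_keys_iff\<close>)

lemma char_eval_add: "char_eval n \<alpha> \<beta> (K + L) = char_eval n \<alpha> \<beta> K + char_eval n \<alpha> \<beta> L"
proof -
  let ?A = "Poly_Mapping.keys K \<union> Poly_Mapping.keys L"
  have A: "finite ?A" "Poly_Mapping.keys K \<subseteq> ?A" "Poly_Mapping.keys L \<subseteq> ?A" "Poly_Mapping.keys (K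
      + L) \<subseteq> ?A"
    using Poly_Mapping.keys_add[of K L] by auto
  show ?thesis unfolding char_eval_superset[OF A(1,2)] char_eval_superset[OF A(1,3)]
      char_eval_superset[OF A(1,4)]
    by (simp add: lookup_add distrib_right sum.distrib)
qed

lemma char_eval_single:
  "char_eval n \<alpha> \<beta> (Poly_Mapping.single u c) = c * (sg (bit_pair n \<alpha> (fst u)) * sg (bit_pair n \<beta>
      (snd u)))"
  by (subst char_eval_superset[of "{u}"]) auto

lemma char_eval_mult: "char_eval n \<alpha> \<beta> (K * L) = char_eval n \<alpha> \<beta> K * char_eval n \<alpha> \<beta> L"
proof (induction K rule: poly_mapping_lin_induct)
  case (single u c)
  show ?case
    by (induction L rule: poly_mapping_lin_induct)
       (simp_all add: mult_single char_eval_single char_eval_add distrib_left bit_pair_add sg_add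
           algebra_simps)
qed (simp add: distrib_right char_eval_add)

lemma char_eval_prod:
  "finite A \<Longrightarrow> char_eval n \<alpha> \<beta> (\<Prod>i\<in>A. K i) = (\<Prod>i\<in>A. char_eval n \<alpha> \<beta> (K i))"
proof (induction A rule: finite_induct)
  case empty
  then show ?case using char_eval_single[of n \<alpha> \<beta> 0 1] by (simp add: bit_pair_simps)
qed (simp add: char_eval_mult)

lemma char_eval_ftw:
  assumes "i < n" "j < n"
  shows "char_eval n \<alpha> \<beta> (ftw i j) = sg (\<alpha> i * \<beta> j)"
proof -
  have "ftw i j = scal (1/2) * (tens 0 0 + tens (tgam i) 0 + tens 0 (tgam j)
      + scal (-1) * tens (tgam i) (tgam j))"
    by (simp add: ftw_def scal_simps)
  then show ?thesis
    by (simp add: char_eval_mult char_eval_add char_eval_single scal_def tens_def bit_pair_simps assms)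
       (cases "\<alpha> i"; cases "\<beta> j"; simp)
qed

lemma char_eval_Ftw: "char_eval n \<alpha> \<beta> (Ftw n) = sg (order_form n \<alpha> \<beta>)"
proof -
  let ?P = "{(i, j). j < i \<and> i < n}"
  have P: "?P \<subseteq> {..<n} \<times> {..<n}" by auto
  have "finite ?P" by (rule finite_subset[OF P]) simp
  then have "char_eval n \<alpha> \<beta> (Ftw n) = (\<Prod>(i, j)\<in>?P. sg (\<alpha> i * \<beta> j))"
    unfolding Ftw_def by (subst char_eval_prod) (auto intro!: prod.cong char_eval_ftw)
  also have "\<dots> = sg (\<Sum>(i, j)\<in>?P. \<alpha> i * \<beta> j)" by (simp add: sg_sum split_def)
  also have "(\<Sum>(i, j)\<in>?P. \<alpha> i * \<beta> j) = (\<Sum>(i, j)\<in>{..<n} \<times> {..<n}. of_bool (j < i) * \<alpha> i * \<beta> j)"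
    by (rule sum.mono_neutral_cong_left) (use P in \<open>auto simp: of_bool_def\<close>)
  also have "\<dots> = order_form n \<alpha> \<beta>" by (simp add: order_form_def bilin_def sum.cartesian_product)
  finally show ?thesis .
qed

text \<open>
  With \<open>a = \<gamma>\<^sub>i \<otimes> 1\<close> and \<open>b = 1 \<otimes> \<gamma>\<^sub>j\<close>, expanding the square of \<open>1 + a + b - ab\<close> and using \<open>a\<^sup>2
  = b\<^sup>2 = 1\<close> leaves \<open>4\<close>. So the cocycle is its own inverse.
\<close>

lemma ftw_square: "ftw i j * ftw i j = 1"
proof -
  define a b where "a = tens (tgam i) 0" and "b = tens 0 (tgam j)"
  have ab: "tens (tgam i) (tgam j) = a * b" and one: "tens 0 0 = 1" and sq: "a * a = 1" "b * b = 1"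
    by (simp_all add: a_def b_def tens_def mult_single tgam_def flip: single_add zero_prod_def)
  have "(1 + a + b - a * b) * (1 + a + b - a * b) =
      1 + a * a + b * b + (a * a) * (b * b) + 2 * (a - (a * a) * b + b - a * (b * b))"
    by (simp add: algebra_simps)
  also have "\<dots> = scal 4"
    unfolding sq by (simp add: scal_def mult_single flip: single_numeral)
  finally have X: "(1 + a + b - a * b) * (1 + a + b - a * b) = scal 4" .
  have "ftw i j = scal (1/2) * (1 + a + b - a * b)"
    by (simp only: ftw_def a_def[symmetric] b_def[symmetric] ab one)
  then have "ftw i j * ftw i j = scal (1/2) * scal (1/2) * ((1 + a + b - a * b) * (1 + a + b - a * b))"
    by (simp only: mult_ac)
  also have "\<dots> = 1" unfolding X by (simp flip: scal_simps(1)) (simp add: scal_simps)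
  finally show ?thesis .
qed

lemma inv_alg2_Ftw: "inv_alg2 (Ftw n) = Ftw n"
proof -
  have "Ftw n * Ftw n = 1"
    by (simp add: Ftw_def flip: prod.distrib) (simp add: split_def ftw_square)
  moreover have "K = Ftw n" if "Ftw n * K = 1" for K
  proof -
    have "K = Ftw n * Ftw n * K" by (simp only: \<open>Ftw n * Ftw n = 1\<close> mult_1)
    also have "\<dots> = Ftw n" by (simp only: mult.assoc that mult_1_right)
    finally show ?thesis .
  qed
  ultimately show ?thesis
    unfolding inv_alg2_def by (intro the_equality)
qed

definition star :: "nat \<Rightarrow> gen ncpoly \<Rightarrow> gen ncpoly \<Rightarrow> gen ncpoly" where
  "star n f g = (\<Sum>u\<in>Poly_Mapping.keys (Ftw n).
     (Poly_Mapping.lookup (Ftw n) u) *\<^sub>s (tact n (fst u) f * tact n (snd u) g))"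

lemma star_simps:
  "star n (f + f') g = star n f g + star n f' g"
  "star n f (g + g') = star n f g + star n f g'"
  "star n (c *\<^sub>s f) g = c *\<^sub>s star n f g"
  "star n f (c *\<^sub>s g) = c *\<^sub>s star n f g"
  by (simp_all add: star_def tact_simps distrib_left distrib_right smul_distrib sum.distrib smul_sum
      mult.commute[of c])

lemma star_weight:
  assumes "\<alpha> \<in> vecs n" "weight n \<alpha> f" "\<beta> \<in> vecs n" "weight n \<beta> g"
  shows "star n f g = (sg (order_form n \<alpha> \<beta>)) *\<^sub>s (f * g)"
proof -
  have "star n f g = (char_eval n \<alpha> \<beta> (Ftw n)) *\<^sub>s (f * g)"
    unfolding star_def char_eval_def tact_weight[OF assms(1,2)] tact_weight[OF assms(3,4)]
    by (simp add: smul_sum mult_ac)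
  then show ?thesis by (simp add: char_eval_Ftw)
qed

lemma sign_act_star: "sign_act n k (star n f g) = star n (sign_act n k f) (sign_act n k g)"
  by (simp add: star_def sign_act_simps tact_simps)

lemma order_form_add:
  "order_form n (\<lambda>k. \<alpha> k + \<alpha>' k) \<beta> = order_form n \<alpha> \<beta> + order_form n \<alpha>' \<beta>"
  "order_form n \<alpha> (\<lambda>k. \<beta> k + \<beta>' k) = order_form n \<alpha> \<beta> + order_form n \<alpha> \<beta>'"
  by (simp_all add: order_form_def bilin_add_left bilin_add_right)

lemma order_form_zero: "order_form n (\<lambda>k. 0) \<beta> = 0" "order_form n \<alpha> (\<lambda>k. 0) = 0"
  by (simp_all add: order_form_def bilin_def)

text \<open>
  On weight vectors this is bilinearity of \<open>B\<close>.
\<close>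

lemma star_assoc: "star n (star n f g) h = star n f (star n g h)"
proof (induction f rule: weight_induct[where n = n])
  case (weight \<alpha> f)
  note f = this
  show ?case
  proof (induction g rule: weight_induct[where n = n])
    case (weight \<beta> g)
    note g = this
    show ?case
    proof (induction h rule: weight_induct[where n = n])
      case (weight \<chi> h)
      show ?case
        unfolding star_weight[OF f g] star_weight[OF g weight] star_simps
          star_weight[OF vecs_add[OF f(1) g(1)] weight_mult[OF f(2) g(2)] weight]
          star_weight[OF f vecs_add[OF g(1) weight(1)] weight_mult[OF g(2) weight(2)]] order_form_add
        by (simp add: sg_add mult_ac)
    qed (simp add: star_simps)
  qed (simp add: star_simps)
qed (simp add: star_simps)

lemma star_one: "star n 1 f = f" "star n f 1 = f"
proof -
  show "star n 1 f = f"
  proof (induction f rule: weight_induct[where n = n])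
    case (weight \<alpha> f)
    then show ?case by (simp add: star_weight[OF vecs_zero weight_one weight] order_form_zero)
  qed (simp add: star_simps)
  show "star n f 1 = f"
  proof (induction f rule: weight_induct[where n = n])
    case (weight \<alpha> f)
    then show ?case by (simp add: star_weight[OF weight vecs_zero weight_one] order_form_zero)
  qed (simp add: star_simps)
qed

section \<open>Fourier expansion over the group of sign matrices\<close>

definition dot :: "nat \<Rightarrow> (nat \<Rightarrow> bit) \<Rightarrow> (nat \<Rightarrow> bit) \<Rightarrow> bit" where
  "dot n \<epsilon> \<delta> = (\<Sum>k<n. \<epsilon> k * \<delta> k)"

lemma dot_add: "dot n (\<lambda>k. \<epsilon> k + \<epsilon>' k) \<delta> = dot n \<epsilon> \<delta> + dot n \<epsilon>' \<delta>"
  "dot n \<epsilon> (\<lambda>k. \<delta> k + \<delta>' k) = dot n \<epsilon> \<delta> + dot n \<epsilon> \<delta>'"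
  by (simp_all add: dot_def distrib_left distrib_right sum.distrib)

lemma dot_unit: "k < n \<Longrightarrow> dot n (unit k) \<delta> = \<delta> k" "k < n \<Longrightarrow> dot n \<epsilon> (unit k) = \<epsilon> k"
  using sum_mult_unit[of k n] by (simp_all add: dot_def mult.commute[of "unit k _"])

lemma dot_perm:
  assumes "\<pi> permutes {..<n}"
  shows "dot n (\<lambda>k. \<epsilon> (\<pi> k)) \<delta> = dot n \<epsilon> (\<lambda>k. \<delta> (pinv \<pi> k))"
  using sum.permute[OF assms, of "\<lambda>k. \<epsilon> k * \<delta> (pinv \<pi> k)"]
  by (simp add: dot_def o_def permutes_inverses[OF assms])

lemma finite_vecs: "finite (vecs n)"
proof -
  have "(UNIV :: bit set) = {0, 1}" using bit_not_zero_iff by auto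
  then have "finite (UNIV :: bit set)" by (metis finite.emptyI finite.insertI)
  from finite_set_of_finite_funs[OF finite_lessThan this, of n 0]
  show ?thesis by (rule rev_finite_subset) (auto simp: vecs_def)
qed

lemma card_vecs: "card (vecs n) \<noteq> 0"
  using finite_vecs vecs_zero by (metis card_eq_0_iff empty_iff)

lemma vecs_perm: "\<delta> \<in> vecs n \<Longrightarrow> \<pi> permutes {..<n} \<Longrightarrow> (\<lambda>k. \<delta> (\<pi> k)) \<in> vecs n"
  by (auto simp: vecs_def permutes_not_in)

text \<open>
  Orthogonality of characters: if \<open>\<delta>\<^sub>k = 1\<close>, the shift by the \<open>k\<close>-th unit vector permutes the
  summands and changes their sign.
\<close>

lemma sum_sg_dot:
  assumes \<delta>: "\<delta> \<in> vecs n"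
  shows "(\<Sum>\<epsilon>\<in>vecs n. sg (dot n \<epsilon> \<delta>)) = (if \<delta> = (\<lambda>k. 0) then of_nat (card (vecs n)) else 0)"
proof (cases "\<delta> = (\<lambda>k. 0)")
  case False
  then obtain k where "\<delta> k \<noteq> 0" by (auto simp: fun_eq_iff)
  with \<delta> have k: "k < n" "\<delta> k = 1" by (auto simp: vecs_def not_le[symmetric])
  have "(\<Sum>\<epsilon>\<in>vecs n. sg (dot n \<epsilon> \<delta>)) = (\<Sum>\<epsilon>\<in>vecs n. sg (dot n (\<lambda>j. \<epsilon> j + unit k j) \<delta>))"
    by (rule sum.reindex_bij_witness[of _ "\<lambda>\<epsilon> j. \<epsilon> j + unit k j" "\<lambda>\<epsilon> j. \<epsilon> j + unit k j"])
       (auto simp: add.assoc vecs_add vecs_unit[OF k(1)])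
  also have "\<dots> = - (\<Sum>\<epsilon>\<in>vecs n. sg (dot n \<epsilon> \<delta>))"
    by (simp add: dot_add dot_unit k sg_add sum_negf)
  finally show ?thesis using False by simp
qed (simp add: dot_def)

definition fourier :: "nat \<Rightarrow> ((nat \<Rightarrow> bit) \<Rightarrow> complex) \<Rightarrow> (nat \<Rightarrow> bit) \<Rightarrow> complex" where
  "fourier n f \<epsilon> = (\<Sum>\<delta>\<in>vecs n. sg (dot n \<epsilon> \<delta>) * f \<delta>) / of_nat (card (vecs n))"

lemma vec_diff_zero: "(\<lambda>k. \<delta> k + \<delta>' k) = (\<lambda>k. 0) \<longleftrightarrow> \<delta> = (\<delta>' :: nat \<Rightarrow> bit)"
  by (simp add: fun_eq_iff bit_add_eq_0_iff)

lemma fourier_inversion: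
  assumes \<delta>: "\<delta> \<in> vecs n"
  shows "(\<Sum>\<epsilon>\<in>vecs n. fourier n f \<epsilon> * sg (dot n \<epsilon> \<delta>)) = f \<delta>"
proof -
  let ?c = "of_nat (card (vecs n)) :: complex"
  have "(\<Sum>\<epsilon>\<in>vecs n. fourier n f \<epsilon> * sg (dot n \<epsilon> \<delta>))
      = (\<Sum>\<epsilon>\<in>vecs n. \<Sum>\<delta>'\<in>vecs n. f \<delta>' / ?c * sg (dot n \<epsilon> (\<lambda>k. \<delta>' k + \<delta> k)))"
    unfolding fourier_def sum_divide_distrib sum_distrib_right by (simp add: dot_add sg_add mult_ac)
  also have "\<dots> = (\<Sum>\<delta>'\<in>vecs n. f \<delta>' / ?c * (\<Sum>\<epsilon>\<in>vecs n. sg (dot n \<epsilon> (\<lambda>k. \<delta>' k + \<delta> k))))"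
    by (subst sum.swap) (simp add: sum_distrib_left)
  also have "\<dots> = (\<Sum>\<delta>'\<in>vecs n. if \<delta>' = \<delta> then f \<delta> else 0)"
    by (rule sum.cong[OF refl]) (simp add: sum_sg_dot vecs_add \<delta> vec_diff_zero card_vecs)
  finally show ?thesis using \<delta> finite_vecs by simp
qed

text \<open>
  The element \<open>M Q\<close> where \<open>Q\<close> in the group algebra of the sign matrices takes the value \<open>f \<delta>\<close> on
  the character \<open>\<delta>\<close>. Working with \<open>f\<close> turns products into pointwise products.
\<close>

definition smear :: "nat \<Rightarrow> complex mat \<Rightarrow> ((nat \<Rightarrow> bit) \<Rightarrow> complex) \<Rightarrow> gen ncpoly" where
  "smear n M f = (\<Sum>\<epsilon>\<in>vecs n. fourier n f \<epsilon> *\<^sub>s gg (M * sign_mat n \<epsilon>))"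

lemma smear_cong: "(\<And>\<delta>. \<delta> \<in> vecs n \<Longrightarrow> f \<delta> = g \<delta>) \<Longrightarrow> smear n M f = smear n M g"
  unfolding smear_def fourier_def by simp

lemma smear_sum: "smear n M (\<lambda>\<delta>. \<Sum>i\<in>A. c i * f i \<delta>) = (\<Sum>i\<in>A. c i *\<^sub>s smear n M (f i))"
proof -
  have "fourier n (\<lambda>\<delta>. \<Sum>i\<in>A. c i * f i \<delta>) \<epsilon> = (\<Sum>i\<in>A. c i * fourier n (f i) \<epsilon>)" for \<epsilon>
  proof -
    have "(\<Sum>\<delta>\<in>vecs n. sg (dot n \<epsilon> \<delta>) * (\<Sum>i\<in>A. c i * f i \<delta>))
        = (\<Sum>i\<in>A. c i * (\<Sum>\<delta>\<in>vecs n. sg (dot n \<epsilon> \<delta>) * f i \<delta>))"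
      unfolding sum_distrib_left by (subst sum.swap) (simp add: mult_ac)
    then show ?thesis
      unfolding fourier_def by (simp only: sum_divide_distrib[of _ A] times_divide_eq_right)
  qed
  then show ?thesis
    unfolding smear_def by (simp add: smul_sum) (rule sum.swap)
qed

lemma smear_character:
  assumes "\<epsilon> \<in> vecs n"
  shows "smear n M (\<lambda>\<delta>. sg (dot n \<epsilon> \<delta>)) = gg (M * sign_mat n \<epsilon>)"
proof -
  have "fourier n (\<lambda>\<delta>. sg (dot n \<epsilon> \<delta>)) \<epsilon>' = (if \<epsilon>' = \<epsilon> then 1 else 0)" if "\<epsilon>' \<in> vecs n" for \<epsilon>'
  proof -
    have "sg (dot n \<epsilon>' \<delta>) * sg (dot n \<epsilon> \<delta>) = sg (dot n \<delta> (\<lambda>k. \<epsilon>' k + \<epsilon> k))" for \<delta>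
      by (simp add: dot_def distrib_left sum.distrib sg_add mult_ac)
    then show ?thesis
      unfolding fourier_def by (simp add: sum_sg_dot vecs_add that assms vec_diff_zero card_vecs)
  qed
  then have "smear n M (\<lambda>\<delta>. sg (dot n \<epsilon> \<delta>)) = (\<Sum>\<epsilon>'\<in>vecs n. if \<epsilon>' = \<epsilon> then gg (M * sign_mat n \<epsilon>) else 0)"
    unfolding smear_def by (intro sum.cong) auto
  then show ?thesis using assms finite_vecs by simp
qed

lemma sum_gg_smear:
  assumes "\<And>i. i \<in> A \<Longrightarrow> e i \<in> vecs n"
  shows "(\<Sum>i\<in>A. c i *\<^sub>s gg (M * sign_mat n (e i))) = smear n M (\<lambda>\<delta>. \<Sum>i\<in>A. c i * sg (dot n (e i) \<delta>))"
  unfolding smear_sum by (rule sum.cong[OF refl]) (simp add: smear_character assms)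

lemma mult_sign_mat:
  assumes "monomial n M"
  shows "M * sign_mat n \<epsilon> * sign_mat n \<epsilon>' = M * sign_mat n (\<lambda>k. \<epsilon> k + \<epsilon>' k)"
    "sign_mat n \<epsilon> * M = M * sign_mat n (\<lambda>k. \<epsilon> (perm_of n M k))"
    "monomial n (M * sign_mat n \<epsilon>)" "perm_of n (M * sign_mat n \<epsilon>) = perm_of n M"
    "perm_of n M permutes {..<n}" "M \<in> carrier_mat n n"
proof -
  obtain \<pi> a where M: "M = monomat n \<pi> a" "\<pi> permutes {..<n}" "\<And>k. k < n \<Longrightarrow> a k \<noteq> 0"
    using monomialE[OF assms] by metis
  have p: "perm_of n M = \<pi>" unfolding M(1) using M(2,3) by (rule perm_of_monomat)
  show "M * sign_mat n \<epsilon> * sign_mat n \<epsilon>' = M * sign_mat n (\<lambda>k. \<epsilon> k + \<epsilon>' k)"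
    unfolding M(1) monomat_sign_mat by (simp add: sg_add mult.assoc)
  show "sign_mat n \<epsilon> * M = M * sign_mat n (\<lambda>k. \<epsilon> (perm_of n M k))"
    unfolding p unfolding M(1) monomat_sign_mat sign_mat_monomat[OF M(2)] ..
  show "monomial n (M * sign_mat n \<epsilon>)"
    unfolding M(1) monomat_sign_mat using M(2,3) by (intro monomial_monomat) auto
  show "perm_of n (M * sign_mat n \<epsilon>) = perm_of n M"
    unfolding p unfolding M(1) monomat_sign_mat using M(2,3) by (intro perm_of_monomat) auto
  show "perm_of n M permutes {..<n}" "M \<in> carrier_mat n n"
    unfolding p using M by auto
qed

lemma sign_mat_carrier: "sign_mat n \<epsilon> \<in> carrier_mat n n"
  by (simp add: sign_mat_def)

lemma smear_shift:
  assumes M: "monomial n M" and \<epsilon>: "\<epsilon> \<in> vecs n"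
  shows "smear n (M * sign_mat n \<epsilon>) f = smear n M (\<lambda>\<delta>. sg (dot n \<epsilon> \<delta>) * f \<delta>)"
proof -
  have "smear n (M * sign_mat n \<epsilon>) f
      = smear n M (\<lambda>\<delta>. \<Sum>\<epsilon>'\<in>vecs n. fourier n f \<epsilon>' * sg (dot n (\<lambda>k. \<epsilon> k + \<epsilon>' k) \<delta>))"
    unfolding smear_def[of n "M * sign_mat n \<epsilon>"] mult_sign_mat(1)[OF M]
    by (rule sum_gg_smear) (simp add: vecs_add \<epsilon>)
  also have "\<dots> = smear n M (\<lambda>\<delta>. sg (dot n \<epsilon> \<delta>) * f \<delta>)"
  proof (rule smear_cong)
    fix \<delta> assume "\<delta> \<in> vecs n"
    have "(\<Sum>\<epsilon>'\<in>vecs n. fourier n f \<epsilon>' * sg (dot n (\<lambda>k. \<epsilon> k + \<epsilon>' k) \<delta>))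
        = sg (dot n \<epsilon> \<delta>) * (\<Sum>\<epsilon>'\<in>vecs n. fourier n f \<epsilon>' * sg (dot n \<epsilon>' \<delta>))"
      by (simp add: dot_add sg_add sum_distrib_left mult_ac)
    then show "(\<Sum>\<epsilon>'\<in>vecs n. fourier n f \<epsilon>' * sg (dot n (\<lambda>k. \<epsilon> k + \<epsilon>' k) \<delta>)) = sg (dot n \<epsilon> \<delta>) * f \<delta>"
      unfolding fourier_inversion[OF \<open>\<delta> \<in> vecs n\<close>] .
  qed
  finally show ?thesis .
qed

text \<open>
  The weight \<open>\<pi>\<delta> + \<delta>\<close> of the component of a group element with permutation \<open>\<pi>\<close> at the character
  \<open>\<delta>\<close>.
\<close>

definition defect :: "(nat \<Rightarrow> nat) \<Rightarrow> (nat \<Rightarrow> bit) \<Rightarrow> nat \<Rightarrow> bit" where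
  "defect \<pi> \<delta> k = \<delta> (pinv \<pi> k) + \<delta> k"

lemma defect_vecs: "\<pi> permutes {..<n} \<Longrightarrow> \<delta> \<in> vecs n \<Longrightarrow> defect \<pi> \<delta> \<in> vecs n"
  unfolding defect_def[abs_def] by (rule vecs_add[OF vecs_perm[OF _ permutes_inv]])

text \<open>
  Conjugating \<open>M\<close> by a sign matrix multiplies it from the right by another sign matrix, which
  the character \<open>\<delta>\<close> evaluates at the defect.
\<close>

lemma sign_act_smear:
  assumes M: "monomial n M"
  shows "sign_act n k (smear n M f) = smear n M (\<lambda>\<delta>. sg (defect (perm_of n M) \<delta> k) * f \<delta>)"
proof (cases "k < n")
  case True
  let ?\<pi> = "perm_of n M"
  let ?\<eta> = "\<lambda>j. unit k (?\<pi> j) + unit k j"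
  have \<pi>: "?\<pi> permutes {..<n}" by (rule mult_sign_mat(5)[OF M])
  have \<eta>: "?\<eta> \<in> vecs n"
    by (rule vecs_add[OF vecs_perm[OF vecs_unit[OF True] \<pi>] vecs_unit[OF True]])
  have "sign_conj n k (M * sign_mat n \<epsilon>) = M * sign_mat n (\<lambda>j. ?\<eta> j + \<epsilon> j)" for \<epsilon>
  proof -
    have "sign_conj n k (M * sign_mat n \<epsilon>) = M * sign_mat n \<epsilon> * sign_mat n (\<lambda>j. unit k (?\<pi> j)) *
        sign_mat n (unit k)"
      using mult_sign_mat(2)[OF mult_sign_mat(3)[OF M]]
      by (simp add: sign_conj_def mult_sign_mat(3,4)[OF M])
    then show ?thesis
      by (simp add: mult_sign_mat(1)[OF M] mult_sign_mat(1)[OF mult_sign_mat(3)[OF M]] add_ac)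
  qed
  then have "sign_act n k (smear n M f) = (\<Sum>\<epsilon>\<in>vecs n. fourier n f \<epsilon> *\<^sub>s gg (M * sign_mat n (\<lambda>j. ?\<eta> j
      + \<epsilon> j)))"
    by (simp add: smear_def sign_act_simps sign_act_letter)
  also have "\<dots> = smear n (M * sign_mat n ?\<eta>) f"
    by (simp add: smear_def mult_sign_mat(1)[OF M])
  also have "\<dots> = smear n M (\<lambda>\<delta>. sg (dot n ?\<eta> \<delta>) * f \<delta>)" by (rule smear_shift[OF M \<eta>])
  also have "\<dots> = smear n M (\<lambda>\<delta>. sg (defect ?\<pi> \<delta> k) * f \<delta>)"
    using True by (intro smear_cong) (simp add: dot_add dot_perm[OF \<pi>] dot_unit defect_def)
  finally show ?thesis .
next
  case False
  then have "perm_of n M k = k" "pinv (perm_of n M) k = k"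
    using permutes_not_in[OF mult_sign_mat(5)[OF M], of k] permutes_not_in[OF permutes_inv[OF
        mult_sign_mat(5)[OF M]], of k] by auto
  with False show ?thesis
    by (auto simp: sign_act_ge defect_def vecs_def intro!: smear_cong)
qed

lemma weight_smear:
  assumes M: "monomial n M" and f: "\<And>\<delta>. \<delta> \<in> vecs n \<Longrightarrow> f \<delta> \<noteq> 0 \<Longrightarrow> defect (perm_of n M) \<delta> = \<alpha>"
  shows "weight n \<alpha> (smear n M f)"
  unfolding weight_def sign_act_smear[OF M]
proof
  fix k
  have "smear n M (\<lambda>\<delta>. sg (defect (perm_of n M) \<delta> k) * f \<delta>) = smear n M (\<lambda>\<delta>. \<Sum>i\<in>{()}. sg (\<alpha> k) * f \<delta>)"
    by (rule smear_cong) (use f in fastforce)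
  then show "smear n M (\<lambda>\<delta>. sg (defect (perm_of n M) \<delta> k) * f \<delta>) = sg (\<alpha> k) *\<^sub>s smear n M f"
    unfolding smear_sum by simp
qed

text \<open>
  Sorting the characters by defect decomposes a smeared matrix into weight vectors.
\<close>

lemma smear_decompose:
  assumes M: "monomial n M"
  shows "smear n M f = (\<Sum>\<alpha>\<in>vecs n. smear n M (\<lambda>\<delta>. if defect (perm_of n M) \<delta> = \<alpha> then f \<delta> else 0))"
proof -
  have "smear n M f = smear n M (\<lambda>\<delta>. \<Sum>\<alpha>\<in>vecs n. 1 * (if defect (perm_of n M) \<delta> = \<alpha> then f \<delta> else 0))"
    by (rule smear_cong) (simp add: finite_vecs defect_vecs[OF mult_sign_mat(5)[OF M]])
  then show ?thesis unfolding smear_sum by simp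
qed

lemma star_sum:
  "star n (\<Sum>i\<in>A. f i) g = (\<Sum>i\<in>A. star n (f i) g)" "star n g (\<Sum>i\<in>A. f i) = (\<Sum>i\<in>A. star n g (f i))"
proof -
  have z: "star n 0 g = 0" "star n g 0 = 0" using star_simps(3)[of n 0 0 g] star_simps(4)[of n g 0
      0] by simp_all
  show "star n (\<Sum>i\<in>A. f i) g = (\<Sum>i\<in>A. star n (f i) g)" "star n g (\<Sum>i\<in>A. f i) = (\<Sum>i\<in>A. star n g (f i))"
    by (induction A rule: infinite_finite_induct) (simp_all add: star_simps z)
qed

lemma star_smear_weight:
  assumes M: "monomial n M" and \<beta>: "\<beta> \<in> vecs n" and g: "weight n \<beta> g"
  shows "star n (smear n M f) g = smear n M (\<lambda>\<delta>. sg (order_form n (defect (perm_of n M) \<delta>) \<beta>) * f \<delta>)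
      * g"
    "star n g (smear n M f) = g * smear n M (\<lambda>\<delta>. sg (order_form n \<beta> (defect (perm_of n M) \<delta>)) * f \<delta>)"
proof -
  let ?f = "\<lambda>\<alpha> \<delta>. if defect (perm_of n M) \<delta> = \<alpha> then f \<delta> else 0"
  have w: "weight n \<alpha> (smear n M (?f \<alpha>))" for \<alpha>
    by (rule weight_smear[OF M]) (simp split: if_splits)
  have re: "(\<Sum>\<alpha>\<in>vecs n. c \<alpha> *\<^sub>s smear n M (?f \<alpha>)) = smear n M (\<lambda>\<delta>. c (defect (perm_of n M) \<delta>) * f
      \<delta>)" for c
    unfolding smear_sum[symmetric]
    by (rule smear_cong) (simp add: if_distrib finite_vecs defect_vecs[OF mult_sign_mat(5)[OF M]]
        cong: if_cong)
  have "star n (smear n M f) g = (\<Sum>\<alpha>\<in>vecs n. sg (order_form n \<alpha> \<beta>) *\<^sub>s smear n M (?f \<alpha>)) * g"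
    unfolding smear_decompose[OF M, of f] star_sum sum_distrib_right
    by (rule sum.cong) (simp_all add: star_weight[OF _ w \<beta> g])
  then show "star n (smear n M f) g = smear n M (\<lambda>\<delta>. sg (order_form n (defect (perm_of n M) \<delta>) \<beta>) *
      f \<delta>) * g"
    unfolding re .
  have "star n g (smear n M f) = g * (\<Sum>\<alpha>\<in>vecs n. sg (order_form n \<beta> \<alpha>) *\<^sub>s smear n M (?f \<alpha>))"
    unfolding smear_decompose[OF M, of f] star_sum sum_distrib_left
    by (rule sum.cong) (simp_all add: star_weight[OF \<beta> g _ w])
  then show "star n g (smear n M f) = g * smear n M (\<lambda>\<delta>. sg (order_form n \<beta> (defect (perm_of n M)
      \<delta>)) * f \<delta>)"
    unfolding re .
qed

definition complement :: "nat \<Rightarrow> (nat \<Rightarrow> bit) \<Rightarrow> nat \<Rightarrow> bit" where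
  "complement n \<delta> k = (if k < n then \<delta> k + 1 else 0)"

text \<open>
  The functions \<open>f\<close> whose Fourier transform is supported on sign matrices of determinant \<open>s\<close>
  (\<open>fourier_parity\<close>).
\<close>

definition parity :: "nat \<Rightarrow> complex \<Rightarrow> ((nat \<Rightarrow> bit) \<Rightarrow> complex) \<Rightarrow> bool" where
  "parity n s f \<longleftrightarrow> (\<forall>\<delta>\<in>vecs n. f (complement n \<delta>) = s * f \<delta>)"

lemma complement_vecs: "complement n \<delta> \<in> vecs n"
  by (simp add: vecs_def complement_def)

lemma complement_complement: "\<delta> \<in> vecs n \<Longrightarrow> complement n (complement n \<delta>) = \<delta>"
  by (auto simp: complement_def vecs_def fun_eq_iff add.assoc)

lemma fourier_parity:
  assumes "parity n s f" "fourier n f \<epsilon> \<noteq> 0"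
  shows "sg (\<Sum>k<n. \<epsilon> k) = s"
proof -
  let ?S = "\<Sum>\<delta>\<in>vecs n. sg (dot n \<epsilon> \<delta>) * f \<delta>"
  have dot: "dot n \<epsilon> (complement n \<delta>) = dot n \<epsilon> \<delta> + (\<Sum>k<n. \<epsilon> k)" for \<delta>
    by (simp add: dot_def complement_def distrib_left sum.distrib)
  have "?S = (\<Sum>\<delta>\<in>vecs n. sg (dot n \<epsilon> (complement n \<delta>)) * f (complement n \<delta>))"
    by (rule sum.reindex_bij_witness[of _ "complement n" "complement n"]) (auto simp:
        complement_complement complement_vecs)
  also have "\<dots> = sg (\<Sum>k<n. \<epsilon> k) * s * ?S"
    using assms(1) by (simp add: parity_def dot sg_add sum_distrib_left mult_ac)
  finally have "sg (\<Sum>k<n. \<epsilon> k) * s = 1" using assms(2) by (simp add: fourier_def)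
  then have "sg (\<Sum>k<n. \<epsilon> k) * (sg (\<Sum>k<n. \<epsilon> k) * s) = sg (\<Sum>k<n. \<epsilon> k)" by simp
  then show ?thesis by (simp only: mult.assoc[symmetric] sg_simps mult_1)
qed

lemma defect_complement:
  assumes "\<pi> permutes {..<n}" "\<delta> \<in> vecs n"
  shows "defect \<pi> (complement n \<delta>) = defect \<pi> \<delta>"
proof
  fix k
  have "pinv \<pi> k < n \<longleftrightarrow> k < n" using permutes_in_image[OF permutes_inv[OF assms(1)], of k] by simp
  then show "defect \<pi> (complement n \<delta>) k = defect \<pi> \<delta> k"
    using assms(2) by (auto simp: defect_def complement_def vecs_def add_ac)
qed

lemma parity_defect:
  "\<pi> permutes {..<n} \<Longrightarrow> parity n s f \<Longrightarrow> parity n s (\<lambda>\<delta>. c (defect \<pi> \<delta>) * f \<delta>)"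
  by (simp add: parity_def defect_complement mult_ac)


text \<open>
  Only those products of group letters may be rewritten whose factors lie in \<open>G\<close>; this is why
  the hypotheses bound the supports of the Fourier transforms. Moving the sign matrix of the
  first factor past \<open>N\<close> replaces \<open>\<delta>\<close> by its image under the permutation of \<open>N\<close>.
\<close>

lemma smear_mult:
  assumes M: "monomial n M" and N: "monomial n N"
    and G: "\<And>g h. g \<in> G \<Longrightarrow> h \<in> G \<Longrightarrow> gg g * gg h - gg (g * h) \<in> tideal R"
    and Mf: "\<And>\<epsilon>. fourier n f \<epsilon> \<noteq> 0 \<Longrightarrow> M * sign_mat n \<epsilon> \<in> G"
    and Ng: "\<And>\<epsilon>. fourier n g \<epsilon> \<noteq> 0 \<Longrightarrow> N * sign_mat n \<epsilon> \<in> G"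
  shows "smear n M f * smear n N g - smear n (M * N) (\<lambda>\<delta>. f (\<lambda>k. \<delta> (pinv (perm_of n N) k)) * g \<delta>)
      \<in> tideal R"
proof -
  let ?\<rho> = "perm_of n N"
  let ?V = "vecs n \<times> vecs n"
  have \<rho>: "?\<rho> permutes {..<n}" by (rule mult_sign_mat(5)[OF N])
  have MN: "M * sign_mat n \<epsilon> * (N * sign_mat n \<epsilon>') = M * N * sign_mat n (\<lambda>k. \<epsilon> (?\<rho> k) + \<epsilon>' k)" for \<epsilon> \<epsilon>'
  proof -
    note c = mult_sign_mat(6)[OF M] mult_sign_mat(6)[OF N] sign_mat_carrier
    have "M * sign_mat n \<epsilon> * (N * sign_mat n \<epsilon>') = M * ((sign_mat n \<epsilon> * N) * sign_mat n \<epsilon>')"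
      using c by (simp add: assoc_mult_mat[of _ n n _ n _ n])
    also have "\<dots> = M * (N * sign_mat n (\<lambda>k. \<epsilon> (?\<rho> k) + \<epsilon>' k))"
      unfolding mult_sign_mat(2)[OF N] mult_sign_mat(1)[OF N] ..
    also have "\<dots> = M * N * sign_mat n (\<lambda>k. \<epsilon> (?\<rho> k) + \<epsilon>' k)"
      using c by (simp add: assoc_mult_mat[of _ n n _ n _ n])
    finally show ?thesis .
  qed
  have 1: "smear n M f * smear n N g = (\<Sum>(\<epsilon>, \<epsilon>')\<in>?V. (fourier n f \<epsilon> * fourier n g \<epsilon>') *\<^sub>s (gg (M *
      sign_mat n \<epsilon>) * gg (N * sign_mat n \<epsilon>')))"
    by (simp add: smear_def sum_product sum.cartesian_product mult.commute)
  have "(\<Sum>e\<in>?V. (fourier n f (fst e) * fourier n g (snd e)) *\<^sub>s gg (M * N * sign_mat n (\<lambda>k. fst e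
      (?\<rho> k) + snd e k)))
      = smear n (M * N) (\<lambda>\<delta>. \<Sum>e\<in>?V. fourier n f (fst e) * fourier n g (snd e) * sg (dot n (\<lambda>k. fst e
          (?\<rho> k) + snd e k) \<delta>))"
    by (rule sum_gg_smear) (auto intro!: vecs_add vecs_perm[OF _ \<rho>])
  also have "\<dots> = smear n (M * N) (\<lambda>\<delta>. f (\<lambda>k. \<delta> (pinv ?\<rho> k)) * g \<delta>)"
  proof (rule smear_cong)
    fix \<delta> assume \<delta>: "\<delta> \<in> vecs n"
    have \<delta>': "(\<lambda>k. \<delta> (pinv ?\<rho> k)) \<in> vecs n" by (rule vecs_perm[OF \<delta> permutes_inv[OF \<rho>]])
    have "(\<Sum>e\<in>?V. fourier n f (fst e) * fourier n g (snd e) * sg (dot n (\<lambda>k. fst e (?\<rho> k) + snd e k) \<delta>))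
        = (\<Sum>\<epsilon>\<in>vecs n. fourier n f \<epsilon> * sg (dot n \<epsilon> (\<lambda>k. \<delta> (pinv ?\<rho> k)))) * (\<Sum>\<epsilon>'\<in>vecs n. fourier n g
            \<epsilon>' * sg (dot n \<epsilon>' \<delta>))"
      unfolding sum_product sum.cartesian_product
      by (rule sum.cong[OF refl]) (auto simp: dot_add dot_perm[OF \<rho>] sg_add mult_ac)
    then show "(\<Sum>e\<in>?V. fourier n f (fst e) * fourier n g (snd e) * sg (dot n (\<lambda>k. fst e (?\<rho> k)
        + snd e k) \<delta>))
        = f (\<lambda>k. \<delta> (pinv ?\<rho> k)) * g \<delta>"
      unfolding fourier_inversion[OF \<delta>] fourier_inversion[OF \<delta>'] .
  qed
  finally have 2: "smear n (M * N) (\<lambda>\<delta>. f (\<lambda>k. \<delta> (pinv ?\<rho> k)) * g \<delta>) =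
      (\<Sum>(\<epsilon>, \<epsilon>')\<in>?V. (fourier n f \<epsilon> * fourier n g \<epsilon>') *\<^sub>s gg (M * N * sign_mat n (\<lambda>k. \<epsilon> (?\<rho> k) + \<epsilon>' k)))"
    by (simp add: split_def)
  have "(fourier n f \<epsilon> * fourier n g \<epsilon>') *\<^sub>s (gg (M * sign_mat n \<epsilon>) * gg (N * sign_mat n \<epsilon>')
      - gg (M * N * sign_mat n (\<lambda>k. \<epsilon> (?\<rho> k) + \<epsilon>' k))) \<in> tideal R" for \<epsilon> \<epsilon>'
  proof (cases "fourier n f \<epsilon> = 0 \<or> fourier n g \<epsilon>' = 0")
    case False
    then show ?thesis unfolding MN[symmetric] using G Mf Ng by (intro tideal_smul) auto
  qed (auto intro: tideal.zero)
  then show ?thesis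
    unfolding 1 2 sum_subtractf[symmetric] by (intro tideal_sum) (auto simp: smul_distrib)
qed

text \<open>
  After decomposing the second factor into weight vectors, the twist only multiplies \<open>f\<close> by
  signs that depend on the defect, and such signs do not affect the parity of \<open>f\<close>.
\<close>

lemma star_smear:
  assumes M: "monomial n M" and N: "monomial n N"
    and G: "\<And>g h. g \<in> G \<Longrightarrow> h \<in> G \<Longrightarrow> gg g * gg h - gg (g * h) \<in> tideal R"
    and f: "parity n s f" and g: "parity n t g"
    and Mf: "\<And>\<epsilon>. sg (\<Sum>k<n. \<epsilon> k) = s \<Longrightarrow> M * sign_mat n \<epsilon> \<in> G"
    and Ng: "\<And>\<epsilon>. sg (\<Sum>k<n. \<epsilon> k) = t \<Longrightarrow> N * sign_mat n \<epsilon> \<in> G"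
  shows "star n (smear n M f) (smear n N g) -
    smear n (M * N) (\<lambda>\<delta>. sg (order_form n (defect (perm_of n M) (\<lambda>k. \<delta> (pinv (perm_of n N) k)))
        (defect (perm_of n N) \<delta>)) *
      (f (\<lambda>k. \<delta> (pinv (perm_of n N) k)) * g \<delta>)) \<in> tideal R"
proof -
  let ?\<pi> = "perm_of n M" and ?\<rho> = "perm_of n N"
  let ?f = "\<lambda>\<beta> \<delta>. sg (order_form n (defect ?\<pi> \<delta>) \<beta>) * f \<delta>"
  let ?g = "\<lambda>\<beta> \<delta>. if defect ?\<rho> \<delta> = \<beta> then g \<delta> else 0"
  let ?h = "\<lambda>\<beta> \<delta>. ?f \<beta> (\<lambda>k. \<delta> (pinv ?\<rho> k)) * ?g \<beta> \<delta>"
  have \<pi>: "?\<pi> permutes {..<n}" and \<rho>: "?\<rho> permutes {..<n}"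
    using mult_sign_mat(5) M N by auto
  have w: "weight n \<beta> (smear n N (?g \<beta>))" for \<beta>
    by (rule weight_smear[OF N]) (simp split: if_splits)
  have "star n (smear n M f) (smear n N g) = (\<Sum>\<beta>\<in>vecs n. smear n M (?f \<beta>) * smear n N (?g \<beta>))"
    unfolding smear_decompose[OF N, of g] star_sum
    by (rule sum.cong[OF refl]) (rule star_smear_weight(1)[OF M _ w])
  moreover have "smear n (M * N) (\<lambda>\<delta>. sg (order_form n (defect ?\<pi> (\<lambda>k. \<delta> (pinv ?\<rho> k))) (defect ?\<rho> \<delta>)) *
      (f (\<lambda>k. \<delta> (pinv ?\<rho> k)) * g \<delta>)) = smear n (M * N) (\<lambda>\<delta>. \<Sum>\<beta>\<in>vecs n. 1 * ?h \<beta> \<delta>)"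
    by (rule smear_cong) (simp add: if_distrib finite_vecs defect_vecs[OF \<rho>] mult.assoc cong: if_cong)
  moreover have "smear n M (?f \<beta>) * smear n N (?g \<beta>) - smear n (M * N) (?h \<beta>) \<in> tideal R"
      if "\<beta> \<in> vecs n" for \<beta>
  proof (rule smear_mult[OF M N G])
    have pf: "parity n s (?f \<beta>)" by (rule parity_defect[OF \<pi> f])
    show "M * sign_mat n \<epsilon> \<in> G" if "fourier n (?f \<beta>) \<epsilon> \<noteq> 0" for \<epsilon>
      by (rule Mf[OF fourier_parity[OF pf that]])
    have "parity n t (\<lambda>\<delta>. (if defect ?\<rho> \<delta> = \<beta> then 1 else 0) * g \<delta>)" by (rule parity_defect[OF \<rho> g])
    then have pg: "parity n t (?g \<beta>)" by (simp add: if_distrib[of "\<lambda>x. x * _"] cong: if_cong)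
    show "N * sign_mat n \<epsilon> \<in> G" if "fourier n (?g \<beta>) \<epsilon> \<noteq> 0" for \<epsilon>
      by (rule Ng[OF fourier_parity[OF pg that]])
  qed
  ultimately show ?thesis
    unfolding smear_sum by (simp only: sum_subtractf[symmetric] smul_simps tideal_sum)
qed

text \<open>
  Stated for a family \<open>Z\<close> with character \<open>\<chi>\<close> of the entries in order to cover both the \<open>x\<^sub>i\<close>,
  where \<open>\<chi>\<close> is the identity, and the \<open>y\<^sub>i\<close>, where it is the inverse. Moving \<open>Z\<^sub>i\<close> past a sign
  matrix \<open>\<epsilon>\<close> gives the factor \<open>(-1)\<^bsup>\<epsilon>\<^sub>i\<^esup>\<close>, that is, it shifts \<open>\<delta>\<close> by the \<open>i\<close>-th unit vector.
\<close>

lemma star_smear_letter: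
  assumes M: "M = monomat n \<pi> a" "\<pi> permutes {..<n}" "\<And>k. k < n \<Longrightarrow> a k \<noteq> 0" and i: "i < n"
    and Z: "\<And>j. j < n \<Longrightarrow> weight n (unit j) (Z j)"
    and G: "\<And>b. monomat n \<pi> b \<in> G \<Longrightarrow> gg (monomat n \<pi> b) * Z i
        - \<chi> (b i) *\<^sub>s (Z (\<pi> i) * gg (monomat n \<pi> b)) \<in> tideal R"
    and \<chi>: "\<And>x e. \<chi> (x * sg e) = \<chi> x * sg e"
    and f: "parity n s f" and Mf: "\<And>\<epsilon>. sg (\<Sum>k<n. \<epsilon> k) = s \<Longrightarrow> M * sign_mat n \<epsilon> \<in> G"
    and step: "\<And>\<delta>. \<delta> \<in> vecs n \<Longrightarrow> sg (order_form n (defect \<pi> (\<lambda>k. \<delta> k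
        + unit i k)) (unit i)) * f (\<lambda>k. \<delta> k + unit i k)
      = sg (order_form n (unit (\<pi> i)) (defect \<pi> \<delta>)) * f \<delta>"
  shows "star n (smear n M f) (Z i) - \<chi> (a i) *\<^sub>s star n (Z (\<pi> i)) (smear n M f) \<in> tideal R"
proof -
  have mon: "monomial n M" unfolding M(1) using M(2,3) by (rule monomial_monomat)
  have p: "perm_of n M = \<pi>" unfolding M(1) using M(2,3) by (rule perm_of_monomat)
  have \<pi>i: "\<pi> i < n" using permutes_in_image[OF M(2), of i] i by simp
  let ?F = "\<lambda>\<delta>. sg (order_form n (defect \<pi> \<delta>) (unit i)) * f \<delta>"
  have F: "parity n s ?F" by (rule parity_defect[OF M(2) f])
  have 1: "star n (smear n M f) (Z i) = smear n M ?F * Z i"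
    using star_smear_weight(1)[OF mon vecs_unit[OF i] Z[OF i]] unfolding p .
  have "star n (Z (\<pi> i)) (smear n M f) = Z (\<pi> i) * smear n M (\<lambda>\<delta>. sg (order_form n (unit (\<pi> i))
      (defect \<pi> \<delta>)) * f \<delta>)"
    using star_smear_weight(2)[OF mon vecs_unit[OF \<pi>i] Z[OF \<pi>i]] unfolding p .
  also have "smear n M (\<lambda>\<delta>. sg (order_form n (unit (\<pi> i)) (defect \<pi> \<delta>)) * f \<delta>)
      = smear n M (\<lambda>\<delta>. \<Sum>\<epsilon>\<in>vecs n. (fourier n ?F \<epsilon> * sg (\<epsilon> i)) * sg (dot n \<epsilon> \<delta>))"
  proof (rule smear_cong)
    fix \<delta> assume \<delta>: "\<delta> \<in> vecs n"
    have "sg (order_form n (unit (\<pi> i)) (defect \<pi> \<delta>)) * f \<delta> = ?F (\<lambda>k. \<delta> k + unit i k)"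
      using step[OF \<delta>] by simp
    also have "\<dots> = (\<Sum>\<epsilon>\<in>vecs n. fourier n ?F \<epsilon> * sg (dot n \<epsilon> (\<lambda>k. \<delta> k + unit i k)))"
      by (rule fourier_inversion[symmetric]) (intro vecs_add \<delta> vecs_unit i)
    finally show "sg (order_form n (unit (\<pi> i)) (defect \<pi> \<delta>)) * f \<delta>
        = (\<Sum>\<epsilon>\<in>vecs n. (fourier n ?F \<epsilon> * sg (\<epsilon> i)) * sg (dot n \<epsilon> \<delta>))"
      by (simp add: dot_add dot_unit i sg_add mult_ac)
  qed
  also have "\<dots> = (\<Sum>\<epsilon>\<in>vecs n. (fourier n ?F \<epsilon> * sg (\<epsilon> i)) *\<^sub>s gg (M * sign_mat n \<epsilon>))"
    by (rule sum_gg_smear[symmetric])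
  finally have 2: "\<chi> (a i) *\<^sub>s star n (Z (\<pi> i)) (smear n M f) =
      (\<Sum>\<epsilon>\<in>vecs n. fourier n ?F \<epsilon> *\<^sub>s (\<chi> (a i * sg (\<epsilon> i)) *\<^sub>s (Z (\<pi> i) * gg (M * sign_mat n \<epsilon>))))"
    by (simp add: smul_sum sum_distrib_left \<chi> mult_ac)
  have 3: "fourier n ?F \<epsilon> *\<^sub>s (gg (M * sign_mat n \<epsilon>) * Z i
      - \<chi> (a i * sg (\<epsilon> i)) *\<^sub>s (Z (\<pi> i) * gg (M * sign_mat n \<epsilon>))) \<in> tideal R" for \<epsilon>
  proof (cases "fourier n ?F \<epsilon> = 0")
    case False
    then show ?thesis
      using G[of "\<lambda>k. a k * sg (\<epsilon> k)"] Mf[OF fourier_parity[OF F False]] unfolding M(1) monomat_sign_mat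
      by (intro tideal_smul)
  qed (auto intro: tideal.zero)
  show ?thesis
    unfolding 1 2 unfolding smear_def[of n M ?F] sum_distrib_right sum_subtractf[symmetric]
    by (rule tideal_sum) (use 3 in \<open>simp add: smul_distrib\<close>)
qed

section \<open>The twisting map\<close>

definition perm_sign :: "nat \<Rightarrow> (nat \<Rightarrow> nat) \<Rightarrow> (nat \<Rightarrow> bit) \<Rightarrow> complex" where
  "perm_sign n \<pi> \<delta> = sg (perm_form n \<pi> \<delta>)"

definition twist_letter :: "nat \<Rightarrow> gen \<Rightarrow> gen ncpoly" where
  "twist_letter n l = (case l of XGen j \<Rightarrow> xg j | YGen j \<Rightarrow> yg j
     | GGen M \<Rightarrow> if monomial n M then smear n M (perm_sign n (perm_of n M)) else gg M)"

definition twist_map :: "nat \<Rightarrow> gen ncpoly \<Rightarrow> gen ncpoly" where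
  "twist_map n = word_map (star n) (twist_letter n)"

lemma twist_map_simps:
  "twist_map n (f + g) = twist_map n f + twist_map n g"
  "twist_map n (f - g) = twist_map n f - twist_map n g"
  "twist_map n (c *\<^sub>s f) = c *\<^sub>s twist_map n f"
  "twist_map n (\<Sum>i\<in>A. h i) = (\<Sum>i\<in>A. twist_map n (h i))"
  "twist_map n 1 = 1" "twist_map n 0 = 0"
  by (simp_all add: twist_map_def word_map_add word_map_diff word_map_smul word_map_sum)

lemma twist_map_letter_mult: "twist_map n (letter l * f) = star n (twist_letter n l) (twist_map n f)"
  unfolding twist_map_def by (rule word_map_letter_mult) (simp_all add: star_simps)

lemma twist_map_letter:
  "twist_map n (xg j) = xg j" "twist_map n (yg j) = yg j"
  "monomial n M \<Longrightarrow> twist_map n (gg M) = smear n M (perm_sign n (perm_of n M))"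
  "\<not> monomial n M \<Longrightarrow> twist_map n (gg M) = gg M"
  using twist_map_letter_mult[of n _ 1] by (simp_all add: twist_map_simps star_one twist_letter_def)

lemma twist_map_mult: "twist_map n (f * g) = star n (twist_map n f) (twist_map n g)"
  by (induction f rule: ncpoly_induct)
     (simp_all add: twist_map_letter_mult star_assoc mult.assoc, simp_all add: twist_map_simps
         star_one star_simps distrib_right)

lemma sign_act_twist_map: "sign_act n k (twist_map n f) = twist_map n (sign_act n k f)"
proof (induction f rule: ncpoly_induct)
  case (letter l f)
  have "sign_act n k (twist_map n (letter l)) = twist_map n (sign_act n k (letter l))"
  proof (cases l)
    case (GGen M)
    show ?thesis
    proof (cases "monomial n M")
      case True
      obtain \<pi> a where M: "M = monomat n \<pi> a" "\<pi> permutes {..<n}" "\<And>k. k < n \<Longrightarrow> a k \<noteq> 0"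
        using monomialE[OF True] by metis
      have \<pi>: "perm_of n M permutes {..<n}" by (rule mult_sign_mat(5)[OF True])
      show ?thesis
      proof (cases "k < n")
        case k: True
        let ?\<eta> = "\<lambda>j. unit k (perm_of n M j) + unit k j"
        have \<eta>: "?\<eta> \<in> vecs n"
          by (rule vecs_add[OF vecs_perm[OF vecs_unit[OF k] \<pi>] vecs_unit[OF k]])
        have conj: "sign_conj n k M = M * sign_mat n ?\<eta>"
          using True by (simp add: sign_conj_def mult_sign_mat(1,2)[OF True])
        have "twist_map n (sign_act n k (gg M)) = smear n (M * sign_mat n ?\<eta>) (perm_sign n (perm_of
            n M))"
          by (simp add: sign_act_letter conj twist_map_letter mult_sign_mat(3,4)[OF True])
        also have "\<dots> = sign_act n k (smear n M (perm_sign n (perm_of n M)))"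
          unfolding smear_shift[OF True \<eta>] sign_act_smear[OF True]
          by (rule smear_cong) (simp add: dot_add dot_perm[OF \<pi>] dot_unit k defect_def)
        finally show ?thesis using True GGen by (simp add: twist_map_letter)
      qed (simp add: sign_act_ge)
    next
      case False
      then show ?thesis using GGen by (simp add: twist_map_letter sign_act_letter sign_conj_def)
    qed
  qed (simp_all add: twist_map_letter sign_act_letter twist_map_simps)
  with letter show ?case
    by (simp add: twist_map_mult sign_act_simps sign_act_star)
qed (simp_all add: twist_map_simps sign_act_simps)

lemma weight_twist_map: "weight n \<alpha> f \<Longrightarrow> weight n \<alpha> (twist_map n f)"
  by (simp add: weight_def sign_act_twist_map twist_map_simps)

text \<open>
  Since \<open>twist_map\<close> preserves weights, on weight vectors the sign of the twisted product arises
  twice: from the argument and from the image of an ordinary product. The two cancel.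
\<close>

lemma twist_map_star: "twist_map n (star n f g) = twist_map n f * twist_map n g"
proof (induction f rule: weight_induct[where n = n])
  case (weight \<alpha> f)
  note f = this
  show ?case
  proof (induction g rule: weight_induct[where n = n])
    case (weight \<beta> g)
    show ?case
      by (simp add: star_weight[OF f weight] twist_map_simps twist_map_mult
          star_weight[OF f(1) weight_twist_map[OF f(2)] weight(1) weight_twist_map[OF weight(2)]])
  qed (simp add: star_simps twist_map_simps distrib_left)
qed (simp add: star_simps twist_map_simps distrib_right)

lemma perm_sign_square: "perm_sign n \<pi> \<delta> * perm_sign n \<pi> \<delta> = 1"
  by (simp add: perm_sign_def)

lemma smear_one: "monomial n M \<Longrightarrow> smear n M (\<lambda>\<delta>. 1) = gg M"
proof -
  assume "monomial n M"
  have "sign_mat n (\<lambda>k. 0) = 1\<^sub>m n" by (simp add: sign_mat_def monomat_one)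
  then show ?thesis
    using smear_character[OF vecs_zero, of n M] mult_sign_mat(6)[OF \<open>monomial n M\<close>]
        by (simp add: dot_def)
qed

text \<open>
  Sign matrices commute with \<open>Q\<close>, so \<open>twist_map\<close> acts on every smeared multiple of \<open>M\<close> by
  pointwise multiplication.
\<close>

lemma twist_map_smear:
  assumes M: "monomial n M"
  shows "twist_map n (smear n M f) = smear n M (\<lambda>\<delta>. f \<delta> * perm_sign n (perm_of n M) \<delta>)"
proof -
  let ?s = "perm_sign n (perm_of n M)"
  have "twist_map n (smear n M f) = (\<Sum>\<epsilon>\<in>vecs n. fourier n f \<epsilon> *\<^sub>s smear n M (\<lambda>\<delta>. sg (dot n \<epsilon> \<delta>) * ?s
      \<delta>))"
    unfolding smear_def[of n M f] twist_map_simps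
    by (rule sum.cong[OF refl]) (simp add: twist_map_letter mult_sign_mat(3,4)[OF M] smear_shift[OF M])
  also have "\<dots> = smear n M (\<lambda>\<delta>. f \<delta> * ?s \<delta>)"
    unfolding smear_sum[symmetric]
  proof (rule smear_cong)
    fix \<delta> assume \<delta>: "\<delta> \<in> vecs n"
    show "(\<Sum>\<epsilon>\<in>vecs n. fourier n f \<epsilon> * (sg (dot n \<epsilon> \<delta>) * ?s \<delta>)) = f \<delta> * ?s \<delta>"
      unfolding mult.assoc[symmetric] sum_distrib_right[symmetric] fourier_inversion[OF \<delta>] ..
  qed
  finally show ?thesis .
qed

lemma twist_map_twist_map: "twist_map n (twist_map n f) = f"
proof (induction f rule: ncpoly_induct)
  case (letter l f)
  have "twist_map n (twist_map n (letter l)) = letter l"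
  proof (cases l)
    case (GGen M)
    then show ?thesis
      by (cases "monomial n M") (simp_all add: twist_map_letter twist_map_smear perm_sign_square
          smear_one)
  qed (simp_all add: twist_map_letter)
  with letter show ?case by (simp add: twist_map_mult twist_map_star)
qed (simp_all add: twist_map_simps)

lemma perm_sign_parity:
  assumes "\<pi> permutes {..<n}"
  shows "parity n (of_int (sign \<pi>)) (perm_sign n \<pi>)"
  unfolding parity_def
proof
  fix \<delta>
  have "perm_form n \<pi> (complement n \<delta>) = perm_form n \<pi> (\<lambda>k. \<delta> k + 1)"
    by (rule perm_form_cong) (simp add: complement_def)
  then show "perm_sign n \<pi> (complement n \<delta>) = of_int (sign \<pi>) * perm_sign n \<pi> \<delta>"
    by (simp add: perm_sign_def perm_form_complement[OF assms] sg_add sg_perm_form_ones[OF assms])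
qed

section \<open>The defining relations under the twisting map\<close>

text \<open>
  The sign with which variables of different index commute: \<open>1\<close> in the rational algebra and \<open>-1\<close>
  in the braided one.
\<close>

definition comm_sign :: "bool \<Rightarrow> complex" where
  "comm_sign br = (if br then - 1 else 1)"

lemma comm_sign_simps [simp]: "comm_sign br * comm_sign br = 1" "comm_sign (\<not> br) =
    - comm_sign br" "comm_sign br \<noteq> 0"
  by (simp_all add: comm_sign_def)

definition refl_mat :: "bool \<Rightarrow> nat \<Rightarrow> nat \<Rightarrow> nat \<Rightarrow> complex \<Rightarrow> complex mat" where
  "refl_mat br n i j \<epsilon> = (if br then sigma_mat n i j \<epsilon> else s_mat n i j \<epsilon>)"

lemma refl_mat_monomat:
  "i \<noteq> j \<Longrightarrow> refl_mat br n i j \<epsilon> =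
    monomat n (transpose i j) (\<lambda>k. if k = i then inverse \<epsilon> else if k = j then comm_sign br * \<epsilon> else 1)"
  by (cases br) (simp_all add: refl_mat_def comm_sign_def s_mat_monomat sigma_mat_monomat cong: if_cong)

text \<open>
  One family for both algebras. The parameters of the braided algebra are negated, which is why
  the factor of \<open>c1\<close> is \<open>comm_sign br\<close> in the relation between \<open>y\<^sub>i\<close> and \<open>x\<^sub>j\<close> but constant in
  the one between \<open>y\<^sub>i\<close> and \<open>x\<^sub>i\<close>.
\<close>

definition rels :: "bool \<Rightarrow> nat \<Rightarrow> nat \<Rightarrow> nat \<Rightarrow> complex \<Rightarrow> (complex \<Rightarrow> complex) \<Rightarrow> gen ncpoly set" where
  "rels br m p n c1 c = group_rels n (mgroup br m p n) \<union>
     {xg i * xg j - comm_sign br *\<^sub>s (xg j * xg i) | i j. i < n \<and> j < n \<and> (br \<longrightarrow> i \<noteq> j)} \<union>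
     {yg i * yg j - comm_sign br *\<^sub>s (yg j * yg i) | i j. i < n \<and> j < n \<and> (br \<longrightarrow> i \<noteq> j)} \<union>
     {yg i * xg j - comm_sign br *\<^sub>s (xg j * yg i)
        - (comm_sign br * c1) *\<^sub>s (\<Sum>\<epsilon> \<in> roots1 m. \<epsilon> *\<^sub>s gg (refl_mat br n i j \<epsilon>))
      | i j. i < n \<and> j < n \<and> i \<noteq> j} \<union>
     {yg i * xg i - xg i * yg i
        - (1 - c1 *\<^sub>s (\<Sum>j \<in> {..<n} - {i}. \<Sum>\<epsilon> \<in> roots1 m. gg (refl_mat br n i j \<epsilon>))
             - (\<Sum>\<zeta> \<in> roots1 (m div p) - {1}. c \<zeta> *\<^sub>s gg (t_mat n i \<zeta>)))
      | i. i < n}"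

lemma cherednik_rels_eq: "cherednik_rels m p n c1 c = rels False m p n c1 c"
  by (simp add: cherednik_rels_def rels_def Ggrp_eq comm_sign_def refl_mat_def smul_def[symmetric])

lemma braided_rels_eq: "braided_rels m p n (- c1) (\<lambda>\<zeta>. - c \<zeta>) = rels True m p n c1 c"
  by (simp add: braided_rels_def rels_def muGgrp_eq comm_sign_def refl_mat_def smul_def[symmetric]
      sum_negf)

lemma act_x_monomat:
  assumes "\<pi> permutes {..<n}" "j < n"
  shows "act_x n (monomat n \<pi> a) j = a j *\<^sub>s xg (\<pi> j)"
proof -
  have "\<pi> j < n" using permutes_in_image[OF assms(1), of j] assms(2) by simp
  have "act_x n (monomat n \<pi> a) j = (\<Sum>i<n. if i = \<pi> j then a j *\<^sub>s xg i else 0)"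
    unfolding act_x_def by (rule sum.cong) (auto simp: assms smul_def scal_simps)
  then show ?thesis using \<open>\<pi> j < n\<close> by simp
qed

lemma act_y_monomat:
  assumes \<pi>: "\<pi> permutes {..<n}" and j: "j < n" and a: "\<And>k. k < n \<Longrightarrow> a k \<noteq> 0"
  shows "act_y n (monomat n \<pi> a) j = inverse (a j) *\<^sub>s yg (\<pi> j)"
proof -
  have \<pi>j: "\<pi> j < n" using permutes_in_image[OF \<pi>, of j] j by simp
  have iff: "j = pinv \<pi> i \<longleftrightarrow> i = \<pi> j" for i using permutes_inverses[OF \<pi>] by metis
  have inv: "inv_mat n (monomat n \<pi> a) = monomat n (pinv \<pi>) (\<lambda>k. inverse (a (pinv \<pi> k)))"
    by (rule inv_mat_monomat[OF \<pi> a])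
  have "act_y n (monomat n \<pi> a) j = (\<Sum>i<n. if i = \<pi> j then inverse (a j) *\<^sub>s yg i else 0)"
    unfolding act_y_def inv
    by (rule sum.cong) (auto simp: j iff smul_def scal_simps permutes_inverses[OF \<pi>])
  then show ?thesis using \<pi>j by simp
qed

lemma unit_sym: "unit i k = unit k i"
  by (auto simp: unit_def)

lemma mgroup_monomial: "M \<in> mgroup br m p n \<Longrightarrow> m > 0 \<Longrightarrow> monomial n M"
  by (metis mgroupE monomial_monomat)

lemma mgroup_monomatD:
  assumes "monomat n \<pi> b \<in> mgroup br m p n" "m > 0" "\<pi> permutes {..<n}" "k < n"
  shows "b k \<noteq> 0"
proof -
  obtain \<rho> a where a: "monomat n \<pi> b = monomat n \<rho> a" "\<rho> permutes {..<n}" "\<And>k. k < n \<Longrightarrow> a k \<noteq> 0"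
    using mgroupE[OF assms(1,2)] by metis
  show ?thesis using monomat_eqD(2)[OF a(1)[symmetric] a(2) assms(3) a(3) assms(4)] a(3)[OF
      assms(4)] by metis
qed

lemma mgroup_sign_conj:
  assumes "M \<in> mgroup br m p n" "m > 0" "even m"
  shows "sign_conj n k M \<in> mgroup br m p n"
proof (cases "k < n")
  case True
  have mon: "monomial n M" by (rule mgroup_monomial[OF assms(1,2)])
  let ?\<eta> = "\<lambda>j. unit k (perm_of n M j) + unit k j"
  have \<pi>: "perm_of n M permutes {..<n}" by (rule mult_sign_mat(5)[OF mon])
  have "sign_conj n k M = M * sign_mat n ?\<eta>"
    using mon by (simp add: sign_conj_def mult_sign_mat(1,2)[OF mon])
  moreover have "(\<Sum>j<n. ?\<eta> j) = 0"
    using sum.permute[OF \<pi>, of "unit k"] by (simp add: sum.distrib o_def)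
  ultimately show ?thesis using mgroup_sign_mat[OF assms, of ?\<eta> br] by simp
qed (simp add: sign_conj_ge assms)

lemma refl_mat_mgroup:
  assumes m: "m > 0" "even m" and ij: "i \<noteq> j" "i < n" "j < n" and \<epsilon>: "\<epsilon> \<in> roots1 m"
  shows "refl_mat br n i j \<epsilon> \<in> mgroup br m p n"
proof -
  let ?a = "\<lambda>k. if k = i then inverse \<epsilon> else if k = j then comm_sign br * \<epsilon> else 1"
  have t: "transpose i j permutes {..<n}" using ij by (intro permutes_swap_id) auto
  have e: "\<epsilon> ^ m = 1" using \<epsilon> by (simp add: roots1_def)
  then have "\<epsilon> \<noteq> 0" using m by (auto simp: power_0_left)
  have "comm_sign br ^ m = 1" using m by (auto simp: comm_sign_def)
  then have pow: "?a k ^ m = 1" for k using e by (simp add: power_mult_distrib power_inverse)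
  have "prod ?a {..<n} = prod ?a {i, j}"
    by (rule prod.mono_neutral_right) (use ij in auto)
  also have "\<dots> = comm_sign br" using ij \<open>\<epsilon> \<noteq> 0\<close> by simp
  finally have "(if br then of_int (sign (transpose i j)) else 1) * prod ?a {..<n} = 1"
    using ij by (simp add: comm_sign_def sign_swap_id)
  then show ?thesis
    unfolding refl_mat_monomat[OF ij(1)] mgroup_def using t pow
    by (intro CollectI exI[of _ "transpose i j"] exI[of _ ?a]) simp
qed

lemma t_mat_mgroup:
  assumes "p dvd m" "i < n" "\<zeta> \<in> roots1 (m div p)"
  shows "t_mat n i \<zeta> \<in> mgroup br m p n"
proof -
  have z: "\<zeta> ^ (m div p) = 1" using assms by (simp add: roots1_def)
  \<comment> \<open>A root of unity of order dividing \<open>m / p\<close> is one of order dividing \<open>m\<close>.\<close>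
  have "\<zeta> ^ m = (\<zeta> ^ (m div p)) ^ p" using assms(1) by (simp flip: power_mult)
  then have "\<zeta> ^ m = 1" using z by simp
  moreover have "(\<Prod>k<n. if k = i then \<zeta> else 1) = \<zeta>" using assms(2) by simp
  ultimately show ?thesis
    unfolding t_mat_monomat mgroup_def using z
    by (intro CollectI exI[of _ id] exI[of _ "\<lambda>k. if k = i then \<zeta> else 1"]) (simp add: permutes_id)
qed

lemma sum_roots1_reindex:
  assumes "c * c = 1" "c ^ m = 1"
  shows "(\<Sum>\<epsilon>\<in>roots1 m. f (c * \<epsilon>)) = (\<Sum>\<epsilon>\<in>roots1 m. f \<epsilon>)"
  by (rule sum.reindex_bij_witness[of _ "(*) c" "(*) c"])
     (auto simp: roots1_def power_mult_distrib assms mult.assoc[symmetric])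

text \<open>
  Used with \<open>c = \<plusminus>1\<close>, which is an \<open>m\<close>-th root of unity because \<open>m\<close> is even.
\<close>

lemma sum_roots1_weighted:
  assumes "c * c = 1" "c ^ m = 1"
  shows "(\<Sum>\<epsilon>\<in>roots1 m. \<epsilon> *\<^sub>s h (c * \<epsilon>)) = c *\<^sub>s (\<Sum>\<epsilon>\<in>roots1 m. \<epsilon> *\<^sub>s h \<epsilon>)"
proof -
  have "(\<Sum>\<epsilon>\<in>roots1 m. \<epsilon> *\<^sub>s h (c * \<epsilon>)) = c *\<^sub>s (\<Sum>\<epsilon>\<in>roots1 m. (c * \<epsilon>) *\<^sub>s h (c * \<epsilon>))"
    by (simp add: smul_sum mult.assoc[symmetric] assms(1))
  then show ?thesis using sum_roots1_reindex[OF assms, of "\<lambda>\<epsilon>. \<epsilon> *\<^sub>s h \<epsilon>"] by simp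
qed

lemma sign_conj_refl_mat:
  assumes "i \<noteq> j" "i < n" "j < n" "\<epsilon> \<noteq> 0"
  shows "sign_conj n k (refl_mat br n i j \<epsilon>) = refl_mat br n i j (sg (unit i k + unit j k) * \<epsilon>)"
proof -
  have t: "transpose i j permutes {..<n}" using assms by (intro permutes_swap_id) auto
  show ?thesis
    unfolding refl_mat_monomat[OF assms(1)]
    by (subst sign_conj_monomat[OF t])
       (use assms in \<open>auto intro!: monomat_cong simp: transpose_def unit_sym[of k] add.commute[of
           "unit j k"]\<close>)
qed

text \<open>
  The form of a transposition is a character, so the correction is a single sign matrix: it
  negates the column of the smaller index.
\<close>

lemma twist_map_refl_mat:
  assumes "i \<noteq> j" "i < n" "j < n" "\<epsilon> \<noteq> 0"
  shows "twist_map n (gg (refl_mat br n i j \<epsilon>)) = gg (refl_mat (\<not> br) n i j ((if i < j then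
      - 1 else 1) * \<epsilon>))"
proof -
  let ?a = "\<lambda>k. if k = i then inverse \<epsilon> else if k = j then comm_sign br * \<epsilon> else 1"
  let ?M = "refl_mat br n i j \<epsilon>"
  have t: "transpose i j permutes {..<n}" using assms by (intro permutes_swap_id) auto
  have nz: "?a k \<noteq> 0" for k using assms by simp
  have mon: "monomial n ?M" and perm: "perm_of n ?M = transpose i j"
    unfolding refl_mat_monomat[OF assms(1)] by (rule monomial_monomat[OF t nz], rule
        perm_of_monomat[OF t nz])
  have min: "min i j < n" using assms by simp
  have "perm_sign n (transpose i j) \<delta> = sg (dot n (unit (min i j)) \<delta>)" for \<delta>
    using assms perm_form_transpose[of i j n \<delta>] perm_form_transpose[of j i n \<delta>]
    by (cases i j rule: linorder_cases) (auto simp: perm_sign_def dot_unit transpose_commute min_def)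
  then have "perm_sign n (transpose i j) = (\<lambda>\<delta>. sg (dot n (unit (min i j)) \<delta>))" by blast
  then have "twist_map n (gg ?M) = gg (?M * sign_mat n (unit (min i j)))"
    using smear_character[OF vecs_unit[OF min], of ?M] mon perm by (simp add: twist_map_letter)
  also have "?M * sign_mat n (unit (min i j)) = refl_mat (\<not> br) n i j ((if i < j then - 1 else 1) * \<epsilon>)"
    unfolding refl_mat_monomat[OF assms(1)] monomat_sign_mat
    by (rule monomat_cong) (use assms(1) in \<open>auto simp: unit_def min_def\<close>)
  finally show ?thesis .
qed

lemma twist_map_diag:
  assumes "\<And>k. k < n \<Longrightarrow> a k \<noteq> 0"
  shows "twist_map n (gg (monomat n id a)) = gg (monomat n id a)"
proof -
  have "monomial n (monomat n id a)" "perm_of n (monomat n id a) = id"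
    using assms by (auto intro: monomial_monomat perm_of_monomat permutes_id)
  moreover have "perm_sign n id = (\<lambda>\<delta>. 1)" by (rule ext) (simp add: perm_sign_def perm_form_id)
  ultimately show ?thesis by (simp only: twist_map_letter smear_one)
qed

lemma sign_conj_diag:
  assumes "\<And>k. k < n \<Longrightarrow> a k \<noteq> 0"
  shows "sign_conj n k (monomat n id a) = monomat n id a"
  by (subst sign_conj_monomat[OF permutes_id]) (use assms in auto)

locale cherednik_params =
  fixes m p n :: nat and c1 :: complex and c :: "complex \<Rightarrow> complex"
  assumes m: "m > 0" "even m" and p: "p dvd m"
begin

abbreviation "R br \<equiv> rels br m p n c1 c"
abbreviation "G br \<equiv> mgroup br m p n"
abbreviation "P br \<equiv> polys_over (gens n (G br))"

lemma roots1_nonzero: "\<epsilon> \<in> roots1 m \<Longrightarrow> \<epsilon> \<noteq> 0" "\<zeta> \<in> roots1 (m div p) \<Longrightarrow> \<zeta> \<noteq> 0"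
proof -
  have "m div p > 0" using m(1) p by (metis dvd_div_eq_0_iff neq0_conv)
  then show "\<epsilon> \<in> roots1 m \<Longrightarrow> \<epsilon> \<noteq> 0" "\<zeta> \<in> roots1 (m div p) \<Longrightarrow> \<zeta> \<noteq> 0"
    using m(1) by (auto simp: roots1_def power_0_left)
qed

lemma letters_in_P:
  "i < n \<Longrightarrow> xg i \<in> P br" "i < n \<Longrightarrow> yg i \<in> P br" "M \<in> G br \<Longrightarrow> gg M \<in> P br"
  by (auto intro!: polys_over_letter simp: gens_def)

lemma rels_subset: "R br \<subseteq> P br"
  unfolding rels_def group_rels_def act_x_def act_y_def
  by (intro Un_least subsetI; clarsimp;
      intro polys_over_diff polys_over_mult polys_over_one polys_over_smul polys_over_sum
          polys_over_scal letters_in_P;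
      simp add: mgroup_mult mgroup_one m p refl_mat_mgroup t_mat_mgroup)

lemma
  group_rel: "g \<in> G br \<Longrightarrow> h \<in> G br \<Longrightarrow> gg g * gg h - gg (g * h) \<in> tideal (R br)"
  and one_rel: "gg (1\<^sub>m n) - 1 \<in> tideal (R br)"
  and x_rel: "i < n \<Longrightarrow> \<pi> permutes {..<n} \<Longrightarrow> monomat n \<pi> a \<in> G br \<Longrightarrow>
    gg (monomat n \<pi> a) * xg i - a i *\<^sub>s (xg (\<pi> i) * gg (monomat n \<pi> a)) \<in> tideal (R br)"
  and y_rel: "i < n \<Longrightarrow> \<pi> permutes {..<n} \<Longrightarrow> monomat n \<pi> a \<in> G br \<Longrightarrow>
    gg (monomat n \<pi> a) * yg i - inverse (a i) *\<^sub>s (yg (\<pi> i) * gg (monomat n \<pi> a)) \<in> tideal (R br)"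
proof -
  show "g \<in> G br \<Longrightarrow> h \<in> G br \<Longrightarrow> gg g * gg h - gg (g * h) \<in> tideal (R br)"
    "gg (1\<^sub>m n) - 1 \<in> tideal (R br)"
    by (rule tideal.base; auto simp: rels_def group_rels_def)+
  show "gg (monomat n \<pi> a) * xg i - a i *\<^sub>s (xg (\<pi> i) * gg (monomat n \<pi> a)) \<in> tideal (R br)"
    if "i < n" "\<pi> permutes {..<n}" "monomat n \<pi> a \<in> G br"
  proof -
    have "gg (monomat n \<pi> a) * xg i - act_x n (monomat n \<pi> a) i * gg (monomat n \<pi> a) \<in> R br"
      using that unfolding rels_def group_rels_def by blast
    then show ?thesis unfolding act_x_monomat[OF that(2,1)] by (simp add: tideal.base)
  qed
  show "gg (monomat n \<pi> a) * yg i - inverse (a i) *\<^sub>s (yg (\<pi> i) * gg (monomat n \<pi> a)) \<in> tideal (R br)"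
    if "i < n" "\<pi> permutes {..<n}" "monomat n \<pi> a \<in> G br"
  proof -
    have "gg (monomat n \<pi> a) * yg i - act_y n (monomat n \<pi> a) i * gg (monomat n \<pi> a) \<in> R br"
      using that unfolding rels_def group_rels_def by blast
    moreover have "act_y n (monomat n \<pi> a) i = inverse (a i) *\<^sub>s yg (\<pi> i)"
      by (rule act_y_monomat[OF that(2,1)]) (rule mgroup_monomatD[OF that(3) m(1) that(2)])
    ultimately show ?thesis by (simp add: tideal.base)
  qed
qed

lemma
  xx_rel: "i < n \<Longrightarrow> j < n \<Longrightarrow> br \<longrightarrow> i \<noteq> j \<Longrightarrow> xg i * xg j - comm_sign br *\<^sub>s (xg j * xg i) \<in> tideal (R br)"
  and yy_rel: "i < n \<Longrightarrow> j < n \<Longrightarrow> br \<longrightarrow> i \<noteq> j \<Longrightarrow> yg i * yg j - comm_sign br *\<^sub>s (yg j * yg i)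
      \<in> tideal (R br)"
  and yx_rel: "i < n \<Longrightarrow> j < n \<Longrightarrow> i \<noteq> j \<Longrightarrow> yg i * xg j - comm_sign br *\<^sub>s (xg j * yg i)
        - (comm_sign br * c1) *\<^sub>s (\<Sum>\<epsilon> \<in> roots1 m. \<epsilon> *\<^sub>s gg (refl_mat br n i j \<epsilon>)) \<in> tideal (R br)"
  and diag_rel: "i < n \<Longrightarrow> yg i * xg i - xg i * yg i
        - (1 - c1 *\<^sub>s (\<Sum>j \<in> {..<n} - {i}. \<Sum>\<epsilon> \<in> roots1 m. gg (refl_mat br n i j \<epsilon>))
             - (\<Sum>\<zeta> \<in> roots1 (m div p) - {1}. c \<zeta> *\<^sub>s gg (t_mat n i \<zeta>))) \<in> tideal (R br)"
  by (rule tideal.base; unfold rels_def; blast)+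

text \<open>
  In the relations between group elements and variables the action is evaluated on monomial
  matrices.
\<close>

lemma rels_cases [consumes 1, case_names group one x y xx yy yx diag]:
  assumes "r \<in> R br"
    and "\<And>g h. r = gg g * gg h - gg (g * h) \<Longrightarrow> g \<in> G br \<Longrightarrow> h \<in> G br \<Longrightarrow> thesis"
    and "r = gg (1\<^sub>m n) - 1 \<Longrightarrow> thesis"
    and "\<And>\<pi> a i. r = gg (monomat n \<pi> a) * xg i - a i *\<^sub>s (xg (\<pi> i) * gg (monomat n \<pi> a)) \<Longrightarrow>
      \<pi> permutes {..<n} \<Longrightarrow> monomat n \<pi> a \<in> G br \<Longrightarrow> \<forall>k<n. a k \<noteq> 0 \<Longrightarrow> i < n \<Longrightarrow> thesis"
    and "\<And>\<pi> a i. r = gg (monomat n \<pi> a) * yg i - inverse (a i) *\<^sub>s (yg (\<pi> i) * gg (monomat n \<pi> a)) \<Longrightarrow>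
      \<pi> permutes {..<n} \<Longrightarrow> monomat n \<pi> a \<in> G br \<Longrightarrow> \<forall>k<n. a k \<noteq> 0 \<Longrightarrow> i < n \<Longrightarrow> thesis"
    and "\<And>i j. r = xg i * xg j - comm_sign br *\<^sub>s (xg j * xg i) \<Longrightarrow> i < n \<Longrightarrow> j < n \<Longrightarrow> br \<longrightarrow> i \<noteq> j \<Longrightarrow> thesis"
    and "\<And>i j. r = yg i * yg j - comm_sign br *\<^sub>s (yg j * yg i) \<Longrightarrow> i < n \<Longrightarrow> j < n \<Longrightarrow> br \<longrightarrow> i \<noteq> j \<Longrightarrow> thesis"
    and "\<And>i j. r = yg i * xg j - comm_sign br *\<^sub>s (xg j * yg i)
        - (comm_sign br * c1) *\<^sub>s (\<Sum>\<epsilon> \<in> roots1 m. \<epsilon> *\<^sub>s gg (refl_mat br n i j \<epsilon>)) \<Longrightarrow> i < n \<Longrightarrow> j < n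
            \<Longrightarrow> i \<noteq> j \<Longrightarrow> thesis"
    and "\<And>i. r = yg i * xg i - xg i * yg i
        - (1 - c1 *\<^sub>s (\<Sum>j \<in> {..<n} - {i}. \<Sum>\<epsilon> \<in> roots1 m. gg (refl_mat br n i j \<epsilon>))
             - (\<Sum>\<zeta> \<in> roots1 (m div p) - {1}. c \<zeta> *\<^sub>s gg (t_mat n i \<zeta>))) \<Longrightarrow> i < n \<Longrightarrow> thesis"
  shows thesis
proof -
  have act: thesis if gi: "g \<in> G br" "i < n"
    and r: "r = gg g * xg i - act_x n g i * gg g \<or> r = gg g * yg i - act_y n g i * gg g" for g i
  proof -
    obtain \<pi> a where g: "g = monomat n \<pi> a" "\<pi> permutes {..<n}" "\<And>k. k < n \<Longrightarrow> a k \<noteq> 0"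
      using mgroupE[OF gi(1) m(1)] by metis
    have y: "act_y n (monomat n \<pi> a) i = inverse (a i) *\<^sub>s yg (\<pi> i)"
      by (rule act_y_monomat[OF g(2) gi(2) g(3)])
    show thesis
      using r unfolding g(1) y act_x_monomat[OF g(2) gi(2)] smul_simps
      using assms(4)[of \<pi> a i] assms(5)[of \<pi> a i] g gi by blast
  qed
  show thesis
    using assms(1) unfolding rels_def group_rels_def Un_iff
    by (elim disjE; (elim CollectE exE conjE)?) (use act assms(2,3,6-9) in \<open>blast+\<close>)
qed

lemma sg_mult_left [simp]: "sg b * (sg b * z) = z"
  by (simp add: mult.assoc[symmetric])

lemma sg_pow_m: "sg b ^ m = 1"
  using m by (auto simp: sg_def)

lemma sum_sign_conj_refl:
  assumes ij: "i \<noteq> j" "i < n" "j < n"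
  shows "(\<Sum>\<epsilon>\<in>roots1 m. \<epsilon> *\<^sub>s gg (sign_conj n k (refl_mat br n i j \<epsilon>)))
      = sg (unit i k + unit j k) *\<^sub>s (\<Sum>\<epsilon>\<in>roots1 m. \<epsilon> *\<^sub>s gg (refl_mat br n i j \<epsilon>))"
    "(\<Sum>\<epsilon>\<in>roots1 m. gg (sign_conj n k (refl_mat br n i j \<epsilon>))) = (\<Sum>\<epsilon>\<in>roots1 m. gg (refl_mat br n i j \<epsilon>))"
proof -
  have conj: "sign_conj n k (refl_mat br n i j \<epsilon>) = refl_mat br n i j (sg (unit i k + unit j k) * \<epsilon>)"
    if "\<epsilon> \<in> roots1 m" for \<epsilon>
    by (rule sign_conj_refl_mat[OF ij roots1_nonzero(1)[OF that]])
  show "(\<Sum>\<epsilon>\<in>roots1 m. \<epsilon> *\<^sub>s gg (sign_conj n k (refl_mat br n i j \<epsilon>)))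
      = sg (unit i k + unit j k) *\<^sub>s (\<Sum>\<epsilon>\<in>roots1 m. \<epsilon> *\<^sub>s gg (refl_mat br n i j \<epsilon>))"
    using sum_roots1_weighted[of "sg (unit i k + unit j k)" m "\<lambda>\<epsilon>. gg (refl_mat br n i j \<epsilon>)"]
    by (simp add: conj sg_pow_m)
  show "(\<Sum>\<epsilon>\<in>roots1 m. gg (sign_conj n k (refl_mat br n i j \<epsilon>)))
      = (\<Sum>\<epsilon>\<in>roots1 m. gg (refl_mat br n i j \<epsilon>))"
    using sum_roots1_reindex[of "sg (unit i k + unit j k)" m "\<lambda>\<epsilon>. gg (refl_mat br n i j \<epsilon>)"]
    by (simp add: conj sg_pow_m)
qed

lemma sign_conj_t_mat: "\<zeta> \<in> roots1 (m div p) \<Longrightarrow> sign_conj n k (t_mat n i \<zeta>) = t_mat n i \<zeta>"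
  unfolding t_mat_monomat by (rule sign_conj_diag) (simp add: roots1_nonzero)

lemma sign_conj_mult:
  assumes "g \<in> G br" "h \<in> G br"
  shows "sign_conj n k (g * h) = sign_conj n k g * sign_conj n k h"
proof -
  obtain \<pi> a where g: "g = monomat n \<pi> a" "\<pi> permutes {..<n}" "\<And>k. k < n \<Longrightarrow> a k \<noteq> 0"
    using mgroupE[OF assms(1) m(1)] by metis
  obtain \<rho> b where h: "h = monomat n \<rho> b" "\<rho> permutes {..<n}" "\<And>k. k < n \<Longrightarrow> b k \<noteq> 0"
    using mgroupE[OF assms(2) m(1)] by metis
  have gh: "g * h = monomat n (\<pi> \<circ> \<rho>) (\<lambda>k. a (\<rho> k) * b k)" unfolding g(1) h(1)
      by (rule monomat_mult[OF h(2)])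
  have nz: "a (\<rho> l) * b l \<noteq> 0" if "l < n" for l
    using that g(3)[of "\<rho> l"] h(3) permutes_in_image[OF h(2), of l] by simp
  have eq: "sign_conj n k (g * h) = monomat n (\<pi> \<circ> \<rho>) (\<lambda>j. a (\<rho> j) * b j * sg (unit k ((\<pi> \<circ> \<rho>) j)
      + unit k j))"
    unfolding gh by (rule sign_conj_monomat[OF permutes_compose[OF h(2) g(2)] nz])
  have eg: "sign_conj n k g = monomat n \<pi> (\<lambda>j. a j * sg (unit k (\<pi> j) + unit k j))"
    unfolding g(1) by (rule sign_conj_monomat[OF g(2,3)])
  have eh: "sign_conj n k h = monomat n \<rho> (\<lambda>j. b j * sg (unit k (\<rho> j) + unit k j))"
    unfolding h(1) by (rule sign_conj_monomat[OF h(2,3)])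
  show ?thesis
    unfolding eq eg eh monomat_mult[OF h(2)]
    by (rule monomat_cong) (simp_all add: sg_add mult_ac)
qed

text \<open>
  A sign change maps each relation to a scalar multiple of a relation of the same kind; the sum
  over roots of unity is reindexed when the signs at \<open>i\<close> and \<open>j\<close> differ.
\<close>

lemma sign_act_rels:
  assumes "r \<in> R br"
  shows "sign_act n k r \<in> tideal (R br)"
  using assms
proof (cases rule: rels_cases)
  case (group g h)
  have "sign_conj n k g \<in> G br" "sign_conj n k h \<in> G br" using group mgroup_sign_conj m by auto
  then show ?thesis
    by (simp add: group(1) sign_act_simps sign_act_letter sign_conj_mult[OF group(2,3)] group_rel)
next
  case one
  have "sign_conj n k (1\<^sub>m n) = 1\<^sub>m n" unfolding monomat_one by (rule sign_conj_diag) simp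
  then show ?thesis by (simp add: one sign_act_simps sign_act_letter one_rel)
next
  case (x \<pi> a i)
  have \<pi>i: "\<pi> i < n" using permutes_in_image[OF x(2), of i] x(5) by simp
  let ?b = "\<lambda>j. a j * sg (unit k (\<pi> j) + unit k j)"
  have b: "sign_conj n k (monomat n \<pi> a) = monomat n \<pi> ?b" using x by (intro sign_conj_monomat) auto
  then have G: "monomat n \<pi> ?b \<in> G br" using mgroup_sign_conj[OF x(3) m, of k] by simp
  have "sign_act n k r = sg (unit i k) *\<^sub>s (gg (monomat n \<pi> ?b) * xg i
      - ?b i *\<^sub>s (xg (\<pi> i) * gg (monomat n \<pi> ?b)))"
    by (simp add: x(1) sign_act_simps sign_act_letter b x(5) \<pi>i smul_distrib sg_add unit_sym[of k]
        mult_ac)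
  then show ?thesis using x_rel[OF x(5,2) G] by (simp only: tideal_smul)
next
  case (y \<pi> a i)
  have \<pi>i: "\<pi> i < n" using permutes_in_image[OF y(2), of i] y(5) by simp
  let ?b = "\<lambda>j. a j * sg (unit k (\<pi> j) + unit k j)"
  have b: "sign_conj n k (monomat n \<pi> a) = monomat n \<pi> ?b" using y by (intro sign_conj_monomat) auto
  then have G: "monomat n \<pi> ?b \<in> G br" using mgroup_sign_conj[OF y(3) m, of k] by simp
  have "sign_act n k r = sg (unit i k) *\<^sub>s (gg (monomat n \<pi> ?b) * yg i
      - inverse (?b i) *\<^sub>s (yg (\<pi> i) * gg (monomat n \<pi> ?b)))"
    by (simp add: y(1) sign_act_simps sign_act_letter b y(5) \<pi>i smul_distrib sg_add unit_sym[of k]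
        mult_ac)
  then show ?thesis using y_rel[OF y(5,2) G] by (simp only: tideal_smul)
next
  case (xx i j)
  have "sign_act n k r = (sg (unit i k) * sg (unit j k)) *\<^sub>s (xg i * xg j
      - comm_sign br *\<^sub>s (xg j * xg i))"
    by (simp add: xx(1-3) sign_act_simps sign_act_letter smul_distrib mult_ac)
  then show ?thesis using xx_rel[OF xx(2-4)] by (simp only: tideal_smul)
next
  case (yy i j)
  have "sign_act n k r = (sg (unit i k) * sg (unit j k)) *\<^sub>s (yg i * yg j
      - comm_sign br *\<^sub>s (yg j * yg i))"
    by (simp add: yy(1-3) sign_act_simps sign_act_letter smul_distrib mult_ac)
  then show ?thesis using yy_rel[OF yy(2-4)] by (simp only: tideal_smul)
next
  case (yx i j)
  have "sign_act n k r = (sg (unit i k) * sg (unit j k)) *\<^sub>s (yg i * xg j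
      - comm_sign br *\<^sub>s (xg j * yg i)
        - (comm_sign br * c1) *\<^sub>s (\<Sum>\<epsilon> \<in> roots1 m. \<epsilon> *\<^sub>s gg (refl_mat br n i j \<epsilon>)))"
    by (simp add: yx(1-3) sign_act_simps sign_act_letter sum_sign_conj_refl(1)[OF yx(4,2,3)]
        smul_distrib sg_add mult_ac)
  then show ?thesis using yx_rel[OF yx(2-4)] by (simp only: tideal_smul)
next
  case (diag i)
  have "(\<Sum>j\<in>{..<n} - {i}. \<Sum>\<epsilon>\<in>roots1 m. gg (sign_conj n k (refl_mat br n i j \<epsilon>)))
      = (\<Sum>j\<in>{..<n} - {i}. \<Sum>\<epsilon>\<in>roots1 m. gg (refl_mat br n i j \<epsilon>))"
    by (rule sum.cong[OF refl], rule sum_sign_conj_refl(2)) (use diag in auto)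
  then have "sign_act n k r = r"
    by (simp add: diag sign_act_simps sign_act_letter sign_conj_t_mat)
  then show ?thesis using assms by (simp add: tideal.base)
qed

lemma sign_act_tideal: "f \<in> tideal (R br) \<Longrightarrow> sign_act n k f \<in> tideal (R br)"
  by (induction rule: tideal.induct) (simp_all add: sign_act_simps sign_act_rels tideal.zero
      tideal.add tideal.left tideal.right)

lemma tact_tideal: "f \<in> tideal (R br) \<Longrightarrow> tact n \<tau> f \<in> tideal (R br)"
proof -
  assume f: "f \<in> tideal (R br)"
  have "foldr (sign_act n) ls f \<in> tideal (R br)" for ls
      by (induction ls) (simp_all add: f sign_act_tideal)
  then show ?thesis by (simp add: tact_def tgrp_act_def)
qed

text \<open>
  The ideal is stable under the sign changes, hence it is an ideal for the twisted product too.
\<close>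

lemma star_tideal:
  "f \<in> tideal (R br) \<Longrightarrow> star n f g \<in> tideal (R br)" "g \<in> tideal (R br) \<Longrightarrow> star n f g \<in> tideal (R br)"
  unfolding star_def by (intro tideal_sum tideal_smul tideal.right tact_tideal, assumption)
    (intro tideal_sum tideal_smul tideal.left tact_tideal, assumption)

lemma G_sign_mat:
  assumes "M \<in> G br" "sg (\<Sum>k<n. \<epsilon> k) = of_int (sign (perm_of n M))"
  shows "M * sign_mat n \<epsilon> \<in> G (\<not> br)"
  by (rule mgroup_sign_mat[OF assms(1) m]) (use assms(2) in simp)

lemma twist_map_gg: "M \<in> G br \<Longrightarrow> twist_map n (gg M) = smear n M (perm_sign n (perm_of n M))"
  by (simp add: twist_map_letter mgroup_monomial m)

lemma perm_sign_step:
  assumes \<pi>: "\<pi> permutes {..<n}" and i: "i < n"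
  shows "sg (order_form n (defect \<pi> (\<lambda>k. \<delta> k + unit i k)) (unit i)) * perm_sign n \<pi> (\<lambda>k. \<delta> k + unit i k)
      = sg (order_form n (unit (\<pi> i)) (defect \<pi> \<delta>)) * perm_sign n \<pi> \<delta>"
proof -
  have "unit i (pinv \<pi> k) = unit (\<pi> i) k" for k
    using permutes_inverses[OF \<pi>] by (auto simp: unit_def)
  then have d: "defect \<pi> (\<lambda>k. \<delta> k + unit i k) = (\<lambda>k. \<delta> (pinv \<pi> k) + \<delta> k + unit (\<pi> i) k + unit i k)"
    by (simp add: defect_def[abs_def] add_ac)
  have d': "defect \<pi> \<delta> = (\<lambda>k. \<delta> (pinv \<pi> k) + \<delta> k)" by (simp add: defect_def[abs_def])
  show ?thesis
    unfolding d d' perm_sign_def perm_form_add_unit[OF \<pi> i] sg_add by (simp add: mult_ac)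
qed

lemma twist_map_letter_rel:
  assumes \<pi>: "\<pi> permutes {..<n}" and M: "monomat n \<pi> a \<in> G br" and a: "\<forall>k<n. a k \<noteq> 0" and i: "i < n"
    and Z: "\<And>j. j < n \<Longrightarrow> weight n (unit j) (Z j)" "\<And>j. twist_map n (Z j) = Z j"
    and rel: "\<And>b. monomat n \<pi> b \<in> G (\<not> br) \<Longrightarrow>
      gg (monomat n \<pi> b) * Z i - \<chi> (b i) *\<^sub>s (Z (\<pi> i) * gg (monomat n \<pi> b)) \<in> tideal (R (\<not> br))"
    and \<chi>: "\<And>x e. \<chi> (x * sg e) = \<chi> x * sg e"
  shows "twist_map n (gg (monomat n \<pi> a) * Z i - \<chi> (a i) *\<^sub>s (Z (\<pi> i) * gg (monomat n \<pi> a)))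
      \<in> tideal (R (\<not> br))"
proof -
  have a': "k < n \<Longrightarrow> a k \<noteq> 0" for k using a by simp
  have p: "perm_of n (monomat n \<pi> a) = \<pi>" by (rule perm_of_monomat[OF \<pi> a'])
  show ?thesis
    unfolding twist_map_simps twist_map_mult Z(2) twist_map_gg[OF M] p
  proof (rule star_smear_letter[OF refl \<pi> a' i Z(1) rel \<chi> perm_sign_parity[OF \<pi>] _ perm_sign_step[OF
      \<pi> i]])
    show "monomat n \<pi> a * sign_mat n \<epsilon> \<in> G (\<not> br)" if "sg (\<Sum>k<n. \<epsilon> k) = of_int (sign \<pi>)" for \<epsilon>
      by (rule G_sign_mat[OF M]) (simp add: p that)
  qed
qed

lemma twist_map_group_rel:
  assumes g: "g \<in> G br" and h: "h \<in> G br"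
  shows "twist_map n (gg g * gg h - gg (g * h)) \<in> tideal (R (\<not> br))"
proof -
  let ?\<pi> = "perm_of n g" and ?\<rho> = "perm_of n h"
  have mg: "monomial n g" and mh: "monomial n h" using g h mgroup_monomial m by auto
  have \<pi>: "?\<pi> permutes {..<n}" and \<rho>: "?\<rho> permutes {..<n}" using mult_sign_mat(5) mg mh by auto
  have p: "perm_of n (g * h) = ?\<pi> \<circ> ?\<rho>"
  proof -
    obtain \<pi>' a where ga: "g = monomat n \<pi>' a" "\<pi>' permutes {..<n}" "\<And>k. k < n \<Longrightarrow> a k \<noteq> 0"
      using monomialE[OF mg] by metis
    obtain \<rho>' b where hb: "h = monomat n \<rho>' b" "\<rho>' permutes {..<n}" "\<And>k. k < n \<Longrightarrow> b k \<noteq> 0"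
      using monomialE[OF mh] by metis
    have "?\<pi> = \<pi>'" "?\<rho> = \<rho>'" unfolding ga(1) hb(1)
      by (rule perm_of_monomat[OF ga(2,3)], assumption, rule perm_of_monomat[OF hb(2,3)])
    moreover have "a (\<rho>' l) * b l \<noteq> 0" if "l < n" for l
      using that ga(3)[of "\<rho>' l"] hb(3) permutes_in_image[OF hb(2), of l] by simp
    ultimately show ?thesis
      unfolding ga(1) hb(1) monomat_mult[OF hb(2)]
      using perm_of_monomat[OF permutes_compose[OF hb(2) ga(2)], of "\<lambda>k. a (\<rho>' k) * b k"] by simp
  qed
  have gh: "g * h \<in> G br" by (rule mgroup_mult[OF g h m(1)])
  have "star n (smear n g (perm_sign n ?\<pi>)) (smear n h (perm_sign n ?\<rho>)) -
    smear n (g * h) (\<lambda>\<delta>. sg (order_form n (defect ?\<pi> (\<lambda>k. \<delta> (pinv ?\<rho> k))) (defect ?\<rho> \<delta>)) *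
      (perm_sign n ?\<pi> (\<lambda>k. \<delta> (pinv ?\<rho> k)) * perm_sign n ?\<rho> \<delta>)) \<in> tideal (R (\<not> br))"
    by (rule star_smear[OF mg mh group_rel perm_sign_parity[OF \<pi>] perm_sign_parity[OF \<rho>]
        G_sign_mat[OF g] G_sign_mat[OF h]])
  also have "(\<lambda>\<delta>. sg (order_form n (defect ?\<pi> (\<lambda>k. \<delta> (pinv ?\<rho> k))) (defect ?\<rho> \<delta>)) *
      (perm_sign n ?\<pi> (\<lambda>k. \<delta> (pinv ?\<rho> k)) * perm_sign n ?\<rho> \<delta>)) = perm_sign n (?\<pi> \<circ> ?\<rho>)"
    by (rule ext) (simp only: perm_sign_def perm_form_compose[OF \<pi> \<rho>] sg_add defect_def[abs_def]
        mult_ac)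
  finally show ?thesis
    by (simp only: twist_map_simps twist_map_mult twist_map_gg[OF g] twist_map_gg[OF h]
        twist_map_gg[OF gh] p)
qed

lemma order_form_unit:
  assumes "i < n" "j < n"
  shows "order_form n (unit i) (unit j) = of_bool (j < i)"
  using assms sum_mult_unit[of j n "\<lambda>j. of_bool (j < i)"] by (simp only: order_form_def bilin_unit_left)

lemma star_letters:
  assumes "i < n" "j < n"
  shows "star n (xg i) (xg j) = sg (of_bool (j < i)) *\<^sub>s (xg i * xg j)"
    "star n (yg i) (yg j) = sg (of_bool (j < i)) *\<^sub>s (yg i * yg j)"
    "star n (yg i) (xg j) = sg (of_bool (j < i)) *\<^sub>s (yg i * xg j)"
    "star n (xg i) (yg j) = sg (of_bool (j < i)) *\<^sub>s (xg i * yg j)"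
  by (simp_all add: star_weight[OF vecs_unit[OF assms(1)] _ vecs_unit[OF assms(2)]] weight_x
      weight_y assms order_form_unit)

lemma sg_less_swap: "i \<noteq> j \<Longrightarrow> sg (of_bool (i < j)) = - sg (of_bool ((j::nat) < i))"
  by (cases i j rule: linorder_cases) auto

text \<open>
  For \<open>i < j\<close> the twisting map negates the parameter of a reflection. Reindexing the sum turns
  this into a factor, which accounts for the change of the commutation sign in the relation
  between \<open>y\<^sub>i\<close> and \<open>x\<^sub>j\<close>.
\<close>

lemma twist_map_sum_refl:
  assumes ij: "i \<noteq> j" "i < n" "j < n"
  shows "(\<Sum>\<epsilon>\<in>roots1 m. \<epsilon> *\<^sub>s twist_map n (gg (refl_mat br n i j \<epsilon>)))
      = (- sg (of_bool (j < i))) *\<^sub>s (\<Sum>\<epsilon>\<in>roots1 m. \<epsilon> *\<^sub>s gg (refl_mat (\<not> br) n i j \<epsilon>))"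
    "(\<Sum>\<epsilon>\<in>roots1 m. twist_map n (gg (refl_mat br n i j \<epsilon>)))
        = (\<Sum>\<epsilon>\<in>roots1 m. gg (refl_mat (\<not> br) n i j \<epsilon>))"
proof -
  let ?c = "- sg (of_bool (j < i))"
  have c: "(if i < j then - 1 else 1) = ?c" using ij by auto
  have c2: "?c * ?c = 1" "?c ^ m = 1" using m sg_pow_m by (simp_all add: power_minus_even)
  have t: "twist_map n (gg (refl_mat br n i j \<epsilon>)) = gg (refl_mat (\<not> br) n i j (?c * \<epsilon>))"
    if "\<epsilon> \<in> roots1 m" for \<epsilon>
    using twist_map_refl_mat[OF ij roots1_nonzero(1)[OF that]] unfolding c .
  show "(\<Sum>\<epsilon>\<in>roots1 m. \<epsilon> *\<^sub>s twist_map n (gg (refl_mat br n i j \<epsilon>)))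
      = ?c *\<^sub>s (\<Sum>\<epsilon>\<in>roots1 m. \<epsilon> *\<^sub>s gg (refl_mat (\<not> br) n i j \<epsilon>))"
    unfolding sum_roots1_weighted[OF c2, of "\<lambda>\<epsilon>. gg (refl_mat (\<not> br) n i j \<epsilon>)", symmetric]
    by (rule sum.cong[OF refl]) (simp only: t)
  show "(\<Sum>\<epsilon>\<in>roots1 m. twist_map n (gg (refl_mat br n i j \<epsilon>)))
      = (\<Sum>\<epsilon>\<in>roots1 m. gg (refl_mat (\<not> br) n i j \<epsilon>))"
    unfolding sum_roots1_reindex[OF c2, of "\<lambda>\<epsilon>. gg (refl_mat (\<not> br) n i j \<epsilon>)", symmetric]
    by (rule sum.cong[OF refl]) (simp only: t)
qed

text \<open>
  Relations between variables of distinct index, and those between \<open>y\<^sub>i\<close> and \<open>x\<^sub>i\<close>, go to \<open>\<plusminus>1\<close>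
  times the relation of the same kind for the other sign.
\<close>

lemma twist_map_rels:
  assumes "r \<in> R br"
  shows "twist_map n r \<in> tideal (R (\<not> br))"
  using assms
proof (cases rule: rels_cases)
  case (group g h)
  then show ?thesis using twist_map_group_rel by simp
next
  case one
  have "twist_map n (gg (1\<^sub>m n)) = gg (1\<^sub>m n)" unfolding monomat_one by (rule twist_map_diag) simp
  then show ?thesis by (simp add: one twist_map_simps one_rel)
next
  case (x \<pi> a i)
  show ?thesis
    unfolding x(1)
    by (rule twist_map_letter_rel[OF x(2-5), where \<chi>
        = "\<lambda>x. x"]) (simp_all add: weight_x twist_map_letter x_rel x)
next
  case (y \<pi> a i)
  show ?thesis
    unfolding y(1)
    by (rule twist_map_letter_rel[OF y(2-5), where \<chi>
        = inverse]) (simp_all add: weight_y twist_map_letter y_rel y)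
next
  case (xx i j)
  show ?thesis
  proof (cases "i = j")
    case True
    then show ?thesis using xx by (simp add: comm_sign_def tideal.zero twist_map_simps)
  next
    case False
    have "twist_map n r = sg (of_bool (j < i)) *\<^sub>s (xg i * xg j - comm_sign (\<not> br) *\<^sub>s (xg j * xg i))"
      by (simp add: xx(1-3) twist_map_simps twist_map_mult twist_map_letter star_letters smul_distrib
          sg_less_swap[OF False] mult_ac)
    then show ?thesis using xx_rel[OF xx(2,3), of "\<not> br"] False
        by (simp only: tideal_smul simp_thms not_False_eq_True)
  qed
next
  case (yy i j)
  show ?thesis
  proof (cases "i = j")
    case True
    then show ?thesis using yy by (simp add: comm_sign_def tideal.zero twist_map_simps)
  next
    case False
    have "twist_map n r = sg (of_bool (j < i)) *\<^sub>s (yg i * yg j - comm_sign (\<not> br) *\<^sub>s (yg j * yg i))"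
      by (simp add: yy(1-3) twist_map_simps twist_map_mult twist_map_letter star_letters smul_distrib
          sg_less_swap[OF False] mult_ac)
    then show ?thesis using yy_rel[OF yy(2,3), of "\<not> br"] False
        by (simp only: tideal_smul simp_thms not_False_eq_True)
  qed
next
  case (yx i j)
  have "twist_map n r = sg (of_bool (j < i)) *\<^sub>s (yg i * xg j - comm_sign (\<not> br) *\<^sub>s (xg j * yg i)
        - (comm_sign (\<not> br) * c1) *\<^sub>s (\<Sum>\<epsilon> \<in> roots1 m. \<epsilon> *\<^sub>s gg (refl_mat (\<not> br) n i j \<epsilon>)))"
    by (simp add: yx(1-3) twist_map_simps twist_map_mult twist_map_letter(1,2) star_letters smul_distrib
        sg_less_swap[OF yx(4)] twist_map_sum_refl(1)[OF yx(4,2,3)] mult_ac)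
  then show ?thesis using yx_rel[OF yx(2-4), of "\<not> br"] by (simp only: tideal_smul)
next
  case (diag i)
  have 1: "(\<Sum>j\<in>{..<n} - {i}. \<Sum>\<epsilon>\<in>roots1 m. twist_map n (gg (refl_mat br n i j \<epsilon>)))
      = (\<Sum>j\<in>{..<n} - {i}. \<Sum>\<epsilon>\<in>roots1 m. gg (refl_mat (\<not> br) n i j \<epsilon>))"
    by (rule sum.cong[OF refl], rule twist_map_sum_refl(2)) (use diag in auto)
  have 2: "(\<Sum>\<zeta>\<in>roots1 (m div p) - {1}. c \<zeta> *\<^sub>s twist_map n (gg (t_mat n i \<zeta>)))
      = (\<Sum>\<zeta>\<in>roots1 (m div p) - {1}. c \<zeta> *\<^sub>s gg (t_mat n i \<zeta>))"
    by (rule sum.cong[OF refl]) (simp add: t_mat_monomat, subst twist_map_diag, auto simp: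
        roots1_nonzero)
  have "twist_map n r = yg i * xg i - xg i * yg i
        - (1 - c1 *\<^sub>s (\<Sum>j \<in> {..<n} - {i}. \<Sum>\<epsilon> \<in> roots1 m. gg (refl_mat (\<not> br) n i j \<epsilon>))
             - (\<Sum>\<zeta> \<in> roots1 (m div p) - {1}. c \<zeta> *\<^sub>s gg (t_mat n i \<zeta>)))"
    unfolding diag(1) twist_map_simps 1 2 twist_map_mult twist_map_letter(1,2) star_letters[OF
        diag(2) diag(2)] by simp
  then show ?thesis using diag_rel[OF diag(2), of "\<not> br"] by (simp only:)
qed

lemma twist_map_tideal: "f \<in> tideal (R br) \<Longrightarrow> twist_map n f \<in> tideal (R (\<not> br))"
  by (induction rule: tideal.induct)
     (simp_all add: twist_map_simps twist_map_mult twist_map_rels tideal.zero tideal.add star_tideal)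

section \<open>The isomorphism\<close>

lemma gens_iff:
  "XGen j \<in> gens n H \<longleftrightarrow> j < n" "YGen j \<in> gens n H \<longleftrightarrow> j < n" "GGen M \<in> gens n H \<longleftrightarrow> M \<in> H"
  by (auto simp: gens_def)

lemma sign_act_P: "f \<in> P br \<Longrightarrow> sign_act n k f \<in> P br"
proof (induction rule: polys_over_induct)
  case (letter l f)
  have "sign_act n k (letter l) \<in> P br"
    by (cases l) (use letter(1) in \<open>auto simp: gens_iff sign_act_letter mgroup_sign_conj m intro!:
        polys_over_smul letters_in_P\<close>)
  with letter show ?case by (simp add: sign_act_simps polys_over_mult)
qed (simp_all add: sign_act_simps polys_over_add polys_over_smul polys_over_one)

lemma tact_P: "f \<in> P br \<Longrightarrow> tact n \<tau> f \<in> P br"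
proof -
  assume f: "f \<in> P br"
  have "foldr (sign_act n) ls f \<in> P br" for ls by (induction ls) (simp_all add: f sign_act_P)
  then show ?thesis by (simp add: tact_def tgrp_act_def)
qed

lemma star_P: "f \<in> P br \<Longrightarrow> g \<in> P br \<Longrightarrow> star n f g \<in> P br"
  unfolding star_def by (intro polys_over_sum polys_over_smul polys_over_mult tact_P)

lemma twist_map_P: "f \<in> P br \<Longrightarrow> twist_map n f \<in> P (\<not> br)"
proof (induction rule: polys_over_induct)
  case (letter l f)
  have "twist_map n (letter l) \<in> P (\<not> br)"
  proof (cases l)
    case (GGen M)
    then have M: "M \<in> G br" using letter(1) by (simp add: gens_iff)
    have mon: "monomial n M" by (rule mgroup_monomial[OF M m(1)])
    have "fourier n (perm_sign n (perm_of n M)) \<epsilon> *\<^sub>s gg (M * sign_mat n \<epsilon>) \<in> P (\<not> br)" for \<epsilon>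
    proof (cases "fourier n (perm_sign n (perm_of n M)) \<epsilon> = 0")
      case False
      from fourier_parity[OF perm_sign_parity[OF mult_sign_mat(5)[OF mon]] False]
      show ?thesis by (intro polys_over_smul letters_in_P G_sign_mat M)
    qed (simp add: polys_over_zero)
    then show ?thesis unfolding GGen twist_map_gg[OF M] smear_def by (intro polys_over_sum)
  qed (use letter(1) in \<open>auto simp: gens_iff twist_map_letter letters_in_P\<close>)
  with letter show ?case by (simp add: twist_map_mult star_P)
qed (simp_all add: twist_map_simps polys_over_add polys_over_smul polys_over_one)

abbreviation "cls br \<equiv> rel_class (gens n (G br)) (R br)"
abbreviation "alg br \<equiv> presented_algebra (gens n (G br)) (R br)"

lemmas cls_eq_iff = rel_class_eq_iff[OF rels_subset]

lemma gamma_gen_sign_act: "f \<in> P br \<Longrightarrow> free_hom (gamma_gen n k) f = sign_act n k f"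
proof (induction rule: polys_over_induct)
  case (letter l f)
  have "gamma_gen n k l = sign_act n k (letter l)"
  proof (cases l)
    case (XGen j)
    then have j: "j < n" using letter(1) by (simp add: gens_iff)
    show ?thesis
      unfolding XGen gamma_gen.simps t_mat_monomat act_x_monomat[OF permutes_id j]
      using j by (simp add: sign_act_letter unit_def)
  next
    case (YGen j)
    then have j: "j < n" using letter(1) by (simp add: gens_iff)
    have "act_y n (t_mat n k (-1)) j = inverse (if j = k then - 1 else 1) *\<^sub>s yg (id j)"
      unfolding t_mat_monomat by (rule act_y_monomat[OF permutes_id j]) simp
    then show ?thesis
      unfolding YGen gamma_gen.simps using j by (simp add: sign_act_letter unit_def)
  next
    case (GGen M)
    then have "monomial n M" using letter(1) mgroup_monomial[OF _ m(1)] by (auto simp: gens_iff)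
    then show ?thesis unfolding GGen gamma_gen.simps t_mat_sign sign_act_letter
        by (simp add: sign_conj_def)
  qed
  with letter show ?case by (simp add: free_hom_simps sign_act_simps)
qed (simp_all add: free_hom_simps sign_act_simps)

lemma induced_sign_act:
  assumes "f \<in> P br"
  shows "induced (gens n (G br)) (R br) (free_hom (gamma_gen n k)) (cls br f) = cls br (sign_act n k f)"
proof -
  have "induced (gens n (G br)) (R br) (free_hom (gamma_gen n k)) (cls br f)
      = (\<Union>g\<in>cls br f. cls br (sign_act n k g))"
    unfolding induced_def by (rule SUP_cong[OF refl]) (simp add: rel_class_iff[OF rels_subset assms]
        gamma_gen_sign_act[of _ br])
  also have "\<dots> = cls br (sign_act n k f)"
    by (rule UN_rel_class[OF rels_subset assms sign_act_P rels_subset sign_act_simps(2)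
        sign_act_tideal])
  finally show ?thesis .
qed

lemma tgrp_act_class:
  assumes f: "f \<in> P br"
  shows "tgrp_act (\<lambda>k. induced (gens n (G br)) (R br) (free_hom (gamma_gen n k))) \<tau> (cls br f)
      = cls br (tact n \<tau> f)"
proof -
  have "foldr (sign_act n) ls f \<in> P br \<and>
    foldr (\<lambda>k. induced (gens n (G br)) (R br) (free_hom (gamma_gen n k))) ls (cls br f)
        = cls br (foldr (sign_act n) ls f)" for ls
    by (induction ls) (simp_all add: f sign_act_P induced_sign_act)
  then show ?thesis by (simp add: tact_def tgrp_act_def)
qed

abbreviation "twisted br \<equiv>
  twist (alg br) (\<lambda>k. induced (gens n (G br)) (R br) (free_hom (gamma_gen n k))) (Ftw n)"

lemma twisted_mult:
  assumes f: "f \<in> P br" and g: "g \<in> P br"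
  shows "cls br f \<otimes>\<^bsub>twisted br\<^esub> cls br g = cls br (star n f g)"
proof -
  note ops = presented_algebra_ops[OF rels_subset]
  have "cls br f \<otimes>\<^bsub>twisted br\<^esub> cls br g = (\<Oplus>\<^bsub>alg br\<^esub>u\<in>Poly_Mapping.keys (Ftw n).
      cls br (Poly_Mapping.lookup (Ftw n) u *\<^sub>s (tact n (fst u) f * tact n (snd u) g)))"
    unfolding twist_def by (simp add: inv_alg2_Ftw tgrp_act_class f g ops(1) ops(5)[OF _
        polys_over_zero] tact_P polys_over_mult)
  also have "\<dots> = cls br (star n f g)"
    unfolding star_def
    by (rule presented_algebra_finsum[OF rels_subset finite_keys]) (intro polys_over_smul
        polys_over_mult tact_P f g)
  finally show ?thesis .
qed

definition class_map :: "gen ncpoly set \<Rightarrow> gen ncpoly set" where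
  "class_map A = (\<Union>f\<in>A. cls False (twist_map n f))"

lemma class_map_rel_class: "f \<in> P True \<Longrightarrow> class_map (cls True f) = cls False (twist_map n f)"
  unfolding class_map_def
  by (rule UN_rel_class[where h = "twist_map n", OF rels_subset _ _ rels_subset twist_map_simps(2)])
     (use twist_map_P[of _ True] twist_map_tideal[of _ True] in auto)

text \<open>
  Injectivity and surjectivity both come from \<open>twist_map\<close> being an involution that respects the
  ideals in both directions.
\<close>

lemma class_map_alg_iso: "class_map \<in> alg_iso (alg True) (twisted False)"
proof -
  note ops = presented_algebra_ops[OF rels_subset]
  have P: "f \<in> P True \<Longrightarrow> twist_map n f \<in> P False" "f \<in> P False \<Longrightarrow> twist_map n f \<in> P True" for f
    using twist_map_P[of f True] twist_map_P[of f False] by auto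
  have T: "f \<in> tideal (R False) \<Longrightarrow> twist_map n f \<in> tideal (R True)" for f
    using twist_map_tideal[of f False] by simp
  have tw: "carrier (twisted False) = cls False ` P False"
    "\<And>A B. A \<oplus>\<^bsub>twisted False\<^esub> B = A \<oplus>\<^bsub>alg False\<^esub> B" "\<one>\<^bsub>twisted False\<^esub> = \<one>\<^bsub>alg False\<^esub>"
    "\<And>a A. a \<odot>\<^bsub>twisted False\<^esub> A = a \<odot>\<^bsub>alg False\<^esub> A"
    by (simp_all add: twist_def presented_algebra_carrier)
  have "class_map \<in> Ring.ring_hom (alg True) (twisted False)"
  proof (rule ring_hom_memI)
    fix A assume "A \<in> carrier (alg True)"
    then show "class_map A \<in> carrier (twisted False)"
        by (auto simp: presented_algebra_carrier tw class_map_rel_class P)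
  next
    fix A B assume "A \<in> carrier (alg True)" "B \<in> carrier (alg True)"
    then obtain f g where fg: "A = cls True f" "B = cls True g" "f \<in> P True" "g \<in> P True"
      by (auto simp: presented_algebra_carrier)
    show "class_map (A \<otimes>\<^bsub>alg True\<^esub> B) = class_map A \<otimes>\<^bsub>twisted False\<^esub> class_map B"
      unfolding fg(1,2) ops(1)[OF fg(3,4)] class_map_rel_class[OF fg(3)] class_map_rel_class[OF
          fg(4)] twisted_mult[OF P(1)[OF fg(3)] P(1)[OF fg(4)]]
        class_map_rel_class[OF polys_over_mult[OF fg(3,4)]] twist_map_mult ..
    show "class_map (A \<oplus>\<^bsub>alg True\<^esub> B) = class_map A \<oplus>\<^bsub>twisted False\<^esub> class_map B"
      unfolding fg(1,2) tw ops(2)[OF fg(3,4)] class_map_rel_class[OF fg(3)] class_map_rel_class[OF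
          fg(4)] ops(2)[OF P(1)[OF fg(3)] P(1)[OF fg(4)]]
        class_map_rel_class[OF polys_over_add[OF fg(3,4)]] twist_map_simps ..
  next
    show "class_map \<one>\<^bsub>alg True\<^esub> = \<one>\<^bsub>twisted False\<^esub>"
      unfolding tw ops(3)[OF polys_over_one polys_over_one] class_map_rel_class[OF polys_over_one]
          twist_map_simps ..
  qed
  moreover have "bij_betw class_map (carrier (alg True)) (carrier (twisted False))"
    unfolding bij_betw_def
  proof
    show "inj_on class_map (carrier (alg True))"
    proof (rule inj_onI)
      fix A B assume "A \<in> carrier (alg True)" "B \<in> carrier (alg True)" and eq: "class_map A
          = class_map B"
      then obtain f g where fg: "A = cls True f" "B = cls True g" "f \<in> P True" "g \<in> P True"
        by (auto simp: presented_algebra_carrier)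
      have "twist_map n f - twist_map n g \<in> tideal (R False)"
        using eq unfolding fg(1,2) class_map_rel_class[OF fg(3)] class_map_rel_class[OF fg(4)]
            cls_eq_iff[OF P(1)[OF fg(3)] P(1)[OF fg(4)]] .
      from T[OF this] have "f - g \<in> tideal (R True)" by (simp only: twist_map_simps twist_map_twist_map)
      then show "A = B" unfolding fg(1,2) cls_eq_iff[OF fg(3,4)] .
    qed
    show "class_map ` carrier (alg True) = carrier (twisted False)"
    proof (intro equalityI subsetI)
      fix B assume "B \<in> carrier (twisted False)"
      then obtain g where g: "g \<in> P False" "B = cls False g" by (auto simp: tw)
      then have "B = class_map (cls True (twist_map n g))"
          by (simp only: class_map_rel_class[OF P(2)] twist_map_twist_map)
      then show "B \<in> class_map ` carrier (alg True)" using P(2)[OF g(1)]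
          by (auto simp: presented_algebra_carrier)
    qed (auto simp: presented_algebra_carrier tw class_map_rel_class P)
  qed
  moreover have "class_map (a \<odot>\<^bsub>alg True\<^esub> A) = a \<odot>\<^bsub>twisted False\<^esub> class_map A"
      if A: "A \<in> carrier (alg True)" for a A
  proof -
    obtain f where f: "A = cls True f" "f \<in> P True" using A by (auto simp: presented_algebra_carrier)
    show ?thesis
      unfolding f(1) tw ops(5)[OF f(2) f(2)] class_map_rel_class[OF f(2)] ops(5)[OF P(1)[OF f(2)]
          P(1)[OF f(2)]]
        class_map_rel_class[OF polys_over_smul[OF f(2)]] twist_map_simps ..
  qed
  ultimately show ?thesis by (simp add: alg_iso_def ring_iso_def)
qed

end

theorem theorem5p2:
  fixes m p n :: nat and c1 :: complex and c :: "complex \<Rightarrow> complex"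
  assumes "m > 0" and "even m" and "p > 0" and "p dvd m"
    and "n \<ge> 3 \<or> (n = 2 \<and> odd p)"
  shows "\<exists>\<phi> \<in> alg_iso (braided m p n (- c1) (\<lambda>\<zeta>. - c \<zeta>)) (twisted_cherednik m p n c1 c).
     (\<forall>i. Suc i < n \<longrightarrow>
        \<phi> (braided_class m p n (- c1) (\<lambda>\<zeta>. - c \<zeta>) (gg (sigma_mat n i (Suc i) 1)))
        = cherednik_class m p n c1 c (gg (s_mat n i (Suc i) (-1)))) \<and>
     (\<forall>t \<in> Tgrp m p n.
        \<phi> (braided_class m p n (- c1) (\<lambda>\<zeta>. - c \<zeta>) (gg t)) = cherednik_class m p n c1 c (gg t)) \<and>
     (\<forall>j<n. \<phi> (braided_class m p n (- c1) (\<lambda>\<zeta>. - c \<zeta>) (xg j)) = cherednik_class m p n c1 c (xg j)) \<and>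
     (\<forall>j<n. \<phi> (braided_class m p n (- c1) (\<lambda>\<zeta>. - c \<zeta>) (yg j)) = cherednik_class m p n c1 c (yg j))"
proof -
  interpret cherednik_params m p n c1 c by unfold_locales (use assms in auto)
  have alg: "braided m p n (- c1) (\<lambda>\<zeta>. - c \<zeta>) = alg True"
    unfolding braided_def braided_rels_eq muGgrp_eq ..
  have tw: "twisted_cherednik m p n c1 c = twisted False"
    by (simp add: twisted_cherednik_def cherednik_def gamma_act_def[abs_def] cherednik_rels_eq Ggrp_eq)
  have cls: "braided_class m p n (- c1) (\<lambda>\<zeta>. - c \<zeta>) = cls True" "cherednik_class m p n c1 c = cls False"
    by (simp_all add: braided_class_def[abs_def] cherednik_class_def[abs_def] braided_rels_eq
        cherednik_rels_eq muGgrp_eq Ggrp_eq)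
  show ?thesis
    unfolding alg tw cls
  proof (intro bexI[OF _ class_map_alg_iso] conjI allI ballI impI)
    fix i assume i: "Suc i < n"
    have "sigma_mat n i (Suc i) 1 \<in> G True"
      using refl_mat_mgroup[of m i "Suc i" n 1 True p] i m by (simp add: refl_mat_def roots1_def)
    then have "class_map (cls True (gg (sigma_mat n i (Suc i) 1)))
        = cls False (twist_map n (gg (sigma_mat n i (Suc i) 1)))"
      by (intro class_map_rel_class letters_in_P)
    then show "class_map (cls True (gg (sigma_mat n i (Suc i) 1)))
        = cls False (gg (s_mat n i (Suc i) (-1)))"
      using twist_map_refl_mat[of i "Suc i" n 1 True] i by (simp add: refl_mat_def)
  next
    fix t assume "t \<in> Tgrp m p n"
    then obtain a where a: "t = monomat n id a" "\<forall>k<n. a k ^ m = 1" "(\<Prod>k<n. a k) ^ (m div p) = 1"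
      unfolding Tgrp_eq by blast
    then have "t \<in> G True"
      unfolding mgroup_def by (intro CollectI exI[of _ id] exI[of _ a]) (simp add: permutes_id)
    moreover have "a k \<noteq> 0" if "k < n" for k using a(2) that m(1) by (auto simp: power_0_left)
    ultimately show "class_map (cls True (gg t)) = cls False (gg t)"
      using class_map_rel_class[OF letters_in_P(3)] twist_map_diag[of n a] by (simp add: a(1))
  qed (simp_all add: class_map_rel_class letters_in_P twist_map_letter)
qed

end
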